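(* Let $n\geq 2$ and $p\leq n-1$, and let $f\colon M^{2n}\to\mathbb{H}^{2n+p}_{-1}$ be an isometric immersion of a Kaehler manifold $(M^{2n},J)$ of real dimension $2n$ into the hyperbolic space of constant sectional curvature $-1$. Assume that at some point $x_0\in M^{2n}$ there is a complex (that is, $J$-invariant) vector subspace $V^{2m}\subset T_{x_0}M$ of real dimension $2m$ with $m\geq p$ such that the sectional curvature of $M^{2n}$ satisfies $K(S,JS)>0$ for any $0\neq S\in V^{2m}$. Then $p=n-1$ and, up to an isometry of $\mathbb{H}^{3n-1}_{-1}$, $f(M)$ is an open subset of one of the following submanifolds of $\mathbb{H}^{3n-1}_{-1}$: there are constants $c_1<0$ and $c_2,\ldots,c_n>0$ with $1/c_1+\cdots+1/c_n=-1$ such that the submanifold is the extrinsic product $$\mathbb{H}^2_{c_1}\times\mathbb{S}^2_{c_2}\times\cdots\times\mathbb{S}^2_{c_n}\subset\mathbb{H}^{3n-1}_{-1}\subset\mathbb{L}^{3n}=\mathbb{L}^3\times\mathbb{R}^3\times\cdots\times\mathbb{R}^3$$ of the umbilical surfaces $\mathbb{H}^2_{c_1}\subset\mathbb{L}^3$ and $\mathbb{S}^2_{c_j}\subset\mathbb{R}^3$, $2\leq j\leq n$.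
   Context: A Kaehler manifold $(M^{2n},J)$ is a (connected) Riemannian manifold of real dimension $2n$ with an orthogonal almost complex structure $J$ that is parallel with respect to the Levi-Civita connection. $K(S,JS)$ is the sectional curvature of the plane spanned by $S$ and $JS$. $\mathbb{L}^{N}$ is the flat Lorentzian space of dimension $N$, and $\mathbb{H}^{N-1}_{-1}\subset\mathbb{L}^N$ is the standard hyperboloid model $\{\langle x,x\rangle=-1\}$ (one sheet). $\mathbb{H}^2_{c_1}\subset\mathbb{L}^3$ is (one sheet of) $\{\langle x,x\rangle=1/c_1\}$, of constant curvature $c_1<0$, and $\mathbb{S}^2_{c_j}\subset\mathbb{R}^3$ is the round sphere $\{\langle x,x\rangle=1/c_j\}$, of constant curvature $c_j>0$. The extrinsic product of the inclusions $g_1,\ldots,g_n$ of these surfaces is $g(x_1,\ldots,x_n)=(g_1(x_1),\ldots,g_n(x_n))$; the condition $1/c_1+\cdots+1/c_n=-1$ ensures that its image lies in $\mathbb{H}^{3n-1}_{-1}$. *)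

theory Defs
  imports "HOL-Analysis.Analysis" "HOL-Library.Function_Algebras"
begin

section \<open>Smooth maps between normed spaces\<close>

text \<open>The real vector space structure on functions; tangent vectors are encoded as functions below.\<close>

instantiation "fun" :: (type, real_vector) real_vector
begin

definition scaleR_fun_def: "scaleR r f = (\<lambda>x. r *\<^sub>R f x)"

instance
  by standard (auto simp: scaleR_fun_def plus_fun_def fun_eq_iff algebra_simps)

end

text \<open>These are the usual notions of class \<open>C\<^sup>k\<close> and \<open>C\<^sup>\<infinity>\<close> when \<open>S\<close> is open,
  the only case used here.\<close>

primrec Ck_on :: "nat \<Rightarrow> ('a::real_normed_vector \<Rightarrow> 'b::real_normed_vector) \<Rightarrow> 'a set \<Rightarrow> bool" where
  "Ck_on 0 f S \<longleftrightarrow> continuous_on S f"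
| "Ck_on (Suc k) f S \<longleftrightarrow>
     (\<forall>x\<in>S. f differentiable at x) \<and> (\<forall>v. Ck_on k (\<lambda>x. frechet_derivative f (at x) v) S)"

definition smooth_on :: "('a::real_normed_vector \<Rightarrow> 'b::real_normed_vector) \<Rightarrow> 'a set \<Rightarrow> bool" where
  "smooth_on f S \<longleftrightarrow> (\<forall>k. Ck_on k f S)"


section \<open>Smooth manifolds\<close>

type_synonym ('a, 'e) chart = "'a set \<times> ('a \<Rightarrow> 'e)"

text \<open>
  A tangent vector at \<open>x\<close> is the family of its coordinate vectors in the charts around \<open>x\<close>,
  extended by \<open>0\<close> to all other pairs so that equality of tangent vectors is equality of functions.
\<close>

type_synonym ('a, 'e) tangent = "('a, 'e) chart \<Rightarrow> 'e"

definition chart_inv :: "('a, 'e) chart \<Rightarrow> 'e \<Rightarrow> 'a" where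
  "chart_inv c = inv_into (fst c) (snd c)"

definition transition :: "('a, 'e) chart \<Rightarrow> ('a, 'e) chart \<Rightarrow> 'e \<Rightarrow> 'e" where
  "transition c d = snd d \<circ> chart_inv c"

text \<open>The atlas \<open>A\<close> need not be maximal. The dimension of the manifold is \<open>DIM('e)\<close>.\<close>

locale smooth_manifold =
  fixes M :: "'a topology" and A :: "('a, 'e::euclidean_space) chart set"
  assumes Hausdorff: "Hausdorff_space M"
    and second_countable: "second_countable M"
    and chart: "\<And>U \<phi>. (U, \<phi>) \<in> A \<Longrightarrow>
      openin M U \<and> open (\<phi> ` U) \<and> homeomorphic_map (subtopology M U) (top_of_set (\<phi> ` U)) \<phi>"
    and cover: "(\<Union>c\<in>A. fst c) = topspace M"
    and smooth_transition: "\<And>c d. c \<in> A \<Longrightarrow> d \<in> A \<Longrightarrow>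
      smooth_on (transition c d) (snd c ` (fst c \<inter> fst d))"
begin

definition charts_at :: "'a \<Rightarrow> ('a, 'e) chart set" where
  "charts_at x = {c \<in> A. x \<in> fst c}"

definition chart_at :: "'a \<Rightarrow> ('a, 'e) chart" where
  "chart_at x = (SOME c. c \<in> charts_at x)"

definition tangent_space :: "'a \<Rightarrow> ('a, 'e) tangent set" where
  "tangent_space x = {v.
     (\<forall>c\<in>charts_at x. \<forall>d\<in>charts_at x.
        v d = frechet_derivative (transition c d) (at (snd c x)) (v c)) \<and>
     (\<forall>c. c \<notin> charts_at x \<longrightarrow> v c = 0)}"

text \<open>The tangent vector at \<open>x\<close> whose coordinate vector in the chart \<open>c\<close> is \<open>u\<close>.\<close>

definition tangent_of :: "('a, 'e) chart \<Rightarrow> 'a \<Rightarrow> 'e \<Rightarrow> ('a, 'e) tangent" where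
  "tangent_of c x u = (\<lambda>d. if d \<in> charts_at x
     then frechet_derivative (transition c d) (at (snd c x)) u else 0)"

definition smooth_fun :: "('a \<Rightarrow> real) \<Rightarrow> bool" where
  "smooth_fun h \<longleftrightarrow> (\<forall>c\<in>A. smooth_on (h \<circ> chart_inv c) (snd c ` fst c))"

definition differential :: "('a \<Rightarrow> real) \<Rightarrow> 'a \<Rightarrow> ('a, 'e) tangent \<Rightarrow> real" where
  "differential h x v = (let c = chart_at x in
     frechet_derivative (h \<circ> chart_inv c) (at (snd c x)) (v c))"

end


section \<open>Riemannian manifolds\<close>

locale riemannian_manifold = smooth_manifold M A
  for M :: "'a topology" and A :: "('a, 'e::euclidean_space) chart set" +
  fixes g :: "'a \<Rightarrow> ('a, 'e) tangent \<Rightarrow> ('a, 'e) tangent \<Rightarrow> real"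
  assumes metric_linear: "\<And>x a u v w. x \<in> topspace M \<Longrightarrow> u \<in> tangent_space x \<Longrightarrow>
      v \<in> tangent_space x \<Longrightarrow> w \<in> tangent_space x \<Longrightarrow>
      g x (a *\<^sub>R u + v) w = a * g x u w + g x v w"
    and metric_sym: "\<And>x u v. x \<in> topspace M \<Longrightarrow> u \<in> tangent_space x \<Longrightarrow> v \<in> tangent_space x \<Longrightarrow>
      g x u v = g x v u"
    and metric_pos: "\<And>x u. x \<in> topspace M \<Longrightarrow> u \<in> tangent_space x \<Longrightarrow> u \<noteq> 0 \<Longrightarrow> g x u u > 0"
    and metric_smooth: "\<And>c u v. c \<in> A \<Longrightarrow>
      smooth_on (\<lambda>y. g (chart_inv c y) (tangent_of c (chart_inv c y) u) (tangent_of c (chart_inv c y) v))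
        (snd c ` fst c)"
begin

definition metric_rep :: "('a, 'e) chart \<Rightarrow> 'e \<Rightarrow> 'e \<Rightarrow> 'e \<Rightarrow> real" where
  "metric_rep c y u v =
     g (chart_inv c y) (tangent_of c (chart_inv c y) u) (tangent_of c (chart_inv c y) v)"

text \<open>
  The Levi-Civita connection in the chart \<open>c\<close>:
  \<open>\<nabla>\<^sub>X Y = DY(X) + \<Gamma>(X,Y)\<close>, where \<open>\<Gamma> = christoffel c y\<close> is determined by
  vanishing torsion (first conjunct) and \<open>\<nabla>g = 0\<close> (second conjunct). Such a
  \<open>\<Gamma>\<close> exists and is unique by \<open>christoffel_ex1\<close> below.
\<close>

definition christoffel :: "('a, 'e) chart \<Rightarrow> 'e \<Rightarrow> 'e \<Rightarrow> 'e \<Rightarrow> 'e" where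
  "christoffel c y = (THE \<Gamma>.
     (\<forall>u v. \<Gamma> u v = \<Gamma> v u) \<and>
     (\<forall>u v w. frechet_derivative (\<lambda>z. metric_rep c z v w) (at y) u =
        metric_rep c y (\<Gamma> u v) w + metric_rep c y v (\<Gamma> u w)))"

text \<open>\<open>R(u,v)w = \<nabla>\<^sub>u \<nabla>\<^sub>v w - \<nabla>\<^sub>v \<nabla>\<^sub>u w\<close> for coordinate vector
  fields \<open>u\<close>, \<open>v\<close>, \<open>w\<close> (constant in the chart).\<close>

definition curvature_rep :: "('a, 'e) chart \<Rightarrow> 'e \<Rightarrow> 'e \<Rightarrow> 'e \<Rightarrow> 'e \<Rightarrow> 'e" where
  "curvature_rep c y u v w =
     frechet_derivative (\<lambda>z. christoffel c z v w) (at y) u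
     - frechet_derivative (\<lambda>z. christoffel c z u w) (at y) v
     + christoffel c y u (christoffel c y v w)
     - christoffel c y v (christoffel c y u w)"

definition curvature ::
  "'a \<Rightarrow> ('a, 'e) tangent \<Rightarrow> ('a, 'e) tangent \<Rightarrow> ('a, 'e) tangent \<Rightarrow> ('a, 'e) tangent" where
  "curvature x u v w = (let c = chart_at x in
     tangent_of c x (curvature_rep c (snd c x) (u c) (v c) (w c)))"

definition sectional_curvature :: "'a \<Rightarrow> ('a, 'e) tangent \<Rightarrow> ('a, 'e) tangent \<Rightarrow> real" where
  "sectional_curvature x u v =
     g x (curvature x u v v) u / (g x u u * g x v v - (g x u v)\<^sup>2)"

end


section \<open>Kaehler manifolds\<close>

locale kaehler_manifold = riemannian_manifold M A g
  for M :: "'a topology" and A :: "('a, 'e::euclidean_space) chart set" and g +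
  fixes J :: "'a \<Rightarrow> ('a, 'e) tangent \<Rightarrow> ('a, 'e) tangent"
  assumes connected: "connected_space M"
    and J_closed: "\<And>x u. x \<in> topspace M \<Longrightarrow> u \<in> tangent_space x \<Longrightarrow> J x u \<in> tangent_space x"
    and J_linear: "\<And>x a u v. x \<in> topspace M \<Longrightarrow> u \<in> tangent_space x \<Longrightarrow> v \<in> tangent_space x \<Longrightarrow>
      J x (a *\<^sub>R u + v) = a *\<^sub>R J x u + J x v"
    and J_square: "\<And>x u. x \<in> topspace M \<Longrightarrow> u \<in> tangent_space x \<Longrightarrow> J x (J x u) = - u"
    and J_orthogonal: "\<And>x u v. x \<in> topspace M \<Longrightarrow> u \<in> tangent_space x \<Longrightarrow> v \<in> tangent_space x \<Longrightarrow>
      g x (J x u) (J x v) = g x u v"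
    and J_smooth: "\<And>c v. c \<in> A \<Longrightarrow>
      smooth_on (\<lambda>y. J (chart_inv c y) (tangent_of c (chart_inv c y) v) c) (snd c ` fst c)"
    \<comment> \<open>\<open>\<nabla>\<^sub>u (J v) = J (\<nabla>\<^sub>u v)\<close> for coordinate vector fields \<open>u\<close>, \<open>v\<close>\<close>
    and J_parallel: "\<And>c y u v. c \<in> A \<Longrightarrow> y \<in> snd c ` fst c \<Longrightarrow>
      (let Jc = (\<lambda>z w. J (chart_inv c z) (tangent_of c (chart_inv c z) w) c);
           \<Gamma> = christoffel c y
       in frechet_derivative (\<lambda>z. Jc z v) (at y) u + \<Gamma> u (Jc y v) = Jc y (\<Gamma> u v))"
begin

definition complex_subspace_at :: "'a \<Rightarrow> ('a, 'e) tangent set \<Rightarrow> bool" where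
  "complex_subspace_at x V \<longleftrightarrow> subspace V \<and> V \<subseteq> tangent_space x \<and> J x ` V \<subseteq> V"

end


section \<open>Lorentzian space, hyperbolic space and spheres\<close>

text \<open>\<open>\<real>\<^sup>N\<close> and \<open>\<bbbL>\<^sup>N\<close> are carried by \<open>topspace (Euclidean_space N)\<close>: sequences supported on
  the indices below \<open>N\<close>. Index \<open>0\<close> is the timelike coordinate of \<open>\<bbbL>\<^sup>N\<close>.\<close>

definition lorentz :: "nat \<Rightarrow> (nat \<Rightarrow> real) \<Rightarrow> (nat \<Rightarrow> real) \<Rightarrow> real" where
  "lorentz N x y = - (x 0 * y 0) + (\<Sum>i\<in>{1..<N}. x i * y i)"

text \<open>The \<open>N\<close>-dimensional hyperbolic space of constant curvature \<open>c < 0\<close>, in \<open>\<bbbL>\<^sup>N\<^sup>+\<^sup>1\<close>.\<close>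

definition hyperbolic_space :: "real \<Rightarrow> nat \<Rightarrow> (nat \<Rightarrow> real) set" where
  "hyperbolic_space c N =
     {x \<in> topspace (Euclidean_space (Suc N)). lorentz (Suc N) x x = 1 / c \<and> x 0 > 0}"

text \<open>The \<open>N\<close>-dimensional sphere of constant curvature \<open>c > 0\<close>, in \<open>\<real>\<^sup>N\<^sup>+\<^sup>1\<close>.\<close>

definition round_sphere :: "real \<Rightarrow> nat \<Rightarrow> (nat \<Rightarrow> real) set" where
  "round_sphere c N =
     {x \<in> topspace (Euclidean_space (Suc N)). (\<Sum>i<Suc N. (x i)\<^sup>2) = 1 / c}"

text \<open>The Riemannian distance of the hyperboloid model of curvature \<open>-1\<close>.\<close>

definition hyperbolic_dist :: "nat \<Rightarrow> (nat \<Rightarrow> real) \<Rightarrow> (nat \<Rightarrow> real) \<Rightarrow> real" where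
  "hyperbolic_dist N x y = arcosh (- lorentz (Suc N) x y)"

definition hyperbolic_isometry :: "nat \<Rightarrow> ((nat \<Rightarrow> real) \<Rightarrow> nat \<Rightarrow> real) \<Rightarrow> bool" where
  "hyperbolic_isometry N \<Phi> \<longleftrightarrow>
     bij_betw \<Phi> (hyperbolic_space (-1) N) (hyperbolic_space (-1) N) \<and>
     (\<forall>x\<in>hyperbolic_space (-1) N. \<forall>y\<in>hyperbolic_space (-1) N.
        hyperbolic_dist N (\<Phi> x) (\<Phi> y) = hyperbolic_dist N x y)"

text \<open>The map \<open>(x\<^sub>1,\<dots>,x\<^sub>n) \<mapsto> (x\<^sub>1,\<dots>,x\<^sub>n)\<close> from
  \<open>\<bbbL>\<^sup>3 \<times> \<real>\<^sup>3 \<times> \<dots> \<times> \<real>\<^sup>3\<close> to \<open>\<bbbL>\<^sup>3\<^sup>n\<close>: block \<open>j \<in> {1..n}\<close> occupies the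
  indices \<open>3 * (j - 1)\<close> to \<open>3 * (j - 1) + 2\<close>.\<close>

definition concat_blocks :: "nat \<Rightarrow> (nat \<Rightarrow> nat \<Rightarrow> real) \<Rightarrow> nat \<Rightarrow> real" where
  "concat_blocks n x = (\<lambda>i. if i < 3 * n then x (i div 3 + 1) (i mod 3) else 0)"

definition extrinsic_product :: "nat \<Rightarrow> (nat \<Rightarrow> real) \<Rightarrow> (nat \<Rightarrow> real) set" where
  "extrinsic_product n c = concat_blocks n `
     (\<Pi>\<^sub>E j\<in>{1..n}. if j = 1 then hyperbolic_space (c 1) 2 else round_sphere (c j) 2)"


section \<open>Isometric immersions into hyperbolic space\<close>

context riemannian_manifold
begin

text \<open>Since \<open>g\<close> is positive definite, the last condition makes every \<open>df\<^sub>x\<close> injective. The metric of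
  hyperbolic space is the restriction of \<open>lorentz\<close> to its tangent spaces.\<close>

definition isometric_immersion_hyperbolic :: "('a \<Rightarrow> nat \<Rightarrow> real) \<Rightarrow> nat \<Rightarrow> bool" where
  "isometric_immersion_hyperbolic f N \<longleftrightarrow>
     f ` topspace M \<subseteq> hyperbolic_space (-1) N \<and>
     (\<forall>i. smooth_fun (\<lambda>x. f x i)) \<and>
     (\<forall>x\<in>topspace M. \<forall>u\<in>tangent_space x. \<forall>v\<in>tangent_space x.
        lorentz (Suc N) (\<lambda>i. differential (\<lambda>x. f x i) x u) (\<lambda>i. differential (\<lambda>x. f x i) x v)
          = g x u v)"

end


section \<open>Well-definedness of the Levi-Civita connection\<close>


lemma levi_civita_ex1:
  fixes b :: "'e::euclidean_space \<Rightarrow> 'e \<Rightarrow> real" and k :: "'e \<Rightarrow> 'e \<Rightarrow> 'e \<Rightarrow> real"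
  assumes b: "bilinear b" "\<And>u v. b u v = b v u" "\<And>u. u \<noteq> 0 \<Longrightarrow> b u u > 0"
    and k: "\<And>v w. linear (\<lambda>u. k u v w)" "\<And>u v. linear (\<lambda>w. k u v w)" "\<And>u v w. k u v w = k u w v"
  shows "\<exists>!\<Gamma>. (\<forall>u v. \<Gamma> u v = \<Gamma> v u) \<and> (\<forall>u v w. k u v w = b (\<Gamma> u v) w + b v (\<Gamma> u w))"
proof -
  have eqI: "z = z'" if "\<And>w. b z w = b z' w" for z z'
  proof -
    have "b (z - z') (z - z') = 0"
      using that by (simp add: bilinear_lsub[OF b(1)])
    then show ?thesis using b(3)[of "z - z'"] by force
  qed
  have riesz: "\<exists>z. \<forall>w. b z w = l w" if l: "linear l" for l :: "'e \<Rightarrow> real"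
  proof -
    define L where "L z = (\<Sum>i\<in>Basis. b z i *\<^sub>R i)" for z
    have linb: "linear (b z)" for z using b(1) by (auto simp: bilinear_def)
    have linL: "linear L"
      unfolding L_def by (rule linearI)
        (simp_all add: bilinear_ladd[OF b(1)] bilinear_lmul[OF b(1)] algebra_simps
          sum.distrib scaleR_sum_right)
    have L_inner: "L z \<bullet> w = b z w" for z w
    proof -
      have "b z w = b z (\<Sum>i\<in>Basis. (w \<bullet> i) *\<^sub>R i)" by (simp add: euclidean_representation)
      also have "\<dots> = (\<Sum>i\<in>Basis. (w \<bullet> i) * b z i)"
        by (simp add: linear_sum[OF linb] linear_cmul[OF linb])
      finally show ?thesis by (simp add: L_def inner_sum_left mult.commute inner_commute[of w])
    qed
    have "inj L"
      by (rule injI, rule eqI) (metis L_inner)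
    then have "surj L" using linear_injective_imp_surjective[OF linL] by blast
    then obtain z where z: "L z = (\<Sum>i\<in>Basis. l i *\<^sub>R i)" by (metis surjD)
    have "b z w = l w" for w
    proof -
      have "l w = l (\<Sum>i\<in>Basis. (w \<bullet> i) *\<^sub>R i)" by (simp add: euclidean_representation)
      also have "\<dots> = (\<Sum>i\<in>Basis. (w \<bullet> i) * l i)"
        by (simp add: linear_sum[OF l] linear_cmul[OF l])
      also have "\<dots> = L z \<bullet> w" by (simp add: z inner_sum_left mult.commute inner_commute[of w])
      finally show ?thesis by (simp add: L_inner)
    qed
    then show ?thesis by blast
  qed
  have lin: "linear (\<lambda>w. (k u v w + k v u w - k w u v) / 2)" for u v
    using k(1)[of u v] k(2)[of u v] k(2)[of v u]
    by (auto simp: linear_iff field_simps)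
  define \<Gamma> where "\<Gamma> u v = (SOME z. \<forall>w. b z w = (k u v w + k v u w - k w u v) / 2)" for u v
  have \<Gamma>: "b (\<Gamma> u v) w = (k u v w + k v u w - k w u v) / 2" for u v w
    using someI_ex[OF riesz[OF lin[of u v]]] unfolding \<Gamma>_def by blast
  show ?thesis
  proof (rule ex1I[of _ \<Gamma>])
    have "\<Gamma> u v = \<Gamma> v u" for u v
      by (rule eqI) (simp add: \<Gamma> k(3)[of _ u v])
    moreover have "k u v w = b (\<Gamma> u v) w + b v (\<Gamma> u w)" for u v w
      using k(3)[of u w v] k(3)[of v w u] k(3)[of w v u] b(2)[of v "\<Gamma> u w"]
      by (simp add: \<Gamma> field_simps)
    ultimately show "(\<forall>u v. \<Gamma> u v = \<Gamma> v u) \<and> (\<forall>u v w. k u v w = b (\<Gamma> u v) w + b v (\<Gamma> u w))"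
      by blast
  next
    fix G assume G: "(\<forall>u v. G u v = G v u) \<and> (\<forall>u v w. k u v w = b (G u v) w + b v (G u w))"
    have "b (G u v) w = (k u v w + k v u w - k w u v) / 2" for u v w
    proof -
      have "k u v w = b (G u v) w + b v (G u w)" "k v u w = b (G u v) w + b u (G v w)"
        "k w u v = b (G u w) v + b u (G v w)" using G by metis+
      then show ?thesis using b(2)[of v "G u w"] by simp
    qed
    then show "G = \<Gamma>" by (intro ext eqI) (simp add: \<Gamma>)
  qed
qed

context smooth_manifold
begin

lemma chartD:
  assumes "c \<in> A"
  shows "openin M (fst c)" "open (snd c ` fst c)" "inj_on (snd c) (fst c)"
    "homeomorphic_map (subtopology M (fst c)) (top_of_set (snd c ` fst c)) (snd c)"
    "fst c \<subseteq> topspace M"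
  using chart[of "fst c" "snd c"] assms
  by (auto dest: homeomorphic_imp_injective_map simp: inf.absorb2 openin_subset)

lemma chart_inv_left: "c \<in> A \<Longrightarrow> x \<in> fst c \<Longrightarrow> chart_inv c (snd c x) = x"
  by (simp add: chart_inv_def chartD(3))

lemma open_overlap:
  assumes "c \<in> A" "d \<in> A" shows "open (snd c ` (fst c \<inter> fst d))"
proof -
  have "openin (subtopology M (fst c)) (fst c \<inter> fst d)"
    using assms chartD(1)[of d] by (simp add: openin_subtopology_Int2)
  then have "openin (top_of_set (snd c ` fst c)) (snd c ` (fst c \<inter> fst d))"
    using chartD(4)[OF assms(1)] homeomorphic_imp_open_map open_map_def by blast
  then show ?thesis using chartD(2)[OF assms(1)] openin_open_trans by blast
qed

lemma transition_deriv:
  assumes "c \<in> charts_at x" "d \<in> charts_at x"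
  shows "(transition c d has_derivative frechet_derivative (transition c d) (at (snd c x))) (at (snd c x))"
proof -
  have "smooth_on (transition c d) (snd c ` (fst c \<inter> fst d))"
    using assms smooth_transition by (auto simp: charts_at_def)
  then have "Ck_on (Suc 0) (transition c d) (snd c ` (fst c \<inter> fst d))" unfolding smooth_on_def by blast
  then have "transition c d differentiable at (snd c x)" using assms by (auto simp: charts_at_def)
  then show ?thesis by (simp add: frechet_derivative_works)
qed

lemma transition_chain:
  assumes "c \<in> charts_at x" "d \<in> charts_at x" "e \<in> charts_at x"
  shows "frechet_derivative (transition c e) (at (snd c x)) u =
    frechet_derivative (transition d e) (at (snd d x)) (frechet_derivative (transition c d) (at (snd c x)) u)"
proof -
  have A: "c \<in> A" "d \<in> A" "e \<in> A" "x \<in> fst c" "x \<in> fst d" "x \<in> fst e" using assms by (auto simp: charts_at_def)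
  have 1: "transition c d (snd c x) = snd d x" using A by (simp add: transition_def chart_inv_left)
  have "((transition d e \<circ> transition c d) has_derivative
     frechet_derivative (transition d e) (at (snd d x)) \<circ> frechet_derivative (transition c d) (at (snd c x))) (at (snd c x))"
    using diff_chain_at[OF transition_deriv[OF assms(1,2)], of "transition d e"] transition_deriv[OF assms(2,3)] 1 by simp
  moreover have "(transition d e \<circ> transition c d) y = transition c e y" if "y \<in> snd c ` (fst c \<inter> fst d)" for y
    using that A by (auto simp: transition_def chart_inv_left)
  ultimately have "(transition c e has_derivative
     frechet_derivative (transition d e) (at (snd d x)) \<circ> frechet_derivative (transition c d) (at (snd c x))) (at (snd c x))"
    using open_overlap[OF A(1,2)] A by (auto intro: has_derivative_transform_within_open)
  then show ?thesis using frechet_derivative_at by (metis comp_apply)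
qed

lemma tangent_of_in: "c \<in> charts_at x \<Longrightarrow> tangent_of c x u \<in> tangent_space x"
  unfolding tangent_space_def tangent_of_def mem_Collect_eq
  by (intro conjI ballI allI impI) (simp_all only: if_True if_False, rule transition_chain)

lemma tangent_of_self:
  assumes "c \<in> charts_at x" shows "tangent_of c x u c = u"
proof -
  have A: "c \<in> A" "x \<in> fst c" using assms by (auto simp: charts_at_def)
  have "((\<lambda>y. y) has_derivative (\<lambda>u. u)) (at (snd c x))" by simp
  moreover have "y = transition c c y" if "y \<in> snd c ` (fst c \<inter> fst c)" for y
    using that A by (auto simp: transition_def chart_inv_left)
  moreover have "snd c x \<in> snd c ` (fst c \<inter> fst c)" using A by blast
  ultimately have "(transition c c has_derivative (\<lambda>u. u)) (at (snd c x))"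
    using open_overlap[OF A(1,1)] has_derivative_transform_within_open by blast
  then show ?thesis using frechet_derivative_at assms unfolding tangent_of_def by metis
qed

lemma tangent_of_lin:
  assumes "c \<in> charts_at x" shows "tangent_of c x (a *\<^sub>R u + v) = a *\<^sub>R tangent_of c x u + tangent_of c x v"
  using has_derivative_linear[OF transition_deriv[OF assms]]
  by (auto simp: tangent_of_def fun_eq_iff scaleR_fun_def linear_add linear_cmul)

lemma tangent_of_eq:
  assumes "v \<in> tangent_space x" "c \<in> charts_at x" shows "tangent_of c x (v c) = v"
proof
  fix d show "tangent_of c x (v c) d = v d"
  proof (cases "d \<in> charts_at x")
    case True
    then have "v d = frechet_derivative (transition c d) (at (snd c x)) (v c)"
      using assms unfolding tangent_space_def by blast
    with True show ?thesis unfolding tangent_of_def by argo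
  next
    case False
    moreover from this have "v d = 0" using assms(1) unfolding tangent_space_def by blast
    ultimately show ?thesis unfolding tangent_of_def by argo
  qed
qed

end

context riemannian_manifold
begin

lemma christoffel_ex1:
  assumes c: "c \<in> A" "y \<in> snd c ` fst c"
  shows "\<exists>!\<Gamma>. (\<forall>u v. \<Gamma> u v = \<Gamma> v u) \<and>
     (\<forall>u v w. frechet_derivative (\<lambda>z. metric_rep c z v w) (at y) u =
        metric_rep c y (\<Gamma> u v) w + metric_rep c y v (\<Gamma> u w))"
proof -
  have ch: "c \<in> charts_at (chart_inv c z)" "chart_inv c z \<in> topspace M" if "z \<in> snd c ` fst c" for z
    using that c(1) chart_inv_left[OF c(1)] chartD(5)[OF c(1)] by (auto simp: charts_at_def)
  have lin: "metric_rep c z (a *\<^sub>R u + v) w = a * metric_rep c z u w + metric_rep c z v w"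
    if "z \<in> snd c ` fst c" for z a u v w
    unfolding metric_rep_def using ch[OF that] by (simp add: tangent_of_lin tangent_of_in metric_linear)
  have sym: "metric_rep c z u v = metric_rep c z v u" if "z \<in> snd c ` fst c" for z u v
    unfolding metric_rep_def using ch[OF that] by (simp add: tangent_of_in metric_sym)
  have pos: "metric_rep c y u u > 0" if "u \<noteq> 0" for u
    unfolding metric_rep_def using ch[OF c(2)] that tangent_of_self[of c "chart_inv c y" u]
    by (intro metric_pos) (auto simp: tangent_of_in)
  have add: "metric_rep c z (u + v) w = metric_rep c z u w + metric_rep c z v w"
    if "z \<in> snd c ` fst c" for z u v w using lin[OF that, of 1 u v w] by simp
  have mul: "metric_rep c z (a *\<^sub>R u) w = a * metric_rep c z u w"
    if "z \<in> snd c ` fst c" for z a u w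
    using lin[OF that, of a u 0 w] lin[OF that, of 1 0 0 w] by simp
  have bil: "bilinear (metric_rep c y)"
    unfolding bilinear_def linear_iff using add[OF c(2)] mul[OF c(2)] sym[OF c(2)] by simp
  have der: "((\<lambda>z. metric_rep c z v w) has_derivative frechet_derivative (\<lambda>z. metric_rep c z v w) (at y)) (at y)" for v w
  proof -
    have "Ck_on (Suc 0) (\<lambda>z. metric_rep c z v w) (snd c ` fst c)"
      using metric_smooth[OF c(1), of v w] unfolding smooth_on_def metric_rep_def by blast
    then show ?thesis using c(2) unfolding Ck_on.simps frechet_derivative_works by blast
  qed
  have op: "open (snd c ` fst c)" using chartD c by blast
  have fd: "frechet_derivative F (at y) = F'" if "(G has_derivative F') (at y)" "\<And>z. z \<in> snd c ` fst c \<Longrightarrow> G z = F z"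
    for F G F'
    using has_derivative_transform_within_open[OF that(1) op c(2)] that(2) frechet_derivative_at[of F F' y] by simp
  show ?thesis
  proof (rule levi_civita_ex1[OF bil sym[OF c(2)] pos])
    show "linear (\<lambda>u. frechet_derivative (\<lambda>z. metric_rep c z v w) (at y) u)" for v w
      using has_derivative_linear[OF der[of v w]] by simp
    show s: "frechet_derivative (\<lambda>z. metric_rep c z v w) (at y) u = frechet_derivative (\<lambda>z. metric_rep c z w v) (at y) u" for u v w
      by (rule fun_cong[OF fd[OF der[of w v]]]) (rule sym)
    show "linear (\<lambda>w. frechet_derivative (\<lambda>z. metric_rep c z v w) (at y) u)" for u v
    proof (rule linearI)
      fix w w' a
      show "frechet_derivative (\<lambda>z. metric_rep c z v (w + w')) (at y) u =
         frechet_derivative (\<lambda>z. metric_rep c z v w) (at y) u + frechet_derivative (\<lambda>z. metric_rep c z v w') (at y) u"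
        by (rule fun_cong[OF fd[OF has_derivative_add[OF der[of v w] der[of v w']]]]) (simp add: sym[of _ v] add)
      show "frechet_derivative (\<lambda>z. metric_rep c z v (a *\<^sub>R w)) (at y) u = a *\<^sub>R frechet_derivative (\<lambda>z. metric_rep c z v w) (at y) u"
        by (rule fun_cong[OF fd[OF has_derivative_scaleR_right[OF der[of v w]]]]) (simp add: sym[of _ v] mul)
    qed
  qed
qed

end

end

theory Submission
  imports Defs
begin

text \<open>Let \<open>F\<close> be the immersion, viewed in the ambient Lorentzian space. The \<open>J\<close>-Hermitian part of the
  second fundamental form of \<open>F\<close>, as a bilinear map into two copies of the normal space, is flat for an
  inner product of split signature. Since \<open>K(S, JS) > 0\<close> on \<open>V\<close>, it has injective regular elements,
  so the shape operators at \<open>x\<^sub>0\<close> commute and the second fundamental form splits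
  orthogonally over \<open>n\<close> complex lines; this forces \<open>p = n - 1\<close>. The splitting determines an
  orthogonal frame of the ambient space, hence projections \<open>P\<^sub>j\<close> such that
  \<open>\<langle>P\<^sub>j F, F\<rangle> = 1 / c\<^sub>j\<close> to second order at \<open>x\<^sub>0\<close>. Near any such point the Codazzi equation together with
  \<open>J\<close>-invariance makes the second fundamental form parallel, so these equations propagate along
  rays. The set where they hold locally is therefore open and closed, hence all of the manifold, and a
  dimension count shows that the image is open in the product.\<close>

section \<open>Smooth functions\<close>

text \<open>The obstacle is that positivity of the curvature is known at one point only, while the
  conclusion is global. Moving frames are therefore replaced by constant ambient projections
  \<open>P j\<close>: the resulting equations for the 2-jet of \<open>F\<close> at a point are
  closed conditions, so they hold at limit points, and there they supply their own substitute for
  the curvature hypothesis. The tangent directions orthogonal to the negative block form a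
  \<open>J\<close>-invariant space of dimension \<open>2 * p\<close> on which \<open>b S S\<close>
  is again spacelike.

  The Lorentzian ambient space makes the position vector a normal direction along which the second
  fundamental form is \<open>- g\<close>, so no tangent vector is annihilated by the whole form. The
  price is a normal space of dimension \<open>p + 1\<close> that is itself Lorentzian: null values
  in the overlap of a range with its own orthogonal complement become possible, and excluding them
  is what positivity on \<open>V\<close> is for. The single timelike normal direction is also the
  reason for the single negative constant, and expanding the unit timelike vector \<open>F\<close>
  in the principal normals gives the relation between the constants.\<close>

lemma Ck_on_SucD: "Ck_on (Suc k) f S \<Longrightarrow> Ck_on k f S"
proof (induction k arbitrary: f)
  case 0
  then show ?case
    by (auto intro!: continuous_at_imp_continuous_on differentiable_imp_continuous_within)
next
  case (Suc k)
  then show ?case by (metis Ck_on.simps(2))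
qed

lemma smooth_on_iff:
  "smooth_on f S \<longleftrightarrow> (\<forall>x\<in>S. f differentiable at x) \<and>
     (\<forall>v. smooth_on (\<lambda>x. frechet_derivative f (at x) v) S)"
  unfolding smooth_on_def by (metis Ck_on.simps(2) Ck_on_SucD)

lemma smooth_on_deriv: "smooth_on f S \<Longrightarrow> smooth_on (\<lambda>x. frechet_derivative f (at x) v) S"
  using smooth_on_iff by blast

lemma smooth_on_has_derivative:
  "smooth_on f S \<Longrightarrow> x \<in> S \<Longrightarrow> (f has_derivative frechet_derivative f (at x)) (at x)"
  using smooth_on_iff frechet_derivative_works by blast

lemma smooth_on_imp_continuous_on: "smooth_on f S \<Longrightarrow> continuous_on S f"
  unfolding smooth_on_def by (metis Ck_on.simps(1))

lemma frechet_derivativeI: "(f has_derivative f') (at x) \<Longrightarrow> frechet_derivative f (at x) v = f' v"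
  by (metis frechet_derivative_at)

lemma Ck_on_cong:
  assumes "open S" "\<And>x. x \<in> S \<Longrightarrow> f x = g x" "Ck_on k f S"
  shows "Ck_on k g S"
  using assms(2,3)
proof (induction k arbitrary: f g)
  case 0
  then show ?case using continuous_on_cong[of S S f g] by simp
next
  case (Suc k)
  have df: "f differentiable at x" if "x \<in> S" for x using Suc.prems(2) that by simp
  have d: "(g has_derivative frechet_derivative f (at x)) (at x)" if "x \<in> S" for x
    using frechet_derivative_works[THEN iffD1, OF df[OF that]]
    by (rule has_derivative_transform_within_open[OF _ assms(1) that Suc.prems(1)])
  have "Ck_on k (\<lambda>x. frechet_derivative g (at x) v) S" for v
    by (rule Suc.IH[of "\<lambda>x. frechet_derivative f (at x) v"])
      (use Suc.prems(2) in \<open>auto simp: frechet_derivativeI[OF d]\<close>)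
  then show ?case using d differentiableI by (metis Ck_on.simps(2))
qed

lemma smooth_on_cong:
  assumes "open S" "smooth_on f S" "\<And>x. x \<in> S \<Longrightarrow> f x = g x"
  shows "smooth_on g S"
  using assms Ck_on_cong unfolding smooth_on_def by blast

lemma Ck_on_add:
  assumes "open S" "Ck_on k f S" "Ck_on k g S"
  shows "Ck_on k (\<lambda>x. f x + g x) S"
  using assms(2,3)
proof (induction k arbitrary: f g)
  case 0
  then show ?case by (auto intro: continuous_intros)
next
  case (Suc k)
  have d: "((\<lambda>x. f x + g x) has_derivative
      (\<lambda>v. frechet_derivative f (at x) v + frechet_derivative g (at x) v)) (at x)" if "x \<in> S" for x
    using Suc.prems that by (intro has_derivative_add frechet_derivative_works[THEN iffD1]) simp_all
  have "Ck_on k (\<lambda>x. frechet_derivative (\<lambda>x. f x + g x) (at x) v) S" for v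
    by (rule Ck_on_cong[OF assms(1) _ Suc.IH[of "\<lambda>x. frechet_derivative f (at x) v"
          "\<lambda>x. frechet_derivative g (at x) v"]])
      (use Suc.prems in \<open>auto simp: frechet_derivativeI[OF d]\<close>)
  then show ?case using d differentiableI by (metis Ck_on.simps(2))
qed

lemma Ck_on_const: "Ck_on k (\<lambda>x. c) S"
  by (induction k arbitrary: c) auto

lemma Ck_on_bilinear:
  assumes "bounded_bilinear pr" "open S" "Ck_on k f S" "Ck_on k g S"
  shows "Ck_on k (\<lambda>x. pr (f x) (g x)) S"
  using assms(3,4)
proof (induction k arbitrary: f g)
  case 0
  then show ?case using bounded_bilinear.continuous_on[OF assms(1)] by auto
next
  case (Suc k)
  have d: "((\<lambda>x. pr (f x) (g x)) has_derivative
      (\<lambda>v. pr (f x) (frechet_derivative g (at x) v) + pr (frechet_derivative f (at x) v) (g x))) (at x)"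
    if "x \<in> S" for x
    using Suc.prems that
    by (intro bounded_bilinear.FDERIV[OF assms(1)] frechet_derivative_works[THEN iffD1]) simp_all
  have "Ck_on k (\<lambda>x. frechet_derivative (\<lambda>x. pr (f x) (g x)) (at x) v) S" for v
    by (rule Ck_on_cong[OF assms(2) _ Ck_on_add[OF assms(2) Suc.IH[of f "\<lambda>x. frechet_derivative g (at x) v"]
          Suc.IH[of "\<lambda>x. frechet_derivative f (at x) v" g]]])
      (use Suc.prems Ck_on_SucD[OF Suc.prems(1)] Ck_on_SucD[OF Suc.prems(2)] in
        \<open>auto simp: frechet_derivativeI[OF d]\<close>)
  then show ?case using d differentiableI by (metis Ck_on.simps(2))
qed

lemma Ck_on_linear:
  assumes "bounded_linear L" "open S" "Ck_on k f S"
  shows "Ck_on k (\<lambda>x. L (f x)) S"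
  using assms(3)
proof (induction k arbitrary: f)
  case 0
  then show ?case using bounded_linear.continuous_on[OF assms(1)] by auto
next
  case (Suc k)
  have d: "((\<lambda>x. L (f x)) has_derivative (\<lambda>v. L (frechet_derivative f (at x) v))) (at x)"
    if "x \<in> S" for x
    using Suc.prems that
    by (intro bounded_linear.has_derivative[OF assms(1)] frechet_derivative_works[THEN iffD1]) simp_all
  have "Ck_on k (\<lambda>x. frechet_derivative (\<lambda>x. L (f x)) (at x) v) S" for v
    by (rule Ck_on_cong[OF assms(2) _ Suc.IH[of "\<lambda>x. frechet_derivative f (at x) v"]])
      (use Suc.prems in \<open>auto simp: frechet_derivativeI[OF d]\<close>)
  then show ?case using d differentiableI by (metis Ck_on.simps(2))
qed

lemma smooth_on_add: "open S \<Longrightarrow> smooth_on f S \<Longrightarrow> smooth_on g S \<Longrightarrow> smooth_on (\<lambda>x. f x + g x) S"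
  unfolding smooth_on_def using Ck_on_add by blast

lemma smooth_on_const: "smooth_on (\<lambda>x. c) S"
  unfolding smooth_on_def using Ck_on_const by blast

lemma smooth_on_bilinear:
  "bounded_bilinear pr \<Longrightarrow> open S \<Longrightarrow> smooth_on f S \<Longrightarrow> smooth_on g S \<Longrightarrow>
    smooth_on (\<lambda>x. pr (f x) (g x)) S"
  unfolding smooth_on_def using Ck_on_bilinear by blast

lemma smooth_on_linear:
  "bounded_linear L \<Longrightarrow> open S \<Longrightarrow> smooth_on f S \<Longrightarrow> smooth_on (\<lambda>x. L (f x)) S"
  unfolding smooth_on_def using Ck_on_linear by blast

lemma smooth_on_diff:
  assumes "open S" "smooth_on f S" "smooth_on g S"
  shows "smooth_on (\<lambda>x. f x - g x) S"
  using smooth_on_add[OF assms(1,2) smooth_on_linear[OF bounded_linear_minus[OF bounded_linear_ident] assms(1,3)]]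
  by simp

lemma smooth_on_sum:
  assumes "open S" "\<And>i. i \<in> I \<Longrightarrow> smooth_on (f i) S"
  shows "smooth_on (\<lambda>x. \<Sum>i\<in>I. f i x) S"
  using assms(2)
proof (induction I rule: infinite_finite_induct)
  case (insert i I)
  then show ?case using smooth_on_add[OF assms(1), of "f i" "\<lambda>x. \<Sum>i\<in>I. f i x"] by simp
qed (simp_all add: smooth_on_const)

lemma Ck_on_sum:
  assumes "open S" "\<And>i. i \<in> I \<Longrightarrow> Ck_on k (f i) S"
  shows "Ck_on k (\<lambda>x. \<Sum>i\<in>I. f i x) S"
  using assms(2)
proof (induction I rule: infinite_finite_induct)
  case (insert i I)
  then show ?case using Ck_on_add[OF assms(1), of k "f i" "\<lambda>x. \<Sum>i\<in>I. f i x"] by simp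
qed (simp_all add: Ck_on_const)

section \<open>Families of linear maps with smooth coefficients\<close>

lemma linear_basis_expand:
  fixes L :: "'x::euclidean_space \<Rightarrow> 'y::real_vector"
  assumes "linear L" shows "L x = (\<Sum>i\<in>Basis. (x \<bullet> i) *\<^sub>R L i)"
proof -
  have "L x = L (\<Sum>i\<in>Basis. (x \<bullet> i) *\<^sub>R i)" by (simp only: euclidean_representation)
  also have "\<dots> = (\<Sum>i\<in>Basis. (x \<bullet> i) *\<^sub>R L i)"
    by (simp only: linear_sum[OF assms] linear_scale[OF assms])
  finally show ?thesis .
qed

text \<open>Smoothness of \<open>L\<close> is asked for each fixed argument only. By linearity in a
  finite-dimensional argument this is smoothness of finitely many coefficients, and no norm on a
  space of linear maps enters.\<close>

lemma smooth_on_apply: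
  fixes L :: "'z::real_normed_vector \<Rightarrow> 'x::euclidean_space \<Rightarrow> 'y::real_normed_vector"
  assumes "open S" "\<And>x. smooth_on (\<lambda>z. L z x) S" "smooth_on s S" "\<And>z. z \<in> S \<Longrightarrow> linear (L z)"
  shows "smooth_on (\<lambda>z. L z (s z)) S"
proof (rule smooth_on_cong[OF assms(1)])
  show "smooth_on (\<lambda>z. \<Sum>i\<in>Basis. (s z \<bullet> i) *\<^sub>R L z i) S"
    by (intro smooth_on_sum smooth_on_bilinear[OF bounded_bilinear_scaleR] assms
        smooth_on_linear[OF bounded_linear_inner_left])
  show "(\<Sum>i\<in>Basis. (s z \<bullet> i) *\<^sub>R L z i) = L z (s z)" if "z \<in> S" for z
    by (rule linear_basis_expand[OF assms(4)[OF that], symmetric])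
qed

lemma has_derivative_apply:
  fixes L :: "'z::real_normed_vector \<Rightarrow> 'x::euclidean_space \<Rightarrow> 'y::real_normed_vector"
  assumes "open S" "\<And>x. smooth_on (\<lambda>z. L z x) S" "(s has_derivative s') (at y)" "y \<in> S"
    and "\<And>z. z \<in> S \<Longrightarrow> linear (L z)"
  shows "((\<lambda>z. L z (s z)) has_derivative
     (\<lambda>v. frechet_derivative (\<lambda>z. L z (s y)) (at y) v + L y (s' v))) (at y)"
proof -
  have d: "((\<lambda>z. L z x) has_derivative frechet_derivative (\<lambda>z. L z x) (at y)) (at y)" for x
    using smooth_on_has_derivative[OF assms(2) assms(4)] .
  have e: "((\<lambda>z. \<Sum>i\<in>Basis. (s z \<bullet> i) *\<^sub>R L z i) has_derivative
     (\<lambda>v. \<Sum>i\<in>Basis. (s y \<bullet> i) *\<^sub>R frechet_derivative (\<lambda>z. L z i) (at y) v + (s' v \<bullet> i) *\<^sub>R L y i)) (at y)"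
    by (rule has_derivative_sum bounded_bilinear.FDERIV[OF bounded_bilinear_scaleR]
          bounded_linear.has_derivative[OF bounded_linear_inner_left] d assms(3))+
  have e2: "((\<lambda>z. L z (s z)) has_derivative
     (\<lambda>v. \<Sum>i\<in>Basis. (s y \<bullet> i) *\<^sub>R frechet_derivative (\<lambda>z. L z i) (at y) v + (s' v \<bullet> i) *\<^sub>R L y i)) (at y)"
    by (rule has_derivative_transform_within_open[OF e assms(1) assms(4)])
      (simp add: linear_basis_expand[OF assms(5), symmetric])
  have f0: "((\<lambda>z. \<Sum>i\<in>Basis. (s y \<bullet> i) *\<^sub>R L z i) has_derivative
     (\<lambda>v. \<Sum>i\<in>Basis. (s y \<bullet> i) *\<^sub>R frechet_derivative (\<lambda>z. L z i) (at y) v)) (at y)"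
    by (rule has_derivative_sum has_derivative_scaleR_right d)+
  have f: "((\<lambda>z. L z (s y)) has_derivative
     (\<lambda>v. \<Sum>i\<in>Basis. (s y \<bullet> i) *\<^sub>R frechet_derivative (\<lambda>z. L z i) (at y) v)) (at y)"
    by (rule has_derivative_transform_within_open[OF f0 assms(1) assms(4)])
      (simp add: linear_basis_expand[OF assms(5), symmetric])
  have "(\<lambda>v. \<Sum>i\<in>Basis. (s y \<bullet> i) *\<^sub>R frechet_derivative (\<lambda>z. L z i) (at y) v + (s' v \<bullet> i) *\<^sub>R L y i) =
     (\<lambda>v. frechet_derivative (\<lambda>z. L z (s y)) (at y) v + L y (s' v))"
    using linear_basis_expand[OF assms(5)[OF assms(4)], of "s' _"]
    by (simp add: fun_eq_iff frechet_derivativeI[OF f] sum.distrib)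
  with e2 show ?thesis by simp
qed

text \<open>The inverse function theorem makes \<open>s\<close> continuous, respectively
  differentiable, along with \<open>b\<close>. Differentiating \<open>G z (s z) = b z\<close> gives
  for the derivative of \<open>s\<close> a system with the same \<open>G\<close> and a right-hand
  side of one class less, so induction on \<open>k\<close> applies.\<close>

lemma Ck_on_linear_solve:
  fixes G :: "'z::euclidean_space \<Rightarrow> 'x::euclidean_space \<Rightarrow> 'x"
  assumes S: "open S" and lin: "\<And>z. z \<in> S \<Longrightarrow> linear (G z)" and inj: "\<And>z. z \<in> S \<Longrightarrow> inj (G z)"
    and sm: "\<And>x. smooth_on (\<lambda>z. G z x) S"
    and b: "Ck_on k b S" and eq: "\<And>z. z \<in> S \<Longrightarrow> G z (s z) = b z"
  shows "Ck_on k s S"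
proof -
  \<comment> \<open>The parameter is carried along, so that the single inverse \<open>K\<close>
    treats all \<open>z\<close> at once.\<close>
  define H where "H = (\<lambda>p. (fst p, G (fst p) (snd p)))"
  define K where "K = (\<lambda>p. (fst p, inv (G (fst p)) (snd p)))"
  have bij: "bij (G z)" if "z \<in> S" for z
    using linear_injective_imp_surjective[OF lin[OF that] inj[OF that]] inj[OF that] by (simp add: bij_def)
  have dH: "\<exists>D. (H has_derivative D) (at p) \<and> (\<forall>u x. D (u, x) = (u, frechet_derivative (\<lambda>z. G z (snd p)) (at (fst p)) u + G (fst p) x))"
    if "fst p \<in> S" for p
  proof -
    have SS: "open (S \<times> (UNIV::'x set))" using S by (simp add: open_Times)
    have d: "((\<lambda>z. G z x) has_derivative frechet_derivative (\<lambda>z. G z x) (at (fst p))) (at (fst p))" for x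
      using smooth_on_has_derivative[OF sm that] .
    have e: "((\<lambda>q. \<Sum>i\<in>Basis. (snd q \<bullet> i) *\<^sub>R G (fst q) i) has_derivative
       (\<lambda>v. \<Sum>i\<in>Basis. (snd p \<bullet> i) *\<^sub>R frechet_derivative (\<lambda>z. G z i) (at (fst p)) (fst v) + (snd v \<bullet> i) *\<^sub>R G (fst p) i)) (at p)"
      by (rule has_derivative_sum bounded_bilinear.FDERIV[OF bounded_bilinear_scaleR]
          bounded_linear.has_derivative[OF bounded_linear_inner_left] has_derivative_snd has_derivative_ident
          has_derivative_compose[OF has_derivative_fst[OF has_derivative_ident] d])+
    have e2: "((\<lambda>q. G (fst q) (snd q)) has_derivative
       (\<lambda>v. \<Sum>i\<in>Basis. (snd p \<bullet> i) *\<^sub>R frechet_derivative (\<lambda>z. G z i) (at (fst p)) (fst v) + (snd v \<bullet> i) *\<^sub>R G (fst p) i)) (at p)"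
      by (rule has_derivative_transform_within_open[OF e SS])
        (use that in \<open>auto simp: linear_basis_expand[OF lin, symmetric] mem_Times_iff\<close>)
    have f0: "((\<lambda>z. \<Sum>i\<in>Basis. (snd p \<bullet> i) *\<^sub>R G z i) has_derivative
       (\<lambda>v. \<Sum>i\<in>Basis. (snd p \<bullet> i) *\<^sub>R frechet_derivative (\<lambda>z. G z i) (at (fst p)) v)) (at (fst p))"
      by (rule has_derivative_sum has_derivative_scaleR_right d)+
    have f: "((\<lambda>z. G z (snd p)) has_derivative
       (\<lambda>v. \<Sum>i\<in>Basis. (snd p \<bullet> i) *\<^sub>R frechet_derivative (\<lambda>z. G z i) (at (fst p)) v)) (at (fst p))"
      by (rule has_derivative_transform_within_open[OF f0 S that])
        (simp add: linear_basis_expand[OF lin, symmetric])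
    have "(\<Sum>i\<in>Basis. (snd p \<bullet> i) *\<^sub>R frechet_derivative (\<lambda>z. G z i) (at (fst p)) (fst v) + (snd v \<bullet> i) *\<^sub>R G (fst p) i)
       = frechet_derivative (\<lambda>z. G z (snd p)) (at (fst p)) (fst v) + G (fst p) (snd v)" for v
      using linear_basis_expand[OF lin[OF that], of "snd v"]
      by (simp add: frechet_derivativeI[OF f] sum.distrib)
    with e2 have "((\<lambda>q. G (fst q) (snd q)) has_derivative
       (\<lambda>v. frechet_derivative (\<lambda>z. G z (snd p)) (at (fst p)) (fst v) + G (fst p) (snd v))) (at p)" by simp
    then show ?thesis unfolding H_def
      by (intro exI[of _ "\<lambda>v. (fst v, frechet_derivative (\<lambda>z. G z (snd p)) (at (fst p)) (fst v) + G (fst p) (snd v))"])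
        (auto intro!: has_derivative_Pair has_derivative_fst)
  qed
  have K: "K differentiable at (z, w)" if z: "z \<in> S" for z w
  proof -
    define x where "x = inv (G z) w"
    have x: "G z x = w" using bij[OF z] by (simp add: x_def bij_is_surj surj_f_inv_f)
    obtain D where D: "(H has_derivative D) (at (z,x))"
      "\<And>u x'. D (u, x') = (u, frechet_derivative (\<lambda>z. G z x) (at z) u + G z x')"
      using dH[of "(z,x)"] z by auto
    \<comment> \<open>\<open>D\<close> is block triangular with diagonal blocks the identity and
      \<open>G z\<close>; this is its inverse.\<close>
    define D' where "D' = (\<lambda>(u, y). (u, inv (G z) (y - frechet_derivative (\<lambda>z. G z x) (at z) u)))"
    have "(K has_derivative D') (at (H (z,x)))"
    proof (rule has_derivative_inverse_strong[of "S \<times> UNIV" "(z,x)" H K D D'])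
      show "open (S \<times> (UNIV::'x set))" using S by (simp add: open_Times)
      show "(z,x) \<in> S \<times> UNIV" using z by simp
      show "continuous_on (S \<times> UNIV) H"
      proof (intro continuous_at_imp_continuous_on ballI)
        fix p assume "p \<in> S \<times> (UNIV::'x set)"
        then show "isCont H p" using dH[of p] has_derivative_continuous by (auto simp: mem_Times_iff)
      qed
      show "K (H p) = p" if "p \<in> S \<times> UNIV" for p
        using that inj by (auto simp: K_def H_def)
      show "(H has_derivative D) (at (z,x))" by (rule D)
      show "D \<circ> D' = id"
        using bij[OF z] by (auto simp: D'_def D(2) fun_eq_iff bij_is_surj surj_f_inv_f)
    qed
    then show ?thesis using x by (auto simp: H_def differentiable_def)
  qed
  show ?thesis
    using b eq
  proof (induction k arbitrary: b s)
    case 0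
    have sK: "s z = snd (K (z, b z))" if "z \<in> S" for z
      using inj[OF that] 0(2)[OF that] by (simp add: K_def flip: 0(2)[OF that])
    have "continuous_on (S \<times> UNIV) K"
      using K by (intro continuous_at_imp_continuous_on) (auto intro: differentiable_imp_continuous_within)
    then have "continuous_on S (\<lambda>z. K (z, b z))"
      by (rule continuous_on_compose2[where g=K]) (use 0 in \<open>auto intro: continuous_intros\<close>)
    then have "continuous_on S (\<lambda>z. snd (K (z, b z)))" by (rule continuous_on_snd)
    then show ?case using sK continuous_on_cong[of S S s] by simp
  next
    case (Suc k)
    have sK: "s z = snd (K (z, b z))" if "z \<in> S" for z
      using inj[OF that] Suc.prems(2)[OF that] by (simp add: K_def flip: Suc.prems(2)[OF that])
    have ds: "s differentiable at z" if zS: "z \<in> S" for z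
    proof -
      have "b differentiable at z" using Suc.prems that by simp
      then obtain b' where b': "(b has_derivative b') (at z)" by (auto simp: differentiable_def)
      obtain K' where K': "(K has_derivative K') (at (z, b z))"
        using K[OF zS, of "b z"] unfolding differentiable_def by blast
      have "((\<lambda>z. (z, b z)) has_derivative (\<lambda>v. (v, b' v))) (at z)"
        using b' by (intro has_derivative_Pair has_derivative_ident)
      from has_derivative_compose[OF this K'] have "((\<lambda>z. snd (K (z, b z))) has_derivative (\<lambda>v. snd (K' (v, b' v)))) (at z)"
        by (rule has_derivative_snd)
      from has_derivative_transform_within_open[OF this S that, of s] sK show ?thesis
        by (auto simp: differentiable_def)
    qed
    \<comment> \<open>The induction hypothesis is applied to the differentiated equation, solved for
      the term that contains the derivative of \<open>s\<close>.\<close>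
    have step: "Ck_on k (\<lambda>z. frechet_derivative s (at z) v) S" for v
    proof (rule Suc.IH)
      have Cs: "Ck_on k s S" using Suc.IH[of b s] Suc.prems Ck_on_SucD by blast
      show "Ck_on k (\<lambda>z. frechet_derivative b (at z) v
          + (- 1) *\<^sub>R (\<Sum>i\<in>Basis. (s z \<bullet> i) *\<^sub>R frechet_derivative (\<lambda>z. G z i) (at z) v)) S"
        using Suc.prems(1) smooth_on_deriv[OF sm]
        by (intro Ck_on_add Ck_on_linear[OF bounded_linear_scaleR_right] S Ck_on_sum
            Ck_on_bilinear[OF bounded_bilinear_scaleR] Ck_on_linear[OF bounded_linear_inner_left] Cs)
          (auto simp: smooth_on_def)
      fix z assume z: "z \<in> S"
      have f: "((\<lambda>z. G z (s z)) has_derivative (\<lambda>v. frechet_derivative (\<lambda>w. G w (s z)) (at z) v + G z (frechet_derivative s (at z) v))) (at z)"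
        using ds[OF z] frechet_derivative_works by (intro has_derivative_apply[OF S sm _ z lin]) auto
      have "(b has_derivative (\<lambda>v. frechet_derivative (\<lambda>w. G w (s z)) (at z) v + G z (frechet_derivative s (at z) v))) (at z)"
        by (rule has_derivative_transform_within_open[OF f S z]) (simp add: Suc.prems)
      then have 1: "frechet_derivative b (at z) v = frechet_derivative (\<lambda>w. G w (s z)) (at z) v + G z (frechet_derivative s (at z) v)"
        by (rule frechet_derivativeI)
      have d: "((\<lambda>z. G z x) has_derivative frechet_derivative (\<lambda>z. G z x) (at z)) (at z)" for x
        using smooth_on_has_derivative[OF sm z] .
      have "((\<lambda>w. \<Sum>i\<in>Basis. (s z \<bullet> i) *\<^sub>R G w i) has_derivative
       (\<lambda>v. \<Sum>i\<in>Basis. (s z \<bullet> i) *\<^sub>R frechet_derivative (\<lambda>z. G z i) (at z) v)) (at z)"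
        by (rule has_derivative_sum has_derivative_scaleR_right d)+
      then have "((\<lambda>w. G w (s z)) has_derivative
       (\<lambda>v. \<Sum>i\<in>Basis. (s z \<bullet> i) *\<^sub>R frechet_derivative (\<lambda>z. G z i) (at z) v)) (at z)"
        by (rule has_derivative_transform_within_open[OF _ S z])
          (simp add: linear_basis_expand[OF lin, symmetric])
      from frechet_derivativeI[OF this] 1
      show "G z (frechet_derivative s (at z) v) = frechet_derivative b (at z) v
          + (- 1) *\<^sub>R (\<Sum>i\<in>Basis. (s z \<bullet> i) *\<^sub>R frechet_derivative (\<lambda>z. G z i) (at z) v)" by simp
    qed
    show ?case using ds step by simp
  qed
qed

lemma smooth_on_linear_solve:
  fixes G :: "'z::euclidean_space \<Rightarrow> 'x::euclidean_space \<Rightarrow> 'x"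
  assumes "open S" "\<And>z. z \<in> S \<Longrightarrow> linear (G z)" "\<And>z. z \<in> S \<Longrightarrow> inj (G z)"
    and "\<And>x. smooth_on (\<lambda>z. G z x) S" "smooth_on b S" "\<And>z. z \<in> S \<Longrightarrow> G z (s z) = b z"
  shows "smooth_on s S"
  unfolding smooth_on_def using Ck_on_linear_solve[OF assms(1-4) _ assms(6)] assms(5) smooth_on_def by blast

section \<open>Symmetry of second derivatives\<close>

lemma has_real_derivative_along_line:
  fixes f :: "'a::real_normed_vector \<Rightarrow> real"
  assumes "smooth_on f S" "w + s *\<^sub>R u \<in> S"
  shows "((\<lambda>s. f (w + s *\<^sub>R u)) has_real_derivative frechet_derivative f (at (w + s *\<^sub>R u)) u) (at s)"
proof -
  have "((\<lambda>s. w + s *\<^sub>R u) has_derivative (\<lambda>h. h *\<^sub>R u)) (at s)"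
    by (auto intro!: derivative_eq_intros)
  from has_derivative_compose[OF this smooth_on_has_derivative[OF assms]]
  have "((\<lambda>s. f (w + s *\<^sub>R u)) has_derivative (\<lambda>h. frechet_derivative f (at (w + s *\<^sub>R u)) (h *\<^sub>R u))) (at s)" .
  moreover have "linear (frechet_derivative f (at (w + s *\<^sub>R u)))"
    using has_derivative_linear[OF smooth_on_has_derivative[OF assms]] .
  ultimately show ?thesis
    by (simp add: has_field_derivative_def linear_scale mult_commute_abs)
qed

text \<open>The mean value theorem in the direction \<open>u\<close>, followed by the one in the
  direction \<open>v\<close>. The left side is symmetric in \<open>u\<close> and \<open>v\<close>,
  so it can be evaluated with either mixed derivative.\<close>

lemma second_difference:
  fixes f :: "'a::real_normed_vector \<Rightarrow> real"
  assumes f: "smooth_on f S" and h: "h > 0"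
    and S: "\<And>s t. s \<in> {0..h} \<Longrightarrow> t \<in> {0..h} \<Longrightarrow> y + s *\<^sub>R u + t *\<^sub>R v \<in> S"
  obtains s t where "s \<in> {0..h}" "t \<in> {0..h}"
    "f (y + h *\<^sub>R u + h *\<^sub>R v) - f (y + h *\<^sub>R u) - f (y + h *\<^sub>R v) + f y =
       h\<^sup>2 * frechet_derivative (\<lambda>z. frechet_derivative f (at z) u) (at (y + s *\<^sub>R u + t *\<^sub>R v)) v"
proof -
  let ?\<phi> = "\<lambda>s. f ((y + h *\<^sub>R v) + s *\<^sub>R u) - f (y + s *\<^sub>R u)"
  let ?D = "\<lambda>z. frechet_derivative f (at z) u"
  have "DERIV ?\<phi> s :> ?D ((y + h *\<^sub>R v) + s *\<^sub>R u) - ?D (y + s *\<^sub>R u)" if "0 \<le> s" "s \<le> h" for s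
    using S[of s h] S[of s 0] that h
    by (intro DERIV_diff has_real_derivative_along_line[OF f]) (auto simp: algebra_simps)
  from MVT2[OF h this] obtain s where s: "0 < s" "s < h"
    "?\<phi> h - ?\<phi> 0 = h * (?D ((y + h *\<^sub>R v) + s *\<^sub>R u) - ?D (y + s *\<^sub>R u))" by auto
  have "DERIV (\<lambda>t. ?D ((y + s *\<^sub>R u) + t *\<^sub>R v)) t :> frechet_derivative ?D (at (y + s *\<^sub>R u + t *\<^sub>R v)) v"
    if "0 \<le> t" "t \<le> h" for t
    using S[of s t] that s by (intro has_real_derivative_along_line[OF smooth_on_deriv[OF f]]) auto
  from MVT2[OF h this] obtain t where t: "0 < t" "t < h"
    "?D ((y + s *\<^sub>R u) + h *\<^sub>R v) - ?D ((y + s *\<^sub>R u) + 0 *\<^sub>R v) =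
      h * frechet_derivative ?D (at (y + s *\<^sub>R u + t *\<^sub>R v)) v" by auto
  show thesis
  proof (rule that[of s t])
    show "s \<in> {0..h}" "t \<in> {0..h}" using s t by auto
    have "f (y + h *\<^sub>R u + h *\<^sub>R v) - f (y + h *\<^sub>R u) - f (y + h *\<^sub>R v) + f y = ?\<phi> h - ?\<phi> 0"
      by (simp add: algebra_simps)
    also have "\<dots> = h * (?D ((y + s *\<^sub>R u) + h *\<^sub>R v) - ?D ((y + s *\<^sub>R u) + 0 *\<^sub>R v))"
      using s(3) by (simp add: add_ac)
    finally show "f (y + h *\<^sub>R u + h *\<^sub>R v) - f (y + h *\<^sub>R u) - f (y + h *\<^sub>R v) + f y =
       h\<^sup>2 * frechet_derivative ?D (at (y + s *\<^sub>R u + t *\<^sub>R v)) v"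
      using t(3) by (simp add: power2_eq_square)
  qed
qed

lemma second_derivative_symmetric_real:
  fixes f :: "'a::real_normed_vector \<Rightarrow> real"
  assumes S: "open S" "y \<in> S" and f: "smooth_on f S"
  shows "frechet_derivative (\<lambda>z. frechet_derivative f (at z) u) (at y) v =
         frechet_derivative (\<lambda>z. frechet_derivative f (at z) v) (at y) u"
proof (rule ccontr)
  let ?A = "\<lambda>z. frechet_derivative (\<lambda>z. frechet_derivative f (at z) u) (at z) v"
  let ?B = "\<lambda>z. frechet_derivative (\<lambda>z. frechet_derivative f (at z) v) (at z) u"
  assume ne: "?A y \<noteq> ?B y"
  define e where "e = \<bar>?A y - ?B y\<bar> / 2"
  have e: "e > 0" using ne by (simp add: e_def)
  have cont: "isCont ?A y" "isCont ?B y"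
    using S smooth_on_imp_continuous_on[OF smooth_on_deriv[OF smooth_on_deriv[OF f]]]
    by (auto simp: continuous_on_eq_continuous_at)
  obtain d1 where d1: "d1 > 0" "\<And>z. dist z y < d1 \<Longrightarrow> dist (?A z) (?A y) < e"
    using cont(1) e unfolding continuous_at_eps_delta by blast
  obtain d2 where d2: "d2 > 0" "\<And>z. dist z y < d2 \<Longrightarrow> dist (?B z) (?B y) < e"
    using cont(2) e unfolding continuous_at_eps_delta by blast
  obtain d3 where d3: "d3 > 0" "\<And>z. dist z y < d3 \<Longrightarrow> z \<in> S"
    using S unfolding open_dist by blast
  define d where "d = min d1 (min d2 d3)"
  have d: "d > 0" using d1 d2 d3 by (simp add: d_def)
  \<comment> \<open>Keeps the parallelogram with sides \<open>h *\<^sub>R u\<close> and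
    \<open>h *\<^sub>R v\<close> within distance \<open>d\<close> of \<open>y\<close>; the
    \<open>+ 1\<close> covers \<open>u = v = 0\<close>.\<close>
  define h where "h = d / (2 * (norm u + norm v + 1))"
  have h: "h > 0" using d by (simp add: h_def add_nonneg_pos)
  have near: "dist (y + s *\<^sub>R a + t *\<^sub>R b) y < d" if "s \<in> {0..h}" "t \<in> {0..h}"
    "norm a + norm b = norm u + norm v" for s t a b
  proof -
    have "dist (y + s *\<^sub>R a + t *\<^sub>R b) y = norm (s *\<^sub>R a + t *\<^sub>R b)" by (simp add: dist_norm)
    also have "\<dots> \<le> s * norm a + t * norm b"
      using that by (intro order_trans[OF norm_triangle_ineq]) simp
    also have "\<dots> \<le> h * norm a + h * norm b" using that by (intro add_mono mult_right_mono) auto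
    also have "\<dots> = h * (norm u + norm v)" using that(3) by (simp flip: distrib_left)
    also have "\<dots> \<le> h * (norm u + norm v + 1)" using h by simp
    also have "\<dots> = d / 2"
    proof -
      have "norm u + norm v + 1 \<noteq> 0" using add_nonneg_pos[of "norm u + norm v" 1] by simp
      moreover have "d / (2 * k) * k = d / 2" if "k \<noteq> 0" for k :: real
        using that by simp
      ultimately show ?thesis unfolding h_def by blast
    qed
    also have "\<dots> < d" using d by simp
    finally show ?thesis .
  qed
  obtain s t where st: "s \<in> {0..h}" "t \<in> {0..h}"
    "f (y + h *\<^sub>R u + h *\<^sub>R v) - f (y + h *\<^sub>R u) - f (y + h *\<^sub>R v) + f y = h\<^sup>2 * ?A (y + s *\<^sub>R u + t *\<^sub>R v)"
    using second_difference[OF f h, of y u v] near[of _ _ u v] d3(2) d_def by (metis min_less_iff_conj)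
  obtain s' t' where st': "s' \<in> {0..h}" "t' \<in> {0..h}"
    "f (y + h *\<^sub>R v + h *\<^sub>R u) - f (y + h *\<^sub>R v) - f (y + h *\<^sub>R u) + f y = h\<^sup>2 * ?B (y + s' *\<^sub>R v + t' *\<^sub>R u)"
    using second_difference[OF f h, of y v u] near[of _ _ v u] d3(2) d_def by (metis min_less_iff_conj add.commute)
  have "h\<^sup>2 * ?A (y + s *\<^sub>R u + t *\<^sub>R v) = h\<^sup>2 * ?B (y + s' *\<^sub>R v + t' *\<^sub>R u)"
    using st(3) st'(3) by (simp add: algebra_simps)
  then have eq: "?A (y + s *\<^sub>R u + t *\<^sub>R v) = ?B (y + s' *\<^sub>R v + t' *\<^sub>R u)" using h by simp
  have "dist (?A (y + s *\<^sub>R u + t *\<^sub>R v)) (?A y) < e"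
    using near[OF st(1,2)] by (intro d1) (auto simp: d_def)
  moreover have "dist (?B (y + s' *\<^sub>R v + t' *\<^sub>R u)) (?B y) < e"
    using near[OF st'(1,2), of v u] by (intro d2) (auto simp: d_def add.commute)
  ultimately have "dist (?A y) (?B y) < 2 * e"
    using dist_triangle[of "?A y" "?B y" "?A (y + s *\<^sub>R u + t *\<^sub>R v)"] unfolding eq
    by (simp add: dist_commute)
  then show False by (simp add: e_def dist_real_def)
qed

lemma second_derivative_symmetric:
  fixes f :: "'a::real_normed_vector \<Rightarrow> 'b::euclidean_space"
  assumes S: "open S" "y \<in> S" and f: "smooth_on f S"
  shows "frechet_derivative (\<lambda>z. frechet_derivative f (at z) u) (at y) v =
         frechet_derivative (\<lambda>z. frechet_derivative f (at z) v) (at y) u"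
proof (rule euclidean_eqI)
  fix b :: 'b assume "b \<in> Basis"
  have sb: "smooth_on (\<lambda>z. f z \<bullet> b) S"
    by (rule smooth_on_linear[OF bounded_linear_inner_left S(1) f])
  have comp: "frechet_derivative (\<lambda>z. g z \<bullet> b) (at z) w = frechet_derivative g (at z) w \<bullet> b"
    if "smooth_on g S" "z \<in> S" for g z w
    by (rule frechet_derivativeI[OF bounded_linear.has_derivative[OF bounded_linear_inner_left
            smooth_on_has_derivative[OF that]]])
  have c2: "frechet_derivative (\<lambda>z. frechet_derivative (\<lambda>z. f z \<bullet> b) (at z) u) (at y) v =
      frechet_derivative (\<lambda>z. frechet_derivative f (at z) u) (at y) v \<bullet> b" for u v
  proof -
    have "((\<lambda>z. frechet_derivative f (at z) u \<bullet> b) has_derivative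
        (\<lambda>v. frechet_derivative (\<lambda>z. frechet_derivative f (at z) u) (at y) v \<bullet> b)) (at y)"
      by (rule bounded_linear.has_derivative[OF bounded_linear_inner_left
            smooth_on_has_derivative[OF smooth_on_deriv[OF f] S(2)]])
    then have "((\<lambda>z. frechet_derivative (\<lambda>z. f z \<bullet> b) (at z) u) has_derivative
        (\<lambda>v. frechet_derivative (\<lambda>z. frechet_derivative f (at z) u) (at y) v \<bullet> b)) (at y)"
      by (rule has_derivative_transform_within_open[OF _ S]) (simp add: comp[OF f])
    then show ?thesis by (rule frechet_derivativeI)
  qed
  show "frechet_derivative (\<lambda>z. frechet_derivative f (at z) u) (at y) v \<bullet> b =
         frechet_derivative (\<lambda>z. frechet_derivative f (at z) v) (at y) u \<bullet> b"
    using second_derivative_symmetric_real[OF S sb, of u v] by (simp add: c2)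
qed

text \<open>Gronwall's inequality in maximum form: on a ball of radius \<open>r\<close> with
  \<open>c * r \<le> 1 / 2\<close> the mean value inequality bounds the maximum of the sum of norms
  by half of itself. This is uniqueness for an overdetermined linear first-order system.\<close>

lemma vanishing_near:
  fixes h :: "'i \<Rightarrow> 'z::euclidean_space \<Rightarrow> 'w::real_normed_vector"
  assumes S: "open S" "y \<in> S" and I: "finite I"
    and der: "\<And>i z. i \<in> I \<Longrightarrow> z \<in> S \<Longrightarrow> (h i has_derivative h' i z) (at z)"
    and K: "continuous_on S K"
    and bound: "\<And>i z b. i \<in> I \<Longrightarrow> z \<in> S \<Longrightarrow> b \<in> Basis \<Longrightarrow> norm (h' i z b) \<le> K z * (\<Sum>j\<in>I. norm (h j z))"
    and zero: "\<And>i. i \<in> I \<Longrightarrow> h i y = 0"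
  obtains r where "r > 0" "ball y r \<subseteq> S" "\<And>i z. i \<in> I \<Longrightarrow> z \<in> ball y r \<Longrightarrow> h i z = 0"
proof -
  obtain r0 where r0: "r0 > 0" "cball y r0 \<subseteq> S" using S open_contains_cball by blast
  have "compact (K ` cball y r0)"
    using K r0 by (intro compact_continuous_image) (auto intro: continuous_on_subset)
  then have "bounded (K ` cball y r0)" by (rule compact_imp_bounded)
  then obtain K0 where K0: "K0 > 0" "\<And>z. z \<in> cball y r0 \<Longrightarrow> \<bar>K z\<bar> \<le> K0"
    unfolding bounded_pos by auto
  \<comment> \<open>The mean value inequality will give \<open>T p \<le> (c - 1) * r * T p\<close>;
    the \<open>+ 1\<close> keeps \<open>c\<close> positive also for empty \<open>I\<close>.\<close>
  define c where "c = real (card I) * (real DIM('z) * K0) + 1"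
  have c: "c > 0" using K0 by (simp add: c_def add_nonneg_pos)
  define r where "r = min r0 (1 / (2 * c))"
  have r: "r > 0" "r \<le> r0" "c * r \<le> 1 / 2" using r0 c by (auto simp: r_def field_simps min_def)
  define T where "T z = (\<Sum>j\<in>I. norm (h j z))" for z
  have T0: "T z \<ge> 0" for z unfolding T_def by (simp add: sum_nonneg)
  have sub: "cball y r \<subseteq> S" using r r0 by (meson order_trans subset_cball)
  have "continuous_on (cball y r) T" unfolding T_def
  proof (intro continuous_on_sum continuous_on_norm)
    fix i assume "i \<in> I"
    then show "continuous_on (cball y r) (h i)"
      using der sub by (intro continuous_at_imp_continuous_on) (auto dest: has_derivative_continuous)
  qed
  from continuous_attains_sup[OF compact_cball _ this] r
  obtain p where p: "p \<in> cball y r" "\<And>z. z \<in> cball y r \<Longrightarrow> T z \<le> T p" by auto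
  have "norm (h i p) \<le> real DIM('z) * K0 * T p * r" if i: "i \<in> I" for i
  proof -
    have "norm (h i p - h i y) \<le> real DIM('z) * K0 * T p * norm (p - y)"
    proof (rule differentiable_bound[of "cball y r" "h i" "h' i"])
      show "convex (cball y r)" by (rule convex_cball)
      show "p \<in> cball y r" "y \<in> cball y r" using p r by auto
      fix z assume z: "z \<in> cball y r"
      then have zS: "z \<in> S" using sub by auto
      show d: "(h i has_derivative h' i z) (at z within cball y r)"
        using der[OF i zS] has_derivative_at_withinI by blast
      show "onorm (h' i z) \<le> real DIM('z) * K0 * T p"
      proof (rule onorm_le)
        fix x :: 'z
        have "linear (h' i z)" using der[OF i zS] has_derivative_linear by blast
        from linear_basis_expand[OF this, of x]
        have "norm (h' i z x) = norm (\<Sum>b\<in>Basis. (x \<bullet> b) *\<^sub>R h' i z b)" by simp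
        also have "\<dots> \<le> (\<Sum>b\<in>Basis. norm ((x \<bullet> b) *\<^sub>R h' i z b))" by (rule norm_sum)
        also have "\<dots> \<le> (\<Sum>b\<in>(Basis::'z set). norm x * (K0 * T p))"
        proof (rule sum_mono)
          fix b :: 'z assume b: "b \<in> Basis"
          have "norm (h' i z b) \<le> K z * T z" using bound[OF i zS b] by (simp add: T_def)
          also have "\<dots> \<le> K0 * T p"
            using K0(2)[of z] z r p(2)[OF z] T0 K0(1) by (intro mult_mono) (auto simp: abs_le_iff)
          finally show "norm ((x \<bullet> b) *\<^sub>R h' i z b) \<le> norm x * (K0 * T p)"
            using Basis_le_norm[OF b, of x] by (simp add: mult_mono)
        qed
        finally show "norm (h' i z x) \<le> real DIM('z) * K0 * T p * norm x" by (simp add: mult_ac)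
      qed
    qed
    also have "\<dots> \<le> real DIM('z) * K0 * T p * r"
      using p(1) K0 T0 by (intro mult_left_mono) (auto simp: dist_norm norm_minus_commute)
    finally show ?thesis using zero[OF i] by simp
  qed
  then have "T p \<le> (\<Sum>i\<in>I. real DIM('z) * K0 * T p * r)" unfolding T_def[of p] by (intro sum_mono) (simp add: T_def)
  also have "\<dots> = real (card I) * (real DIM('z) * K0) * r * T p" by simp
  also have "\<dots> \<le> c * r * T p" using r T0 by (intro mult_right_mono) (auto simp: c_def)
  also have "\<dots> \<le> 1 / 2 * T p" using r T0 by (intro mult_right_mono) auto
  finally have "T p = 0" using T0[of p] by simp
  show thesis
  proof (rule that[OF r(1)])
    show "ball y r \<subseteq> S" using sub by auto
    fix i z assume i: "i \<in> I" and z: "z \<in> ball y r"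
    then have "T z \<le> 0" using p(2)[of z] \<open>T p = 0\<close> by auto
    then have "T z = 0" using T0[of z] by simp
    then show "h i z = 0" using i I unfolding T_def by (simp add: sum_nonneg_eq_0_iff)
  qed
qed

text \<open>An injective linear map on a finite-dimensional space is bounded below by
  \<open>e * norm x\<close>, which survives perturbations smaller than \<open>e\<close>. The filter
  is arbitrary, to serve both a real parameter tending to 0 and a moving base point.\<close>

lemma injective_on_perturb:
  fixes L :: "'z \<Rightarrow> 'x::euclidean_space \<Rightarrow> 'y::euclidean_space"
  assumes C: "subspace C" and lin: "\<And>z. linear (L z)" "linear L0"
    and inj: "\<And>x. x \<in> C \<Longrightarrow> L0 x = 0 \<Longrightarrow> x = 0"
    and lim: "\<And>b. b \<in> Basis \<Longrightarrow> ((\<lambda>z. L z b) \<longlongrightarrow> L0 b) F"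
  shows "\<forall>\<^sub>F z in F. \<forall>x\<in>C. L z x = 0 \<longrightarrow> x = 0"
proof -
  obtain e where e: "e > 0" "\<And>x. x \<in> C \<Longrightarrow> norm (L0 x) \<ge> e * norm x"
    using injective_imp_isometric[OF closed_subspace[OF C] C, of L0] inj lin(2)
    by (auto simp: linear_conv_bounded_linear)
  have "((\<lambda>z. \<Sum>b\<in>Basis. norm (L z b - L0 b)) \<longlongrightarrow> (\<Sum>b\<in>(Basis::'x set). norm (L0 b - L0 b))) F"
    by (intro tendsto_sum tendsto_norm tendsto_diff lim tendsto_const)
  then have "\<forall>\<^sub>F z in F. (\<Sum>b\<in>Basis. norm (L z b - L0 b)) < e"
    using e(1) by (intro order_tendstoD) auto
  then show ?thesis
  proof eventually_elim
    case (elim z)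
    show ?case
    proof (intro ballI impI, rule ccontr)
      fix x assume x: "x \<in> C" "L z x = 0" "x \<noteq> 0"
      have "linear (\<lambda>x. L z x - L0 x)" using lin by (intro linear_compose_sub) auto
      from linear_basis_expand[OF this, of x]
      have "norm (L z x - L0 x) = norm (\<Sum>b\<in>Basis. (x \<bullet> b) *\<^sub>R (L z b - L0 b))" by simp
      also have "\<dots> \<le> (\<Sum>b\<in>Basis. norm ((x \<bullet> b) *\<^sub>R (L z b - L0 b)))" by (rule norm_sum)
      also have "\<dots> \<le> (\<Sum>b\<in>Basis. norm x * norm (L z b - L0 b))"
        by (rule sum_mono) (auto intro!: mult_right_mono Basis_le_norm)
      also have "\<dots> = norm x * (\<Sum>b\<in>Basis. norm (L z b - L0 b))" by (simp add: sum_distrib_left)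
      also have "\<dots> < norm x * e" using elim x by (intro mult_strict_left_mono) auto
      finally show False using e(2)[OF x(1)] x(2) by (simp add: mult.commute)
    qed
  qed
qed

text \<open>If \<open>\<beta> Z Y\<close> lay outside the image,
  \<open>\<beta> (X + t *\<^sub>R Z)\<close> would have larger rank than \<open>\<beta> X\<close>
  for small \<open>t\<close>: on a complement of the kernel it is close to \<open>\<beta> X\<close>,
  and it sends \<open>Y / t\<close> exactly to \<open>\<beta> Z Y\<close>.\<close>

lemma regular_element:
  fixes \<beta> :: "'x::euclidean_space \<Rightarrow> 'y::euclidean_space \<Rightarrow> 'z::euclidean_space"
  assumes bil: "bilinear \<beta>" and D: "subspace D" "subspace D2"
    and X: "X \<in> D" "\<And>X'. X' \<in> D \<Longrightarrow> dim (\<beta> X' ` D2) \<le> dim (\<beta> X ` D2)"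
    and Z: "Z \<in> D" and Y: "Y \<in> D2" "\<beta> X Y = 0"
  shows "\<beta> Z Y \<in> \<beta> X ` D2"
proof (rule ccontr)
  assume nin: "\<beta> Z Y \<notin> \<beta> X ` D2"
  have lin: "linear (\<beta> x)" for x using bil by (simp add: bilinear_def)
  have sub: "subspace (\<beta> X ` D2)" by (intro linear_subspace_image lin D)
  have Y0: "Y \<noteq> 0" using nin linear_0[OF lin] subspace_0[OF sub] by auto
  define Ker where "Ker = {v \<in> D2. \<beta> X v = 0}"
  have Ker: "subspace Ker" unfolding Ker_def
    using D lin by (auto simp: subspace_def linear_add linear_scale linear_0)
  define C where "C = {c \<in> D2. \<forall>k\<in>Ker. orthogonal k c}"
  have C: "subspace C" unfolding C_def
    using D by (auto simp: subspace_def orthogonal_clauses)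
  have YK: "Y \<in> Ker" using Y by (simp add: Ker_def)
  have img: "\<beta> X ` D2 \<subseteq> \<beta> X ` C"
  proof (intro subsetI, elim imageE)
    fix w x assume w: "w = \<beta> X x" and x: "x \<in> D2"
    obtain k c where kc: "k \<in> span Ker" "\<And>w. w \<in> span Ker \<Longrightarrow> orthogonal c w" "x = k + c"
      using orthogonal_subspace_decomp_exists[of Ker x] by metis
    have k: "k \<in> Ker" using kc Ker by (metis span_eq_iff)
    have "c = x - k" using kc by simp
    then have "c \<in> D2" using x k D by (auto simp: Ker_def subspace_diff)
    then have "c \<in> C" using kc(2) by (auto simp: C_def orthogonal_commute span_base)
    moreover have "w = \<beta> X c" using w kc(3) k by (simp add: linear_add[OF lin] Ker_def)
    ultimately show "w \<in> \<beta> X ` C" by blast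
  qed
  have dimC: "dim (\<beta> X ` D2) \<le> dim C"
    using dim_subset[OF img] dim_image_le[OF lin, of X C] by linarith
  have YC: "Y \<notin> C" using YK Y0 by (auto simp: C_def orthogonal_def intro!: bexI[of _ Y])
  define C' where "C' = span (insert Y C)"
  have C': "subspace C'" by (simp add: C'_def)
  have C'D: "C' \<subseteq> D2"
    unfolding C'_def using Y by (intro span_minimal D(2)) (auto simp: C_def)
  have dimC': "dim C' = dim C + 1"
    using YC span_eq_iff[THEN iffD2, OF C] by (simp add: C'_def dim_insert del: span_eq_iff)
  define s where "s v = (v \<bullet> Y) / (Y \<bullet> Y)" for v
  have s: "linear s" unfolding s_def by (intro linearI) (auto simp: inner_add_left add_divide_distrib)
  have sC: "v - s v *\<^sub>R Y \<in> C" if vC: "v \<in> C'" for v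
  proof -
    obtain a where a: "v - a *\<^sub>R Y \<in> span C" using vC unfolding C'_def span_insert by blast
    then have c: "v - a *\<^sub>R Y \<in> C" using C by (metis span_eq_iff)
    then have "Y \<bullet> (v - a *\<^sub>R Y) = 0" using YK by (auto simp: C_def orthogonal_def)
    then have "s v = a" using Y0 by (simp add: s_def inner_diff_right inner_commute field_simps)
    then show ?thesis using c by simp
  qed
  \<comment> \<open>This is \<open>\<beta> (X + t *\<^sub>R Z)\<close> after stretching the
    \<open>Y\<close>-component by \<open>1 / t\<close>, written so that it extends to
    \<open>t = 0\<close>. There it equals \<open>\<beta> X\<close> on \<open>C\<close> and sends
    \<open>Y\<close> to \<open>\<beta> Z Y\<close>.\<close>
  define L where "L t v = \<beta> X v + t *\<^sub>R \<beta> Z v + (s v * (1 - t)) *\<^sub>R \<beta> Z Y" for t v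
  have linL: "linear (L t)" for t unfolding L_def
    by (intro linearI) (simp_all add: linear_add[OF lin] linear_scale[OF lin] linear_add[OF s] linear_scale[OF s] algebra_simps)
  have inj0: "v = 0" if v: "v \<in> C'" and L0: "L 0 v = 0" for v
  proof -
    have s0: "s v = 0"
    proof (rule ccontr)
      assume a: "s v \<noteq> 0"
      have "s v *\<^sub>R \<beta> Z Y = - \<beta> X v" using L0 by (simp add: L_def eq_neg_iff_add_eq_0 add.commute)
      then have "(1 / s v) *\<^sub>R s v *\<^sub>R \<beta> Z Y = (1 / s v) *\<^sub>R - \<beta> X v" by simp
      then have "\<beta> Z Y = (- 1 / s v) *\<^sub>R \<beta> X v" using a by simp
      then have "\<beta> Z Y = \<beta> X ((- 1 / s v) *\<^sub>R v)" using linear_scale[OF lin, of X "- 1 / s v" v] by simp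
      moreover have "(- 1 / s v) *\<^sub>R v \<in> D2" using v C'D by (intro subspace_scale D(2)) auto
      ultimately show False using nin by blast
    qed
    then have "v \<in> C" using sC[OF v] by simp
    moreover have "v \<in> Ker" using L0 s0 v C'D by (auto simp: L_def Ker_def)
    ultimately show "v = 0" by (auto simp: C_def orthogonal_def)
  qed
  have "((\<lambda>t. L t b) \<longlongrightarrow> L 0 b) (at (0::real))" for b
    unfolding L_def by (auto intro!: tendsto_eq_intros)
  from injective_on_perturb[OF C' linL linL inj0 this]
  have "\<forall>\<^sub>F t in at 0. \<forall>x\<in>C'. L t x = 0 \<longrightarrow> x = 0" .
  moreover have "\<forall>\<^sub>F t in at 0. t \<noteq> (0::real)" by (simp add: eventually_at_filter)
  ultimately have ev: "\<forall>\<^sub>F t in at (0::real). t \<noteq> 0 \<and> (\<forall>x\<in>C'. L t x = 0 \<longrightarrow> x = 0)" by eventually_elim auto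
  obtain t where t: "t \<noteq> 0" "\<And>x. x \<in> C' \<Longrightarrow> L t x = 0 \<Longrightarrow> x = 0"
  proof -
    obtain t where "t \<noteq> 0 \<and> (\<forall>x\<in>C'. L t x = 0 \<longrightarrow> x = 0)"
      using eventually_happens[OF ev] by auto
    then show thesis using that by blast
  qed
  have "L t ` C' \<subseteq> \<beta> (X + t *\<^sub>R Z) ` D2"
  proof (intro image_subsetI)
    fix v assume v: "v \<in> C'"
    have "\<beta> (X + t *\<^sub>R Z) (v - s v *\<^sub>R Y + (s v / t) *\<^sub>R Y) = L t v"
      using t(1) Y(2)
      by (simp add: L_def bilinear_ladd[OF bil] bilinear_lmul[OF bil] bilinear_radd[OF bil]
          bilinear_rmul[OF bil] bilinear_rsub[OF bil] algebra_simps)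
    moreover have "v - s v *\<^sub>R Y + (s v / t) *\<^sub>R Y \<in> D2"
      using v C'D Y D by (auto intro!: subspace_add subspace_diff subspace_scale)
    ultimately show "L t v \<in> \<beta> (X + t *\<^sub>R Z) ` D2" by (metis imageI)
  qed
  then have "dim (L t ` C') \<le> dim (\<beta> X ` D2)"
    using X(2)[of "X + t *\<^sub>R Z"] dim_subset D X(1) Z
    by (meson order_trans subspace_add subspace_scale)
  moreover have "dim (L t ` C') = dim C'"
  proof (rule dim_image_eq[OF linL])
    show "inj_on (L t) (span C')"
      using C' t(2) linear_injective_on_subspace_0[OF linL C'] span_eq_iff[THEN iffD2, OF C'] by (auto simp del: span_eq_iff)
  qed
  ultimately show False using dimC dimC' by linarith
qed

text \<open>The form may be indefinite and \<open>U\<close> may meet its own complement, so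
  \<open>W\<close> need not split. Instead \<open>Q w u\<close> is written as the Euclidean product
  \<open>w \<bullet> M u\<close>; nondegeneracy makes \<open>M\<close> injective on
  \<open>U\<close>, and the Euclidean dimension formula applies to the image of \<open>U\<close>
  under \<open>M\<close>.\<close>

lemma dim_form_complement:
  fixes Q :: "'z::euclidean_space \<Rightarrow> 'z \<Rightarrow> real"
  assumes Q: "bilinear Q" and W: "subspace W" and U: "subspace U" "U \<subseteq> W"
    and nondeg: "\<And>u. u \<in> W \<Longrightarrow> (\<And>w. w \<in> W \<Longrightarrow> Q w u = 0) \<Longrightarrow> u = 0"
  shows "dim {w \<in> W. \<forall>u\<in>U. Q w u = 0} + dim U = dim W"
proof -
  obtain B where B: "B \<subseteq> W" "pairwise orthogonal B" "\<And>x. x \<in> B \<Longrightarrow> norm x = 1"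
    "independent B" "span B = W" using orthonormal_basis_subspace[OF W] by metis
  have fin: "finite B" using B(4) by (rule independent_imp_finite)
  have linl: "linear (\<lambda>w. Q w u)" and linr: "linear (Q w)" for u w using Q by (auto simp: bilinear_def)
  define M where "M u = (\<Sum>b\<in>B. Q b u *\<^sub>R b)" for u
  have MW: "M u \<in> W" for u unfolding M_def using B W by (auto intro!: subspace_sum subspace_scale)
  have M: "w \<bullet> M u = Q w u" if "w \<in> W" for w u
  proof -
    have "w = (\<Sum>b\<in>B. (w \<bullet> b) *\<^sub>R b)"
      using orthonormal_basis_expand[OF B(2,3)] that B(5) fin by metis
    then have "Q w u = (\<Sum>b\<in>B. (w \<bullet> b) * Q b u)"
      by (metis (mono_tags, lifting) linear_scale[OF linl] linear_sum[OF linl] real_scaleR_def sum.cong)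
    also have "\<dots> = w \<bullet> M u" by (simp add: M_def inner_sum_right mult.commute)
    finally show ?thesis by simp
  qed
  have linM: "linear M" unfolding M_def
    by (intro linearI) (simp_all add: linear_add[OF linr] linear_scale[OF linr] scaleR_add_left sum.distrib scaleR_sum_right)
  have "dim (M ` U) = dim U"
  proof (rule dim_image_eq[OF linM])
    have "x = 0" if "x \<in> U" "M x = 0" for x
      using nondeg[of x] that U M[of _ x] by auto
    then show "inj_on M (span U)"
      using linear_injective_on_subspace_0[OF linM U(1)] span_eq_iff[THEN iffD2, OF U(1)] by (auto simp del: span_eq_iff)
  qed
  moreover have "dim {w \<in> W. \<forall>x\<in>M ` U. orthogonal x w} + dim (M ` U) = dim W"
    using U W MW by (intro dim_subspace_orthogonal_to_vectors linear_subspace_image linM) auto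
  moreover have "{w \<in> W. \<forall>x\<in>M ` U. orthogonal x w} = {w \<in> W. \<forall>u\<in>U. Q w u = 0}"
    using M by (auto simp: orthogonal_def inner_commute)
  ultimately show ?thesis by simp
qed

section \<open>Hermitian inner products\<close>

lemma riesz_form:
  fixes b :: "'e::euclidean_space \<Rightarrow> 'e \<Rightarrow> real"
  assumes b: "bilinear b" "\<And>u. u \<noteq> 0 \<Longrightarrow> b u u > 0" and l: "linear l"
  shows "\<exists>z. \<forall>w. b z w = l w"
proof -
  define L where "L z = (\<Sum>i\<in>Basis. b z i *\<^sub>R i)" for z
  have linb: "linear (b z)" for z using b(1) by (auto simp: bilinear_def)
  have linL: "linear L" unfolding L_def
    by (rule linearI) (simp_all add: bilinear_ladd[OF b(1)] bilinear_lmul[OF b(1)] algebra_simps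
        sum.distrib scaleR_sum_right)
  have LI: "L z \<bullet> w = b z w" for z w
    using linear_basis_expand[OF linb, of z w]
    by (simp add: L_def inner_sum_left inner_commute[of w] mult.commute)
  have "z = 0" if "L z = 0" for z
    using LI[of z z] b(2)[of z] that by force
  then have "surj L" using linear_injective_imp_surjective[OF linL] linear_injective_0[OF linL] by blast
  then obtain z where z: "L z = (\<Sum>i\<in>Basis. l i *\<^sub>R i)" by (metis surjD)
  have "b z w = l w" for w
    using linear_basis_expand[OF l, of w]
    by (simp add: LI[symmetric] z inner_sum_left inner_commute[of w] mult.commute)
  then show ?thesis by blast
qed

locale hermitian =
  fixes g :: "'e::euclidean_space \<Rightarrow> 'e \<Rightarrow> real" and J :: "'e \<Rightarrow> 'e"
  assumes g_bilinear: "bilinear g"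
    and g_sym: "g u v = g v u"
    and g_pos: "u \<noteq> 0 \<Longrightarrow> g u u > 0"
    and J_linear: "linear J"
    and J_square: "J (J u) = - u"
    and J_orthogonal: "g (J u) (J v) = g u v"
begin

lemmas g_simps =
  bilinear_ladd[OF g_bilinear] bilinear_radd[OF g_bilinear] bilinear_lmul[OF g_bilinear]
  bilinear_rmul[OF g_bilinear] bilinear_lsub[OF g_bilinear] bilinear_rsub[OF g_bilinear]
  bilinear_lneg[OF g_bilinear] bilinear_rneg[OF g_bilinear]
  bilinear_lzero[OF g_bilinear] bilinear_rzero[OF g_bilinear]

lemmas J_simps = linear_add[OF J_linear] linear_scale[OF J_linear] linear_neg[OF J_linear]
  linear_0[OF J_linear] linear_diff[OF J_linear] J_square

lemma g_eqI: "(\<And>w. g u w = g v w) \<Longrightarrow> u = v"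
  using g_pos[of "u - v"] by (force simp: g_simps)

lemma g_J_left: "g (J u) v = - g u (J v)"
  using J_orthogonal[of u "J v"] by (simp add: J_square g_simps)

lemma g_J_self: "g u (J u) = 0"
  using g_J_left[of u u] g_sym[of u "J u"] by simp

lemma g_linear_right: "linear (g u)" and g_linear_left: "linear (\<lambda>v. g v u)"
  using g_bilinear by (auto simp: bilinear_def)

text \<open>The maximiser of the Rayleigh quotient: \<open>h\<close> is nonnegative on
  \<open>Q\<close> and vanishes at \<open>x\<close>, so its first variation vanishes there. The
  quotient is homogeneous, so it may be maximised over the Euclidean sphere, where compactness is
  immediate.\<close>

lemma symmetric_eigenvector:
  assumes S: "linear S" "\<And>u v. g (S u) v = g u (S v)"
    and Q: "subspace Q" "\<And>x. x \<in> Q \<Longrightarrow> S x \<in> Q" "Q \<noteq> {0}"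
  obtains x a where "x \<in> Q" "x \<noteq> 0" "S x = a *\<^sub>R x"
proof -
  let ?K = "Q \<inter> sphere 0 1"
  obtain q where q: "q \<in> Q" "q \<noteq> 0" using Q(1,3) subspace_0 by blast
  then have "(1 / norm q) *\<^sub>R q \<in> ?K" using Q(1) by (auto intro: subspace_scale)
  then have ne: "?K \<noteq> {}" by blast
  have comp: "compact ?K" using Q(1) by (simp add: closed_Int_compact closed_subspace)
  have bb: "bounded_bilinear g" using g_bilinear by (simp add: bilinear_conv_bounded_bilinear)
  have bS: "bounded_linear S" using S(1) by (simp add: linear_conv_bounded_linear)
  have pos: "g x x > 0" if "x \<in> ?K" for x using that by (intro g_pos) auto
  have "continuous_on ?K (\<lambda>x. g (S x) x / g x x)"
    using pos by (intro continuous_on_divide bounded_bilinear.continuous_on[OF bb]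
        bounded_linear.continuous_on[OF bS] continuous_on_id) force
  from continuous_attains_sup[OF comp ne this] obtain x where x: "x \<in> ?K"
    "\<And>v. v \<in> ?K \<Longrightarrow> g (S v) v / g v v \<le> g (S x) x / g x x" by auto
  define a where "a = g (S x) x / g x x"
  define h where "h v = a * g v v - g (S v) v" for v
  have h0: "h v \<ge> 0" if v: "v \<in> Q" for v
  proof (cases "v = 0")
    case False
    define w where "w = (1 / norm v) *\<^sub>R v"
    have w: "w \<in> ?K" "v = norm v *\<^sub>R w" using False v Q(1) by (auto simp: w_def intro: subspace_scale)
    have "g (S w) w \<le> a * g w w" using x(2)[OF w(1)] pos[OF w(1)] by (simp add: a_def field_simps)
    then have "norm v * norm v * g (S w) w \<le> norm v * norm v * (a * g w w)" by (intro mult_left_mono) auto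
    moreover have "g (S v) v = norm v * norm v * g (S w) w" "g v v = norm v * norm v * g w w"
      by (subst (1 2) w(2), simp add: linear_scale[OF S(1)] g_simps)+
    ultimately show ?thesis by (simp add: h_def algebra_simps)
  qed (simp add: h_def g_simps linear_0[OF S(1)])
  have hx: "h x = 0" using pos[OF x(1)] by (simp add: h_def a_def)
  have "g (a *\<^sub>R x - S x) w = 0" if w: "w \<in> Q" for w
  proof -
    define e where "e = g (a *\<^sub>R x - S x) w"
    have exp: "h (x + t *\<^sub>R w) = 2 * t * e + t\<^sup>2 * h w" for t
    proof -
      have "g (S x) w = g (S w) x" using S(2)[of x w] g_sym by simp
      then have "h (x + t *\<^sub>R w) = h x + 2 * t * e + t\<^sup>2 * h w"
        using g_sym[of x w]
        by (simp add: h_def e_def g_simps linear_add[OF S(1)] linear_scale[OF S(1)] power2_eq_square algebra_simps)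
      then show ?thesis using hx by simp
    qed
    \<comment> \<open>With \<open>t = - e / k\<close> the inequality
      \<open>0 \<le> 2 * t * e + t\<^sup>2 * h w\<close> becomes
      \<open>e\<^sup>2 * (k + 1) \<le> 0\<close>; adding 1 to \<open>h w\<close> makes the division
      legitimate.\<close>
    define k where "k = h w + 1"
    have k: "k > 0" "h w = k - 1" using h0[OF w] by (simp_all add: k_def)
    have "0 \<le> h (x + (- e / k) *\<^sub>R w)"
      using w x(1) Q(1) by (intro h0 subspace_add subspace_scale) auto
    then have "0 \<le> k\<^sup>2 * (2 * (- e / k) * e + (- e / k)\<^sup>2 * (k - 1))"
      unfolding exp k(2) by simp
    also have "\<dots> = - (e\<^sup>2 * (k + 1))"
      using k(1) by (simp add: field_simps power2_eq_square)
    finally have "e\<^sup>2 * (k + 1) \<le> 0" by simp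
    then have "e\<^sup>2 \<le> 0" using k(1) by (simp add: mult_le_0_iff)
    then show ?thesis by (simp add: e_def)
  qed
  from this[of "a *\<^sub>R x - S x"] have "a *\<^sub>R x - S x = 0"
    using x(1) Q(1,2) g_pos[of "a *\<^sub>R x - S x"] by (force intro: subspace_diff subspace_scale)
  then show thesis using x(1) that[of x a] norm_zero by force
qed

text \<open>Either every operator is scalar on \<open>Q\<close>, or an eigenspace of a non-scalar
  one is a proper subspace, preserved by the others because they commute with it. Induction on the
  dimension allows infinite families.\<close>

lemma joint_eigenvector:
  assumes lin: "\<And>S. S \<in> \<S> \<Longrightarrow> linear S" and sym: "\<And>S u v. S \<in> \<S> \<Longrightarrow> g (S u) v = g u (S v)"
    and comm: "\<And>S T u. S \<in> \<S> \<Longrightarrow> T \<in> \<S> \<Longrightarrow> S (T u) = T (S u)"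
    and Q: "subspace Q" "\<And>S x. S \<in> \<S> \<Longrightarrow> x \<in> Q \<Longrightarrow> S x \<in> Q" "Q \<noteq> {0}"
  shows "\<exists>x\<in>Q. x \<noteq> 0 \<and> (\<forall>S\<in>\<S>. \<exists>a. S x = a *\<^sub>R x)"
  using Q
proof (induction "dim Q" arbitrary: Q rule: less_induct)
  case less
  show ?case
  proof (cases "\<forall>S\<in>\<S>. \<exists>a. \<forall>x\<in>Q. S x = a *\<^sub>R x")
    case True
    obtain x where "x \<in> Q" "x \<noteq> 0" using less.prems subspace_0 by blast
    then show ?thesis using True by blast
  next
    case False
    then obtain S where S: "S \<in> \<S>" "\<And>a. \<exists>x\<in>Q. S x \<noteq> a *\<^sub>R x" by blast
    obtain x a where x: "x \<in> Q" "x \<noteq> 0" "S x = a *\<^sub>R x"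
      using symmetric_eigenvector[OF lin[OF S(1)] sym[OF S(1)] less.prems(1) less.prems(2)[OF S(1)] less.prems(3)]
      by blast
    define Q' where "Q' = {x \<in> Q. S x = a *\<^sub>R x}"
    have Q': "subspace Q'" using less.prems(1) lin[OF S(1)]
      by (auto simp: Q'_def subspace_def linear_add linear_scale linear_0 scaleR_add_right)
    have "Q' \<subset> Q" using S(2)[of a] by (auto simp: Q'_def)
    then have "dim Q' < dim Q"
      using Q' less.prems(1) by (intro dim_psubset) (simp add: span_eq_iff[THEN iffD2])
    moreover have "T x \<in> Q'" if "T \<in> \<S>" "x \<in> Q'" for T x
      using that less.prems(2) comm[OF S(1) that(1), of x] lin[OF that(1)]
      by (auto simp: Q'_def linear_scale)
    moreover have "Q' \<noteq> {0}" using x by (auto simp: Q'_def)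
    ultimately have "\<exists>x\<in>Q'. x \<noteq> 0 \<and> (\<forall>S\<in>\<S>. \<exists>a. S x = a *\<^sub>R x)" using less.hyps Q' by blast
    then show ?thesis by (auto simp: Q'_def)
  qed
qed

text \<open>Since the operators commute with \<open>J\<close>, an eigenvector \<open>x\<close>
  brings along \<open>J x\<close> with the same eigenvalues. The complement of this complex line is
  invariant under the family and under \<open>J\<close>, so two real dimensions split off at each
  step.\<close>

lemma joint_eigenframe:
  assumes lin: "\<And>S. S \<in> \<S> \<Longrightarrow> linear S" and sym: "\<And>S u v. S \<in> \<S> \<Longrightarrow> g (S u) v = g u (S v)"
    and comm: "\<And>S T u. S \<in> \<S> \<Longrightarrow> T \<in> \<S> \<Longrightarrow> S (T u) = T (S u)"
    and commJ: "\<And>S u. S \<in> \<S> \<Longrightarrow> S (J u) = J (S u)"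
    and Q: "subspace Q" "\<And>S x. S \<in> \<S> \<Longrightarrow> x \<in> Q \<Longrightarrow> S x \<in> Q" "\<And>x. x \<in> Q \<Longrightarrow> J x \<in> Q"
  shows "\<exists>k X. dim Q = 2 * k \<and> (\<forall>i<k. X i \<in> Q \<and> (\<forall>S\<in>\<S>. \<exists>a. S (X i) = a *\<^sub>R X i)) \<and>
    (\<forall>i<k. \<forall>j<k. g (X i) (X j) = (if i = j then 1 else 0) \<and> g (X i) (J (X j)) = 0) \<and>
    (\<forall>v\<in>Q. v = (\<Sum>i<k. g v (X i) *\<^sub>R X i + g v (J (X i)) *\<^sub>R J (X i)))"
  using Q
proof (induction "dim Q" arbitrary: Q rule: less_induct)
  case less
  show ?case
  proof (cases "Q = {0}")
    case True
    then show ?thesis by (intro exI[of _ 0]) simp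
  next
    case False
    obtain x0 where x0: "x0 \<in> Q" "x0 \<noteq> 0" "\<And>S. S \<in> \<S> \<Longrightarrow> \<exists>a. S x0 = a *\<^sub>R x0"
    proof -
      have "\<exists>x\<in>Q. x \<noteq> 0 \<and> (\<forall>S\<in>\<S>. \<exists>a. S x = a *\<^sub>R x)"
        by (rule joint_eigenvector) (fact lin sym comm less.prems False)+
      then show thesis using that by blast
    qed
    define x where "x = (1 / sqrt (g x0 x0)) *\<^sub>R x0"
    have xQ: "x \<in> Q" using x0 less.prems by (auto simp: x_def intro: subspace_scale)
    then have JxQ: "J x \<in> Q" by (rule less.prems(3))
    note xQ = xQ JxQ
    have xx: "g x x = 1" using g_pos[OF x0(2)] by (simp add: x_def g_simps)
    have eig: "\<exists>a. S x = a *\<^sub>R x" if S: "S \<in> \<S>" for S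
      using x0(3)[OF S] by (auto simp: x_def linear_scale[OF lin[OF S]])
    have xJ: "g x (J x) = 0" "g (J x) x = 0" "g (J x) (J x) = 1"
      using g_J_self g_sym J_orthogonal xx by auto
    define Q' where "Q' = {v \<in> Q. g v x = 0 \<and> g v (J x) = 0}"
    have Q': "subspace Q'" using less.prems(1)
      by (auto simp: Q'_def subspace_def g_simps)
    have dec: "v - g v x *\<^sub>R x - g v (J x) *\<^sub>R J x \<in> Q'" if "v \<in> Q" for v
      using that xQ less.prems(1) xx xJ
      by (auto simp: Q'_def g_simps intro!: subspace_diff subspace_scale)
    have spQ': "span Q' = Q'" using Q' by (simp add: span_eq_iff)
    have a1: "J x \<notin> span Q'" unfolding spQ' using xJ by (auto simp: Q'_def)
    have a2: "x \<notin> span (insert (J x) Q')"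
    proof
      assume "x \<in> span (insert (J x) Q')"
      then obtain k where k: "x - k *\<^sub>R J x \<in> span Q'" unfolding span_insert by blast
      then have "g (x - k *\<^sub>R J x) x = 0" unfolding spQ' by (auto simp: Q'_def)
      then show False using xx xJ by (simp add: g_simps)
    qed
    have sp: "span (insert x (insert (J x) Q')) = Q"
    proof
      show "span (insert x (insert (J x) Q')) \<subseteq> Q"
        using xQ less.prems(1) by (intro span_minimal) (auto simp: Q'_def)
      show "Q \<subseteq> span (insert x (insert (J x) Q'))"
      proof
        fix v assume v: "v \<in> Q"
        have "(v - g v x *\<^sub>R x - g v (J x) *\<^sub>R J x) + g v x *\<^sub>R x + g v (J x) *\<^sub>R J x \<in> span (insert x (insert (J x) Q'))"
          using dec[OF v] by (intro span_add span_scale span_base) auto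
        then show "v \<in> span (insert x (insert (J x) Q'))" by simp
      qed
    qed
    have "dim Q = dim (insert x (insert (J x) Q'))" using sp dim_span by metis
    then have dimQ: "dim Q = dim Q' + 2" using a1 a2 by (simp add: dim_insert)
    have Sx: "g (S v) x = 0 \<and> g (S v) (J x) = 0" if S: "S \<in> \<S>" and v: "v \<in> Q'" for S v
    proof -
      obtain a where a: "S x = a *\<^sub>R x" using eig[OF S] by blast
      show ?thesis using v by (simp add: Q'_def sym[OF S] a commJ[OF S] J_simps g_simps)
    qed
    have Jx: "g (J v) x = 0 \<and> g (J v) (J x) = 0" if v: "v \<in> Q'" for v
      using v by (simp add: Q'_def J_orthogonal g_J_left J_square g_simps)
    have "\<exists>k X. dim Q' = 2 * k \<and> (\<forall>i<k. X i \<in> Q' \<and> (\<forall>S\<in>\<S>. \<exists>a. S (X i) = a *\<^sub>R X i)) \<and>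
      (\<forall>i<k. \<forall>j<k. g (X i) (X j) = (if i = j then 1 else 0) \<and> g (X i) (J (X j)) = 0) \<and>
      (\<forall>v\<in>Q'. v = (\<Sum>i<k. g v (X i) *\<^sub>R X i + g v (J (X i)) *\<^sub>R J (X i)))"
    proof (rule less.hyps)
      show "dim Q' < dim Q" using dimQ by simp
      show "subspace Q'" by (rule Q')
      show "S v \<in> Q'" if "S \<in> \<S>" "v \<in> Q'" for S v
        using that less.prems(2) Sx by (auto simp: Q'_def)
      show "J v \<in> Q'" if "v \<in> Q'" for v using that less.prems(3) Jx by (auto simp: Q'_def)
    qed
    then obtain k X where X0: "dim Q' = 2 * k \<and> (\<forall>i<k. X i \<in> Q' \<and> (\<forall>S\<in>\<S>. \<exists>a. S (X i) = a *\<^sub>R X i)) \<and>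
      (\<forall>i<k. \<forall>j<k. g (X i) (X j) = (if i = j then 1 else 0) \<and> g (X i) (J (X j)) = 0) \<and>
      (\<forall>v\<in>Q'. v = (\<Sum>i<k. g v (X i) *\<^sub>R X i + g v (J (X i)) *\<^sub>R J (X i)))"
      by (elim exE)
    from X0 have X: "dim Q' = 2 * k"
      "\<And>i. i < k \<Longrightarrow> X i \<in> Q'" "\<And>i S. i < k \<Longrightarrow> S \<in> \<S> \<Longrightarrow> \<exists>a. S (X i) = a *\<^sub>R X i"
      "\<And>i j. i < k \<Longrightarrow> j < k \<Longrightarrow> g (X i) (X j) = (if i = j then 1 else 0)"
      "\<And>i j. i < k \<Longrightarrow> j < k \<Longrightarrow> g (X i) (J (X j)) = 0"
      "\<And>v. v \<in> Q' \<Longrightarrow> v = (\<Sum>i<k. g v (X i) *\<^sub>R X i + g v (J (X i)) *\<^sub>R J (X i))"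
      by blast+
    define Y where "Y i = (if i < k then X i else x)" for i
    have Xx: "g (X i) x = 0" "g (X i) (J x) = 0" "g x (X i) = 0" "g x (J (X i)) = 0" if "i < k" for i
      using X(2)[OF that] g_sym g_J_left[of x "X i"] by (auto simp: Q'_def)
    have exp: "v = (\<Sum>i<Suc k. g v (Y i) *\<^sub>R Y i + g v (J (Y i)) *\<^sub>R J (Y i))" if v: "v \<in> Q" for v
    proof -
      let ?w = "v - g v x *\<^sub>R x - g v (J x) *\<^sub>R J x"
      have "?w = (\<Sum>i<k. g ?w (X i) *\<^sub>R X i + g ?w (J (X i)) *\<^sub>R J (X i))" by (rule X(6)[OF dec[OF v]])
      also have "\<dots> = (\<Sum>i<k. g v (X i) *\<^sub>R X i + g v (J (X i)) *\<^sub>R J (X i))"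
        using Xx by (intro sum.cong) (auto simp: g_simps J_orthogonal g_J_left J_square)
      finally have "v = (\<Sum>i<k. g v (X i) *\<^sub>R X i + g v (J (X i)) *\<^sub>R J (X i)) + (g v x *\<^sub>R x + g v (J x) *\<^sub>R J x)"
        by (simp add: algebra_simps)
      then show ?thesis by (simp add: Y_def)
    qed
    show ?thesis
    proof (intro exI[of _ "Suc k"] exI[of _ Y] conjI allI impI ballI)
      show "dim Q = 2 * Suc k" using dimQ X(1) by simp
      show "Y i \<in> Q" if "i < Suc k" for i using X(2) xQ by (auto simp: Y_def Q'_def)
      show "\<exists>a. S (Y i) = a *\<^sub>R Y i" if "i < Suc k" "S \<in> \<S>" for i S
        using X(3) eig that by (auto simp: Y_def)
      show "g (Y i) (Y j) = (if i = j then 1 else 0)" if "i < Suc k" "j < Suc k" for i j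
        using that X(4)[of i j] Xx[of i] Xx[of j] xx by (cases "i < k"; cases "j < k") (simp_all add: Y_def less_Suc_eq)
      show "g (Y i) (J (Y j)) = 0" if "i < Suc k" "j < Suc k" for i j
        using that X(5)[of i j] Xx[of i] Xx[of j] xJ by (cases "i < k"; cases "j < k") (simp_all add: Y_def less_Suc_eq)
      show "v = (\<Sum>i<Suc k. g v (Y i) *\<^sub>R Y i + g v (J (Y i)) *\<^sub>R J (Y i))" if "v \<in> Q" for v
        by (rule exp[OF that])
    qed
  qed
qed

end

section \<open>The second fundamental form at a point\<close>

text \<open>The data at one point of an immersion into the ambient Lorentzian space:
  \<open>N\<close> is the normal space and \<open>f\<close> the position vector, itself a unit
  timelike normal. \<open>\<alpha>_f\<close> comes from differentiating \<open>B F F = -1\<close>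
  twice, and \<open>kaehler_identity\<close> is the commutation of the curvature operator with
  \<open>J\<close>, expressed by the Gauss equation.\<close>

locale kaehler_point = hermitian g J
  for g :: "'e::euclidean_space \<Rightarrow> 'e \<Rightarrow> real" and J :: "'e \<Rightarrow> 'e" +
  fixes B :: "'w::euclidean_space \<Rightarrow> 'w \<Rightarrow> real" and N :: "'w set" and f :: 'w
    and \<alpha> :: "'e \<Rightarrow> 'e \<Rightarrow> 'w" and n p :: nat
  assumes B_bilinear: "bilinear B"
    and B_sym: "B x y = B y x"
    and N: "subspace N" "dim N = Suc p" "f \<in> N"
    and B_f: "B f f = -1"
    and B_pos: "x \<in> N \<Longrightarrow> B f x = 0 \<Longrightarrow> x \<noteq> 0 \<Longrightarrow> B x x > 0"
    and \<alpha>_bilinear: "bilinear \<alpha>"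
    and \<alpha>_sym: "\<alpha> u v = \<alpha> v u"
    and \<alpha>_N: "\<alpha> u v \<in> N"
    and \<alpha>_f: "B (\<alpha> u v) f = - g u v"
    and kaehler_identity: "B (\<alpha> u (J v)) (\<alpha> w t) - B (\<alpha> w (J v)) (\<alpha> u t)
      + B (\<alpha> u v) (\<alpha> w (J t)) - B (\<alpha> w v) (\<alpha> u (J t)) = 0"
    and dims: "DIM('e) = 2 * n" "p < n"
begin

lemmas B_simps =
  bilinear_ladd[OF B_bilinear] bilinear_radd[OF B_bilinear] bilinear_lmul[OF B_bilinear]
  bilinear_rmul[OF B_bilinear] bilinear_lsub[OF B_bilinear] bilinear_rsub[OF B_bilinear]
  bilinear_lneg[OF B_bilinear] bilinear_rneg[OF B_bilinear]
  bilinear_lzero[OF B_bilinear] bilinear_rzero[OF B_bilinear]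

lemmas \<alpha>_simps =
  bilinear_ladd[OF \<alpha>_bilinear] bilinear_radd[OF \<alpha>_bilinear] bilinear_lmul[OF \<alpha>_bilinear]
  bilinear_rmul[OF \<alpha>_bilinear] bilinear_lsub[OF \<alpha>_bilinear] bilinear_rsub[OF \<alpha>_bilinear]
  bilinear_lneg[OF \<alpha>_bilinear] bilinear_rneg[OF \<alpha>_bilinear]
  bilinear_lzero[OF \<alpha>_bilinear] bilinear_rzero[OF \<alpha>_bilinear]

lemma B_linear_right: "linear (B u)" and B_linear_left: "linear (\<lambda>v. B v u)"
  using B_bilinear by (auto simp: bilinear_def)

lemma B_nondegenerate:
  assumes "x \<in> N" "\<And>y. y \<in> N \<Longrightarrow> B x y = 0" shows "x = 0"
  using assms(2)[OF N(3)] assms(2)[OF assms(1)] B_pos[OF assms(1)] B_sym[of x f] by force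

text \<open>Twice the \<open>J\<close>-invariant part of \<open>\<alpha>\<close>; the factor
  explains the 2 in \<open>b_f\<close> and in the passage from \<open>\<eta>\<close> to
  \<open>\<nu>\<close> in \<open>principal_frame\<close>. That \<open>\<alpha>\<close> equals half
  of \<open>b\<close> is a result of that theorem.\<close>

definition b :: "'e \<Rightarrow> 'e \<Rightarrow> 'w" where
  "b u v = \<alpha> u v + \<alpha> (J u) (J v)"

text \<open>\<open>\<beta>\<close> is the \<open>J\<close>-Hermitian part of the second fundamental form: its two components are the
  real and imaginary parts, and \<open>Q\<close> is the real part of the complex bilinear extension of \<open>B\<close>.\<close>

definition \<beta> :: "'e \<Rightarrow> 'e \<Rightarrow> 'w \<times> 'w" where
  "\<beta> u v = (b u v, b u (J v))"

definition Q :: "'w \<times> 'w \<Rightarrow> 'w \<times> 'w \<Rightarrow> real" where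
  "Q x y = B (fst x) (fst y) - B (snd x) (snd y)"

lemma b_sym: "b u v = b v u"
  by (simp add: b_def \<alpha>_sym)

lemma b_J_left: "b (J u) v = - b u (J v)" and b_J_self: "b u (J u) = 0"
  using \<alpha>_sym[of u "J u"] by (simp_all add: b_def J_simps \<alpha>_simps)

lemma b_bilinear: "bilinear b"
  unfolding bilinear_def b_def
  by (intro conjI allI linearI) (simp_all add: \<alpha>_simps J_simps algebra_simps)

lemmas b_simps =
  bilinear_ladd[OF b_bilinear] bilinear_radd[OF b_bilinear] bilinear_lmul[OF b_bilinear]
  bilinear_rmul[OF b_bilinear] bilinear_lsub[OF b_bilinear] bilinear_rsub[OF b_bilinear]
  bilinear_lneg[OF b_bilinear] bilinear_rneg[OF b_bilinear]
  bilinear_lzero[OF b_bilinear] bilinear_rzero[OF b_bilinear]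

lemma b_N: "b u v \<in> N" unfolding b_def using \<alpha>_N N(1) by (auto intro: subspace_add)

lemma b_f: "B (b u v) f = - 2 * g u v"
  by (simp add: b_def B_simps \<alpha>_f J_orthogonal)

lemma \<beta>_bilinear: "bilinear \<beta>"
  unfolding bilinear_def \<beta>_def by (intro conjI allI linearI) (simp_all add: b_simps J_simps)

lemmas \<beta>_simps =
  bilinear_ladd[OF \<beta>_bilinear] bilinear_radd[OF \<beta>_bilinear] bilinear_lmul[OF \<beta>_bilinear]
  bilinear_rmul[OF \<beta>_bilinear] bilinear_lsub[OF \<beta>_bilinear] bilinear_rsub[OF \<beta>_bilinear]

lemma \<beta>_linear: "linear (\<beta> u)" using \<beta>_bilinear by (simp add: bilinear_def)

lemma Q_bilinear: "bilinear Q"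
  unfolding bilinear_def Q_def by (intro conjI allI linearI) (simp_all add: B_simps algebra_simps)

lemma Q_sym: "Q x y = Q y x" by (simp add: Q_def B_sym)

text \<open>The Kaehler identity with \<open>J v\<close> for \<open>v\<close> says that the pairs
  \<open>(\<alpha> u v, \<alpha> u (J v))\<close> form a bilinear map that is flat for
  \<open>Q\<close>. Replacing both arguments by their images under \<open>J\<close> and adding turns
  these pairs into values of \<open>\<beta>\<close>.\<close>

lemma \<alpha>_flat: "B (\<alpha> u v) (\<alpha> w t) - B (\<alpha> u (J v)) (\<alpha> w (J t)) =
    B (\<alpha> u t) (\<alpha> w v) - B (\<alpha> u (J t)) (\<alpha> w (J v))"
  using kaehler_identity[of u "J v" w t] by (simp add: J_square \<alpha>_simps B_simps B_sym)

text \<open>Only one factor is made Hermitian. This hybrid of \<open>\<alpha>_flat\<close> and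
  \<open>\<beta>_flat\<close> is what recovers \<open>\<alpha>\<close> itself from \<open>b\<close>
  in \<open>principal_frame\<close>.\<close>

lemma \<beta>_mixed: "Q (\<beta> x y) (\<alpha> z w, \<alpha> z (J w)) = Q (\<beta> x w) (\<alpha> z y, \<alpha> z (J y))"
  using \<alpha>_flat[of x y z w] \<alpha>_flat[of "J x" "J y" z w]
  by (simp add: Q_def \<beta>_def b_def J_simps \<alpha>_simps B_simps)

lemma \<beta>_flat: "Q (\<beta> x y) (\<beta> z w) = Q (\<beta> x w) (\<beta> z y)"
  using \<beta>_mixed[of x y z w] \<beta>_mixed[of x y "J z" "J w"]
  by (simp add: Q_def \<beta>_def b_def J_simps \<alpha>_simps B_simps)

lemma \<beta>_in: "\<beta> u v \<in> N \<times> N" by (simp add: \<beta>_def b_N)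

lemma subspace_NN: "subspace (N \<times> N)" using N(1) by (simp add: subspace_Times)

lemma dim_NN: "dim (N \<times> N) = 2 * Suc p" using N by (simp add: dim_Times)

lemma Q_nondegenerate:
  assumes "u \<in> N \<times> N" "\<And>w. w \<in> N \<times> N \<Longrightarrow> Q w u = 0" shows "u = 0"
proof -
  have "fst u = 0"
    using assms(1) assms(2)[of "(_, 0)"] N(1)
    by (intro B_nondegenerate) (auto simp: Q_def B_simps B_sym subspace_0)
  moreover have "snd u = 0"
    using assms(1) assms(2)[of "(0, _)"] N(1)
    by (intro B_nondegenerate) (auto simp: Q_def B_simps B_sym subspace_0)
  ultimately show ?thesis by (simp add: prod_eq_iff)
qed

definition perp :: "'e \<Rightarrow> ('w \<times> 'w) set" where
  "perp X = {w \<in> N \<times> N. \<forall>u\<in>range (\<beta> X). Q w u = 0}"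

lemma perp_subspace: "subspace (perp X)"
  using subspace_NN unfolding perp_def
  by (auto simp: subspace_def Q_def B_simps zero_prod_def algebra_simps)

lemma dim_perp: "dim (perp X) + dim (range (\<beta> X)) = 2 * Suc p"
  unfolding perp_def dim_NN[symmetric]
  by (rule dim_form_complement[OF Q_bilinear subspace_NN])
    (use \<beta>_in in \<open>blast intro: linear_subspace_image \<beta>_linear subspace_UNIV Q_nondegenerate\<close>)+

text \<open>Flatness turns \<open>Q (\<beta> X W) (\<beta> Z Y)\<close> into
  \<open>Q (\<beta> X Y) (\<beta> Z W) = 0\<close>. Combined with \<open>regular_element\<close>,
  values on a kernel vector lie both in a range and in its orthogonal complement, hence are
  null.\<close>

lemma kernel_perp: "\<beta> X Y = 0 \<Longrightarrow> \<beta> Z Y \<in> perp X"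
  using \<beta>_flat[of X _ Z Y] \<beta>_in by (auto simp: perp_def Q_sym) (simp add: Q_def B_simps)

text \<open>Inserting \<open>J W\<close> for \<open>W\<close> turns \<open>\<beta> X W\<close> by a
  quarter turn of its two components, so the complement of the range is a complex subspace. In
  particular it cannot be of real dimension one.\<close>

lemma perp_rotate: "(x, y) \<in> perp X \<Longrightarrow> (y, - x) \<in> perp X"
proof -
  assume a: "(x, y) \<in> perp X"
  have "Q (y, - x) (\<beta> X W) = 0" for W
  proof -
    have "Q (x, y) (\<beta> X (J W)) = 0" using a unfolding perp_def by blast
    then show ?thesis by (simp add: Q_def \<beta>_def J_square b_simps B_simps)
  qed
  then show ?thesis using a N(1) by (auto simp: perp_def subspace_neg)
qed

lemma rotate_independent:
  fixes x y :: 'w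
  assumes "(x, y) \<noteq> 0"
  shows "(x, y) \<noteq> (y, - x)" "independent {(x, y), (y, - x)}"
proof -
  have ne: "(y, - x) \<noteq> 0" using assms by (auto simp: zero_prod_def)
  have no: "(x, y) \<noteq> c *\<^sub>R (y, - x)" for c
  proof
    assume "(x, y) = c *\<^sub>R (y, - x)"
    from this[unfolded scaleR_Pair prod.inject] have xy: "x = c *\<^sub>R y" "y = c *\<^sub>R - x" by - (erule conjE, assumption)+
    have "(1 + c * c) *\<^sub>R x = x - c *\<^sub>R c *\<^sub>R - x" by (simp add: scaleR_add_left)
    also have "\<dots> = x - c *\<^sub>R y" by (simp only: xy(2)[symmetric])
    also have "\<dots> = x - x" by (simp only: xy(1)[symmetric])
    finally have "(1 + c * c) *\<^sub>R x = 0" by simp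
    moreover have "1 + c * c \<noteq> 0" using zero_le_square[of c] by linarith
    ultimately have x: "x = 0" by simp
    have "y = 0" using xy(2) unfolding x by simp
    with x show False using assms by (simp add: zero_prod_def)
  qed
  then show "(x, y) \<noteq> (y, - x)" using no[of 1] by simp
  have "(x, y) \<notin> span {(y, - x)}" unfolding span_singleton using no by blast
  then show "independent {(x, y), (y, - x)}"
    by (rule independent_insertI) (use ne in \<open>simp only: dependent_single not_False_eq_True\<close>)
qed

lemma perp_dim_ge_2:
  assumes "u \<in> perp X" "u \<noteq> 0" shows "2 \<le> dim (perp X)"
proof -
  obtain x y where u: "u = (x, y)" by fastforce
  note ri = rotate_independent[OF assms(2)[unfolded u]]
  have "card {(x, y), (y, - x)} \<le> dim (perp X)"
    using assms(1) perp_rotate[of x y X] ri(2) u by (intro independent_card_le_dim) auto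
  then show ?thesis using ri(1) by simp
qed

lemma ex_maximal_rank:
  assumes "D \<noteq> {}"
  obtains X where "X \<in> D" "\<And>X'. X' \<in> D \<Longrightarrow> dim (\<beta> X' ` E) \<le> dim (\<beta> X ` E)"
proof -
  have "dim (\<beta> X' ` E) < Suc DIM('w \<times> 'w)" for X' using dim_subset_UNIV[of "\<beta> X' ` E"] by linarith
  then have "\<exists>x. x \<in> D \<and> (\<forall>y. y \<in> D \<longrightarrow> dim (\<beta> y ` E) \<le> dim (\<beta> x ` E))"
    using assms by (intro ex_has_greatest_nat[of _ "SOME x. x \<in> D" _ "Suc DIM('w \<times> 'w)"])
      (auto simp: some_in_eq)
  then show thesis using that by blast
qed

text \<open>The regular elements of \<open>V\<close> and of the whole space are compared: if no \<open>\<beta> X\<close> had rank above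
  \<open>2 * p\<close>, a null vector in the kernel direction would force some \<open>b S S\<close>, \<open>S \<in> V\<close>, to be null.\<close>

theorem exists_regular:
  assumes V: "subspace V" "\<And>v. v \<in> V \<Longrightarrow> J v \<in> V" "2 * p \<le> dim V"
    and pos: "\<And>S. S \<in> V \<Longrightarrow> S \<noteq> 0 \<Longrightarrow> B (b S S) (b S S) > 0"
  shows "n = Suc p" "\<exists>X. \<forall>Y. \<beta> X Y = 0 \<longrightarrow> Y = 0"
proof -
  have posQ: "Q (\<beta> S S) (\<beta> S S) > 0" if "S \<in> V" "S \<noteq> 0" for S
    using pos[OF that] by (simp add: Q_def \<beta>_def b_J_self B_simps)
  have fin: "Y = 0" if "\<And>Z. \<beta> Z Y = 0" for Y
    using that[of Y] b_f[of Y Y] g_pos[of Y] by (force simp: \<beta>_def zero_prod_def B_simps)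
  obtain X where X: "X \<in> V" "\<And>X'. X' \<in> V \<Longrightarrow> dim (\<beta> X' ` V) \<le> dim (\<beta> X ` V)"
    using ex_maximal_rank[of V V] subspace_0[OF V(1)] by blast
  \<comment> \<open>\<open>\<beta> Y Y\<close> lies in the range of \<open>\<beta> X\<close> and in
    its complement, so it is null, which positivity on \<open>V\<close> forbids for
    \<open>Y \<noteq> 0\<close>.\<close>
  have injV: "Y = 0" if Y: "Y \<in> V" "\<beta> X Y = 0" for Y
  proof (rule ccontr)
    assume "Y \<noteq> 0"
    have "\<beta> Y Y \<in> \<beta> X ` V" by (rule regular_element[OF \<beta>_bilinear V(1,1) X Y(1) Y])
    then obtain W where "\<beta> Y Y = \<beta> X W" by blast
    then have "Q (\<beta> Y Y) (\<beta> Y Y) = 0" using kernel_perp[OF Y(2), of Y] by (auto simp: perp_def)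
    then show False using posQ[OF Y(1) \<open>Y \<noteq> 0\<close>] by simp
  qed
  have injon: "inj_on (\<beta> X) (span V)"
    using linear_injective_on_subspace_0[OF \<beta>_linear V(1)] injV span_eq_iff[THEN iffD2, OF V(1)]
    by (auto simp del: span_eq_iff)
  have dimXV: "dim (\<beta> X ` V) = dim V" by (rule dim_image_eq[OF \<beta>_linear injon])
  have "\<exists>X'. \<forall>X''. dim (range (\<beta> X'')) \<le> dim (range (\<beta> X'))"
    by (rule ex_maximal_rank[of UNIV UNIV]) auto
  then obtain X' where X': "\<And>X''. dim (range (\<beta> X'')) \<le> dim (range (\<beta> X'))" by auto
  \<comment> \<open>A rank above \<open>2 * p\<close> leaves a complement of dimension less than 2,
    which is zero because it is complex. Otherwise the maximal rank is exactly \<open>2 * p\<close>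
    and is reached by the element regular on \<open>V\<close>, already on \<open>V\<close> itself;
    this case is contradictory.\<close>
  have "\<exists>X. perp X = {0}"
  proof (cases "dim (range (\<beta> X')) > 2 * p")
    case True
    then have "dim (perp X') < 2" using dim_perp[of X'] by simp
    then have "perp X' \<subseteq> {0}" using perp_dim_ge_2[of _ X'] by force
    then show ?thesis using subspace_0[OF perp_subspace[of X']] by blast
  next
    case False
    have rX: "dim (range (\<beta> X)) \<ge> 2 * p"
      using dim_subset[OF image_mono[OF subset_UNIV, of "\<beta> X" V]] dimXV V(3) by simp
    have max: "dim (range (\<beta> X'')) \<le> dim (range (\<beta> X))" for X''
      using X'[of X''] False rX by linarith
    have rX': "dim (range (\<beta> X)) = 2 * p" using X'[of X] False rX by linarith
    have UV: "\<beta> X ` V = range (\<beta> X)"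
    proof (rule subspace_dim_equal)
      show "subspace (\<beta> X ` V)" "subspace (range (\<beta> X))"
        by (simp_all add: linear_subspace_image \<beta>_linear V(1))
      show "dim (range (\<beta> X)) \<le> dim (\<beta> X ` V)" using dimXV V(3) rX' by linarith
    qed blast
    have dperp: "dim (perp X) = 2" using dim_perp[of X] rX' by simp
    obtain Y where Y: "Y \<noteq> 0" "\<beta> X Y = 0"
    proof (rule ccontr)
      assume "\<not> thesis"
      then have "inj (\<beta> X)" using that linear_injective_0[OF \<beta>_linear] by blast
      then have "dim (range (\<beta> X)) = 2 * n"
        using dim_image_eq[OF \<beta>_linear, of X UNIV] dims(1) by (simp add: inj_on_subset)
      then show False using rX' dims(2) by simp
    qed
    have reg: "\<beta> Z Y \<in> range (\<beta> X)" for Z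
      by (rule regular_element[OF \<beta>_bilinear subspace_UNIV subspace_UNIV UNIV_I max UNIV_I UNIV_I Y(2)])
    define e where "e = b Y Y"
    have e: "\<beta> Y Y = (e, 0)" by (simp add: \<beta>_def e_def b_J_self)
    have e0: "e \<noteq> 0" using b_f[of Y Y] g_pos[OF Y(1)] by (auto simp: e_def B_simps)
    have eperp: "(e, 0) \<in> perp X" "(0, e) \<in> perp X"
      using kernel_perp[OF Y(2), of Y] perp_rotate[of e 0 X] subspace_neg[OF perp_subspace, of "(0, -e)" X]
      by (auto simp: e)
    obtain W where W: "\<beta> X W = (e, 0)" using reg[of Y] e by (metis rangeE)
    have "Q (e, 0) (\<beta> X W) = 0" using eperp(1) unfolding perp_def by blast
    then have Bee: "B e e = 0" by (simp add: W Q_def B_simps)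
    have sp: "perp X \<subseteq> span {(e, 0), (0, - e)}"
    proof (rule card_ge_dim_independent)
      show "{(e, 0), (0, - e)} \<subseteq> perp X"
        using eperp subspace_neg[OF perp_subspace eperp(2)] by auto
      show "independent {(e, 0), (0, - e)}"
        using rotate_independent(2)[of e 0] e0 by (simp add: zero_prod_def)
      show "dim (perp X) \<le> card {(e, 0), (0, - e)}" using e0 dperp by simp
    qed
    have inCe: "\<exists>s t. u = (s *\<^sub>R e, t *\<^sub>R e)" if uP: "u \<in> perp X" for u
    proof -
      obtain s t where st: "u - s *\<^sub>R (e, 0) = t *\<^sub>R (0, - e)"
        using sp uP by (auto simp: span_insert span_singleton)
      then have "u = s *\<^sub>R (e, 0) + t *\<^sub>R (0, - e)" by (metis add.commute diff_eq_eq)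
      then show ?thesis by (auto intro!: exI[of _ s] exI[of _ "-t"])
    qed
    \<comment> \<open>Flatness trades the factor \<open>\<beta> Y Y\<close> for two values that both
      lie in the null complex line of \<open>e\<close>.\<close>
    have Te: "B e (b Z W) = 0" for Z W
    proof -
      obtain s t where 1: "\<beta> Z Y = (s *\<^sub>R e, t *\<^sub>R e)" using inCe[OF kernel_perp[OF Y(2)]] by blast
      obtain s' t' where "\<beta> W Y = (s' *\<^sub>R e, t' *\<^sub>R e)" using inCe[OF kernel_perp[OF Y(2)]] by blast
      then have 2: "b Y W = s' *\<^sub>R e" "b Y (J W) = - (t' *\<^sub>R e)"
        using b_sym[of Y W] b_J_left[of W Y] b_sym[of Y "J W"] by (auto simp: \<beta>_def)
      have "Q (\<beta> Y Y) (\<beta> Z W) = Q (\<beta> Y W) (\<beta> Z Y)" by (rule \<beta>_flat)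
      also have "\<dots> = 0" by (simp add: 1 Q_def) (simp add: \<beta>_def 2 B_simps Bee)
      finally show ?thesis by (simp add: e Q_def B_simps) (simp add: \<beta>_def)
    qed
    \<comment> \<open>The null vector is reached from \<open>V\<close>. By \<open>Te\<close> the
      value \<open>\<beta> S S\<close> is orthogonal to the range of \<open>\<beta> X\<close>, so it
      lies in the null complex line, against positivity at \<open>S\<close>.\<close>
    obtain S where S: "S \<in> V" "\<beta> X S = (e, 0)" using UV W by (metis imageE rangeI)
    have S0: "S \<noteq> 0" using S(2) e0 linear_0[OF \<beta>_linear] by (auto simp: zero_prod_def)
    have "\<beta> S S \<in> perp X"
    proof -
      have "Q (\<beta> S S) (\<beta> X W) = 0" for W
      proof -
        have "Q (\<beta> X W) (\<beta> S S) = Q (\<beta> X S) (\<beta> S W)" by (rule \<beta>_flat)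
        also have "\<dots> = 0" by (simp add: S(2) Q_def B_simps) (simp add: \<beta>_def Te)
        finally show ?thesis by (simp add: Q_sym)
      qed
      then show ?thesis using \<beta>_in by (auto simp: perp_def)
    qed
    then obtain s t where "\<beta> S S = (s *\<^sub>R e, t *\<^sub>R e)" using inCe by blast
    then have "Q (\<beta> S S) (\<beta> S S) = 0" by (simp add: Q_def B_simps Bee)
    then show ?thesis using posQ[OF S(1) S0] by simp
  qed
  then obtain X where X: "perp X = {0}" by blast
  \<comment> \<open>For a kernel vector \<open>Y\<close> all \<open>\<beta> Z Y\<close> lie in
    \<open>perp X\<close>, which is zero; the \<open>f\<close>-component of \<open>b Y Y\<close>
    then forces \<open>g Y Y = 0\<close>.\<close>
  have inj: "Y = 0" if "\<beta> X Y = 0" for Y using kernel_perp[OF that] X by (intro fin) auto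
  then have "inj (\<beta> X)" using linear_injective_0[OF \<beta>_linear] by blast
  then have "dim (range (\<beta> X)) = 2 * n"
    using dim_image_eq[OF \<beta>_linear, of X UNIV] dims(1) by (simp add: inj_on_subset)
  then show "n = Suc p" using dim_perp[of X] X dims(2) by simp
  show "\<exists>X. \<forall>Y. \<beta> X Y = 0 \<longrightarrow> Y = 0" using inj by blast
qed

end

section \<open>Shape operators and the principal frame\<close>

context kaehler_point
begin

text \<open>Formed with \<open>b\<close> instead of \<open>\<alpha>\<close>, so that it commutes
  with \<open>J\<close> by construction and a joint eigenframe can be chosen unitary.\<close>

definition shape :: "'w \<Rightarrow> 'e \<Rightarrow> 'e" where
  "shape \<xi> Z = (SOME z. \<forall>w. g z w = B (b Z w) \<xi>)"

lemma shape: "g (shape \<xi> Z) W = B (b Z W) \<xi>"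
proof -
  have "linear (\<lambda>w. B (b Z w) \<xi>)" by (intro linearI) (simp_all add: b_simps B_simps)
  from someI_ex[OF riesz_form[OF g_bilinear g_pos this]] show ?thesis unfolding shape_def by blast
qed

lemma shape_linear: "linear (shape \<xi>)"
  by (intro linearI; rule g_eqI) (simp_all add: g_simps shape b_simps B_simps)

lemma shape_symmetric: "g (shape \<xi> u) v = g u (shape \<xi> v)"
  by (metis b_sym g_sym shape)

lemma shape_J: "shape \<xi> (J u) = J (shape \<xi> u)"
  by (rule g_eqI) (simp add: shape g_J_left b_J_left B_simps)

lemma range_full:
  fixes L :: "'e \<Rightarrow> 'w \<times> 'w"
  assumes "linear L" "\<And>Y. L Y = 0 \<Longrightarrow> Y = 0" "\<And>Y. L Y \<in> N \<times> N" "n = Suc p"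
  shows "range L = N \<times> N"
proof (rule subspace_dim_equal)
  have "inj L" using linear_injective_0[OF assms(1)] assms(2) by blast
  then have "dim (range L) = 2 * n"
    using dim_image_eq[OF assms(1), of UNIV] dims(1) by (simp add: inj_on_subset)
  then show "dim (N \<times> N) \<le> dim (range L)" using dim_NN assms(4) by simp
  show "subspace (range L)" by (simp add: linear_subspace_image assms(1))
  show "range L \<subseteq> N \<times> N" using assms(3) by blast
qed (rule subspace_NN)

text \<open>With \<open>\<beta> X Y = (f, 0)\<close>, flatness gives \<open>\<beta> Z P = - \<beta> (shape \<xi> Z) Y / 2\<close> whenever
  \<open>\<beta> X P = (\<xi>, 0)\<close>; this expresses the shape operators through \<open>\<beta>\<close> and makes them commute.\<close>

lemma shape_commute:
  assumes inj: "\<And>Y. \<beta> X Y = 0 \<Longrightarrow> Y = 0" and np: "n = Suc p"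
    and \<xi>: "\<xi> \<in> N" and \<zeta>: "\<zeta> \<in> N"
  shows "shape \<xi> (shape \<zeta> Z) = shape \<zeta> (shape \<xi> Z)"
proof -
  have surj: "range (\<beta> X) = N \<times> N" by (rule range_full[OF \<beta>_linear inj \<beta>_in np])
  have pre: "\<exists>P. \<beta> X P = (\<eta>, 0)" if "\<eta> \<in> N" for \<eta>
  proof -
    have "(\<eta>, 0) \<in> range (\<beta> X)" unfolding surj using that subspace_0[OF N(1)] by simp
    then show ?thesis by (metis rangeE)
  qed
  obtain Y where Y: "\<beta> X Y = (f, 0)" using pre N(3) by blast
  \<comment> \<open>The values of \<open>\<beta> X\<close> fill \<open>N \<times> N\<close>, so they
    suffice as test vectors for the nondegenerate form.\<close>
  have eqX: "u = v" if "u \<in> N \<times> N" "v \<in> N \<times> N" "\<And>W. Q (\<beta> X W) u = Q (\<beta> X W) v" for u v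
  proof -
    have "u - v = 0"
    proof (rule Q_nondegenerate)
      show "u - v \<in> N \<times> N" using that subspace_diff[OF subspace_NN] by blast
      fix w assume "w \<in> N \<times> N"
      then obtain W where "w = \<beta> X W" using surj by blast
      then show "Q w (u - v) = 0" using that(3) by (simp add: bilinear_rsub[OF Q_bilinear])
    qed
    then show ?thesis by simp
  qed
  have Qf: "Q (f, 0) (\<beta> u v) = - 2 * g u v" for u v
    using b_f[of u v] B_sym[of f] by (simp add: Q_def \<beta>_def B_simps)
  have Q\<xi>: "Q (\<eta>, 0) (\<beta> u v) = g (shape \<eta> u) v" for \<eta> u v
    using B_sym[of \<eta>] by (simp add: Q_def \<beta>_def B_simps shape)
  have key: "\<beta> (shape \<eta> Z) Y = - 2 *\<^sub>R \<beta> Z P" if P: "\<beta> X P = (\<eta>, 0)" for \<eta> P Z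
  proof (rule eqX[OF \<beta>_in])
    show "- 2 *\<^sub>R \<beta> Z P \<in> N \<times> N" using \<beta>_in by (intro subspace_scale subspace_NN)
    fix W
    have "Q (\<beta> X W) (\<beta> (shape \<eta> Z) Y) = Q (\<beta> X Y) (\<beta> (shape \<eta> Z) W)" by (rule \<beta>_flat)
    also have "\<dots> = - 2 * Q (\<beta> X P) (\<beta> Z W)" unfolding Y Qf unfolding P Q\<xi> by simp
    also have "Q (\<beta> X P) (\<beta> Z W) = Q (\<beta> X W) (\<beta> Z P)" by (rule \<beta>_flat)
    finally show "Q (\<beta> X W) (\<beta> (shape \<eta> Z) Y) = Q (\<beta> X W) (- 2 *\<^sub>R \<beta> Z P)"
      by (simp add: bilinear_rmul[OF Q_bilinear] bilinear_rneg[OF Q_bilinear])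
  qed
  \<comment> \<open>Pairing with \<open>\<beta> X Y = (f, 0)\<close> recovers the metric, so
    \<open>Y\<close> is regular in the second slot.\<close>
  have injY: "V = 0" if "\<beta> V Y = 0" for V
  proof -
    have "Q (\<beta> X Y) (\<beta> V V) = Q (\<beta> X V) (\<beta> V Y)" by (rule \<beta>_flat)
    then have "g V V = 0" using that by (simp add: Y Qf bilinear_rzero[OF Q_bilinear])
    then show ?thesis using g_pos by force
  qed
  have linY: "linear (\<lambda>V. \<beta> V Y)" using \<beta>_bilinear by (simp add: bilinear_def)
  have surjY: "range (\<lambda>V. \<beta> V Y) = N \<times> N" by (rule range_full[OF linY injY \<beta>_in np])
  have eqY: "u = v" if "u \<in> N \<times> N" "v \<in> N \<times> N" "\<And>V. Q u (\<beta> V Y) = Q v (\<beta> V Y)" for u v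
  proof -
    have "u - v = 0"
    proof (rule Q_nondegenerate)
      show "u - v \<in> N \<times> N" using that subspace_diff[OF subspace_NN] by blast
      fix w assume "w \<in> N \<times> N"
      then obtain V where "w = \<beta> V Y" using surjY by blast
      then show "Q w (u - v) = 0" using that(3)[of V] Q_sym[of w "u - v"] by (simp add: bilinear_lsub[OF Q_bilinear])
    qed
    then show ?thesis by simp
  qed
  obtain P R where P: "\<beta> X P = (\<xi>, 0)" and R: "\<beta> X R = (\<zeta>, 0)" using pre \<xi> \<zeta> by blast
  \<comment> \<open>\<open>key\<close> trades a shape operator applied to \<open>Z\<close> for a
    change of the second argument; flatness exchanges \<open>P\<close> and \<open>R\<close> in
    between.\<close>
  have c: "\<beta> (shape \<zeta> Z) P = \<beta> (shape \<xi> Z) R"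
  proof (rule eqY[OF \<beta>_in \<beta>_in])
    fix V
    have "Q (\<beta> (shape \<zeta> Z) P) (\<beta> V Y) = Q (\<beta> (shape \<zeta> Z) Y) (\<beta> V P)" by (rule \<beta>_flat)
    also have "\<dots> = - 2 * Q (\<beta> Z R) (\<beta> V P)" by (simp only: key[OF R] bilinear_lmul[OF Q_bilinear] real_scaleR_def)
    also have "Q (\<beta> Z R) (\<beta> V P) = Q (\<beta> Z P) (\<beta> V R)" by (rule \<beta>_flat)
    also have "- 2 * Q (\<beta> Z P) (\<beta> V R) = Q (\<beta> (shape \<xi> Z) Y) (\<beta> V R)" by (simp only: key[OF P] bilinear_lmul[OF Q_bilinear] real_scaleR_def)
    also have "\<dots> = Q (\<beta> (shape \<xi> Z) R) (\<beta> V Y)" by (rule \<beta>_flat)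
    finally show "Q (\<beta> (shape \<zeta> Z) P) (\<beta> V Y) = Q (\<beta> (shape \<xi> Z) R) (\<beta> V Y)" .
  qed
  show ?thesis
  proof (rule g_eqI)
    fix W
    have "g (shape \<xi> (shape \<zeta> Z)) W = Q (\<beta> X P) (\<beta> (shape \<zeta> Z) W)" by (simp only: P Q\<xi>)
    also have "\<dots> = Q (\<beta> X W) (\<beta> (shape \<zeta> Z) P)" by (rule \<beta>_flat)
    also have "\<dots> = Q (\<beta> X W) (\<beta> (shape \<xi> Z) R)" by (simp only: c)
    also have "\<dots> = Q (\<beta> X R) (\<beta> (shape \<xi> Z) W)" by (rule \<beta>_flat)
    also have "\<dots> = g (shape \<zeta> (shape \<xi> Z)) W" by (simp only: R Q\<xi>)
    finally show "g (shape \<xi> (shape \<zeta> Z)) W = g (shape \<zeta> (shape \<xi> Z)) W" .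
  qed
qed

text \<open>A joint unitary eigenframe of the shape operators diagonalises \<open>b\<close>.
  Flatness makes the vectors \<open>\<eta> i = b (E i) (E i)\<close> orthogonal, and surjectivity of
  \<open>\<beta> X\<close> makes them a basis of \<open>N\<close>. The numbers
  \<open>1 / B (\<nu> i) (\<nu> i)\<close> are the signed squared radii of the future
  factors.\<close>

theorem principal_frame:
  assumes inj: "\<And>Y. \<beta> X Y = 0 \<Longrightarrow> Y = 0" and np: "n = Suc p"
  obtains E \<nu> where
    "\<And>i j. i < n \<Longrightarrow> j < n \<Longrightarrow> g (E i) (E j) = (if i = j then 1 else 0)"
    "\<And>i j. i < n \<Longrightarrow> j < n \<Longrightarrow> g (E i) (J (E j)) = 0"
    "\<And>i. i < n \<Longrightarrow> \<nu> i \<in> N" "\<And>i. i < n \<Longrightarrow> B (\<nu> i) f = -1"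
    "\<And>i j. i < n \<Longrightarrow> j < n \<Longrightarrow> i \<noteq> j \<Longrightarrow> B (\<nu> i) (\<nu> j) = 0"
    "\<And>i. i < n \<Longrightarrow> B (\<nu> i) (\<nu> i) \<noteq> 0"
    "\<And>u v. \<alpha> u v = (\<Sum>i<n. (g (E i) u * g (E i) v + g (J (E i)) u * g (J (E i)) v) *\<^sub>R \<nu> i)"
    "(\<Sum>i<n. 1 / B (\<nu> i) (\<nu> i)) = -1"
    "\<exists>k<n. \<forall>i<n. if i = k then B (\<nu> i) (\<nu> i) < 0 else B (\<nu> i) (\<nu> i) > 0"
proof -
  have "\<exists>k E. dim (UNIV::'e set) = 2 * k \<and> (\<forall>i<k. E i \<in> (UNIV::'e set) \<and> (\<forall>S\<in>shape ` N. \<exists>a. S (E i) = a *\<^sub>R E i)) \<and>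
    (\<forall>i<k. \<forall>j<k. g (E i) (E j) = (if i = j then 1 else 0) \<and> g (E i) (J (E j)) = 0) \<and>
    (\<forall>v\<in>UNIV. v = (\<Sum>i<k. g v (E i) *\<^sub>R E i + g v (J (E i)) *\<^sub>R J (E i)))"
  proof (rule joint_eigenframe)
    show "linear S" if "S \<in> shape ` N" for S using that shape_linear by blast
    show "g (S u) v = g u (S v)" if "S \<in> shape ` N" for S u v using that shape_symmetric by blast
    show "S (T u) = T (S u)" if "S \<in> shape ` N" "T \<in> shape ` N" for S T u
      using that shape_commute[OF inj np] by blast
    show "S (J u) = J (S u)" if "S \<in> shape ` N" for S u using that shape_J by blast
  qed auto
  then obtain k E where kE: "dim (UNIV::'e set) = 2 * k \<and> (\<forall>i<k. E i \<in> (UNIV::'e set) \<and> (\<forall>S\<in>shape ` N. \<exists>a. S (E i) = a *\<^sub>R E i)) \<and>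
    (\<forall>i<k. \<forall>j<k. g (E i) (E j) = (if i = j then 1 else 0) \<and> g (E i) (J (E j)) = 0) \<and>
    (\<forall>v\<in>UNIV. v = (\<Sum>i<k. g v (E i) *\<^sub>R E i + g v (J (E i)) *\<^sub>R J (E i)))"
    by (elim exE)
  have kn: "k = n" using kE dims(1) by simp
  have E: "\<And>i j. i < n \<Longrightarrow> j < n \<Longrightarrow> g (E i) (E j) = (if i = j then 1 else 0)"
    and EJ: "\<And>i j. i < n \<Longrightarrow> j < n \<Longrightarrow> g (E i) (J (E j)) = 0"
    and eig: "\<And>i \<xi>. i < n \<Longrightarrow> \<xi> \<in> N \<Longrightarrow> \<exists>a. shape \<xi> (E i) = a *\<^sub>R E i"
    and exp: "\<And>v. v = (\<Sum>i<n. g v (E i) *\<^sub>R E i + g v (J (E i)) *\<^sub>R J (E i))"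
    using kE unfolding kn by blast+
  define \<eta> where "\<eta> i = b (E i) (E i)" for i
  have \<eta>N: "\<eta> i \<in> N" for i by (simp add: \<eta>_def b_N)
  \<comment> \<open>Testing with all normals turns the eigenvalue equations into one vector
    equation: the eigenvalue of \<open>shape \<xi>\<close> on \<open>E i\<close> is
    \<open>B (\<eta> i) \<xi>\<close>.\<close>
  have bE: "b (E i) W = g (E i) W *\<^sub>R \<eta> i" if i: "i < n" for i W
  proof -
    have "b (E i) W - g (E i) W *\<^sub>R \<eta> i = 0"
    proof (rule B_nondegenerate)
      show "b (E i) W - g (E i) W *\<^sub>R \<eta> i \<in> N" using N(1) b_N \<eta>N by (intro subspace_diff subspace_scale) auto
      fix \<xi> assume "\<xi> \<in> N"
      then obtain a where a: "shape \<xi> (E i) = a *\<^sub>R E i" using eig[OF i] by blast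
      have "B (b (E i) W) \<xi> = a * g (E i) W" for W
        using shape[of \<xi> "E i" W] by (simp add: a g_simps)
      from this[of W] this[of "E i"] show "B (b (E i) W - g (E i) W *\<^sub>R \<eta> i) \<xi> = 0"
        using E[OF i i] by (simp add: B_simps \<eta>_def)
    qed
    then show ?thesis by simp
  qed
  have bJE: "b (J (E i)) W = g (J (E i)) W *\<^sub>R \<eta> i" if i: "i < n" for i W
    using bE[OF i, of "J W"] by (simp add: b_J_left g_J_left)
  have b_exp: "b u v = (\<Sum>i<n. (g (E i) u * g (E i) v + g (J (E i)) u * g (J (E i)) v) *\<^sub>R \<eta> i)" for u v
  proof -
    have lb: "linear (\<lambda>u. b u v)" using b_bilinear by (simp add: bilinear_def)
    have "b u v = b (\<Sum>i<n. g u (E i) *\<^sub>R E i + g u (J (E i)) *\<^sub>R J (E i)) v" using exp[of u] by simp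
    also have "\<dots> = (\<Sum>i<n. g u (E i) *\<^sub>R b (E i) v + g u (J (E i)) *\<^sub>R b (J (E i)) v)"
      by (simp add: linear_sum[OF lb] b_simps)
    also have "\<dots> = (\<Sum>i<n. (g (E i) u * g (E i) v + g (J (E i)) u * g (J (E i)) v) *\<^sub>R \<eta> i)"
      by (rule sum.cong) (auto simp: bE bJE g_sym[of u] scaleR_add_left)
    finally show ?thesis .
  qed
  have \<eta>f: "B (\<eta> i) f = -2" if "i < n" for i using b_f[of "E i" "E i"] E[OF that that] by (simp add: \<eta>_def)
  have \<beta>E: "\<beta> (E i) W = (g (E i) W *\<^sub>R \<eta> i, g (E i) (J W) *\<^sub>R \<eta> i)" if "i < n" for i W
    by (simp add: \<beta>_def bE[OF that])
  have orth: "B (\<eta> i) (\<eta> j) = 0" if "i < n" "j < n" "i \<noteq> j" for i j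
  proof -
    have "Q (\<beta> (E i) (E i)) (\<beta> (E j) (E j)) = Q (\<beta> (E i) (E j)) (\<beta> (E j) (E i))" by (rule \<beta>_flat)
    then show ?thesis using that by (simp add: \<beta>E E EJ Q_def B_simps)
  qed
  have surj: "range (\<beta> X) = N \<times> N" by (rule range_full[OF \<beta>_linear inj \<beta>_in np])
  have span: "\<exists>a. \<xi> = (\<Sum>i<n. a i *\<^sub>R \<eta> i)" if "\<xi> \<in> N" for \<xi>
  proof -
    have "(\<xi>, 0) \<in> range (\<beta> X)" unfolding surj using that subspace_0[OF N(1)] by simp
    then obtain Y where "\<beta> X Y = (\<xi>, 0)" by (metis rangeE)
    then have "\<xi> = b X Y" by (simp add: \<beta>_def)
    then show ?thesis unfolding b_exp
      by (intro exI[of _ "\<lambda>i. g (E i) X * g (E i) Y + g (J (E i)) X * g (J (E i)) Y"])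
  qed
  have Bsum: "B (\<Sum>i<n. a i *\<^sub>R \<eta> i) (\<eta> j) = a j * B (\<eta> j) (\<eta> j)" if "j < n" for a j
  proof -
    have "B (\<Sum>i<n. a i *\<^sub>R \<eta> i) (\<eta> j) = (\<Sum>i<n. a i * B (\<eta> i) (\<eta> j))"
      by (simp add: linear_sum[OF B_linear_left] B_simps)
    also have "\<dots> = (\<Sum>i<n. if i = j then a j * B (\<eta> j) (\<eta> j) else 0)"
      using orth that by (intro sum.cong) auto
    finally show ?thesis using that by simp
  qed
  \<comment> \<open>A null \<open>\<eta> i\<close> would be orthogonal to all of \<open>N\<close>
    and hence zero, while its product with \<open>f\<close> is -2.\<close>
  have nonnull: "B (\<eta> i) (\<eta> i) \<noteq> 0" if i: "i < n" for i
  proof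
    assume z: "B (\<eta> i) (\<eta> i) = 0"
    have "\<eta> i = 0"
    proof (rule B_nondegenerate[OF \<eta>N])
      fix \<xi> assume "\<xi> \<in> N"
      then obtain a where "\<xi> = (\<Sum>i<n. a i *\<^sub>R \<eta> i)" using span by blast
      then show "B (\<eta> i) \<xi> = 0" using Bsum[OF i, of a] z B_sym by simp
    qed
    then show False using \<eta>f[OF i] by (simp add: B_simps)
  qed
  have eqN: "x = y" if "x \<in> N" "y \<in> N" "\<And>i. i < n \<Longrightarrow> B (\<eta> i) x = B (\<eta> i) y" for x y
  proof -
    have "x - y = 0"
    proof (rule B_nondegenerate)
      show "x - y \<in> N" using that N(1) by (intro subspace_diff) auto
      fix \<xi> assume "\<xi> \<in> N"
      then obtain a where "\<xi> = (\<Sum>i<n. a i *\<^sub>R \<eta> i)" using span by blast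
      then show "B (x - y) \<xi> = 0" using that(3)
        by (simp add: linear_sum[OF B_linear_right] B_simps B_sym[of x] B_sym[of y])
    qed
    then show ?thesis by simp
  qed
  obtain a where a: "f = (\<Sum>i<n. a i *\<^sub>R \<eta> i)" using span N(3) by blast
  have ai: "a i * B (\<eta> i) (\<eta> i) = -2" if "i < n" for i
    using Bsum[OF that, of a] \<eta>f[OF that] B_sym[of f] by (simp flip: a)
  define A where "A i u v = B (\<eta> i) (\<alpha> u v)" for i u v
  have Asym: "A i u v = A i v u" for i u v by (simp add: A_def \<alpha>_sym)
  \<comment> \<open>\<open>\<beta>_mixed\<close> with
    \<open>\<beta> (E i) (E i) = (\<eta> i, 0)\<close>. Used in both arguments, it leaves only the
    values of \<open>A i\<close> on the complex line of \<open>E i\<close>.\<close>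
  have A1: "A i Z W = g (E i) W * A i Z (E i) + g (J (E i)) W * A i Z (J (E i))" if i: "i < n" for i Z W
  proof -
    have "Q (\<beta> (E i) (E i)) (\<alpha> Z W, \<alpha> Z (J W)) = Q (\<beta> (E i) W) (\<alpha> Z (E i), \<alpha> Z (J (E i)))"
      by (rule \<beta>_mixed)
    then show ?thesis using i by (simp add: \<beta>E E EJ Q_def B_simps A_def g_J_left)
  qed
  have A2: "A i Z W = g (E i) Z * g (E i) W * A i (E i) (E i) + g (E i) Z * g (J (E i)) W * A i (E i) (J (E i))
      + g (J (E i)) Z * g (E i) W * A i (E i) (J (E i)) + g (J (E i)) Z * g (J (E i)) W * A i (J (E i)) (J (E i))"
    if i: "i < n" for i Z W
  proof -
    have "A i Z (E i) = g (E i) Z * A i (E i) (E i) + g (J (E i)) Z * A i (E i) (J (E i))"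
      using A1[OF i, of "E i" Z] Asym[of i Z "E i"] by simp
    moreover have "A i Z (J (E i)) = g (E i) Z * A i (E i) (J (E i)) + g (J (E i)) Z * A i (J (E i)) (J (E i))"
      using A1[OF i, of "J (E i)" Z] Asym[of i Z "J (E i)"] Asym[of i "E i" "J (E i)"] by simp
    ultimately show ?thesis using A1[OF i, of Z W] by (simp add: algebra_simps)
  qed
  have gA: "- g u v = (\<Sum>j<n. a j * A j u v)" for u v
  proof -
    have "- g u v = B (\<alpha> u v) f" by (simp add: \<alpha>_f)
    also have "\<dots> = B f (\<alpha> u v)" by (rule B_sym)
    also have "\<dots> = (\<Sum>j<n. a j * A j u v)"
      by (subst a) (simp add: linear_sum[OF B_linear_left] B_simps A_def)
    finally show ?thesis .
  qed
  have JE: "g (J (E j)) (E i) = 0" "g (J (E j)) (J (E i)) = (if i = j then 1 else 0)"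
    if "i < n" "j < n" for i j
    using EJ[of i j] E[of j i] that g_sym[of "E i"] by (auto simp: J_orthogonal)
  have only: "(\<Sum>j<n. a j * A j u v) = a i * A i u v"
    if i: "i < n" and "\<And>j. j < n \<Longrightarrow> j \<noteq> i \<Longrightarrow> A j u v = 0" for i u v
  proof -
    have "(\<Sum>j<n. a j * A j u v) = (\<Sum>j<n. if j = i then a i * A i u v else 0)"
      using that by (intro sum.cong) auto
    then show ?thesis using i by simp
  qed
  have zero: "A j (E i) v = 0" "A j (J (E i)) v = 0" if "i < n" "j < n" "j \<noteq> i" for i j v
    using that A2[OF that(2), of "E i" v] A2[OF that(2), of "J (E i)" v] E[of j i] EJ[of j i] JE[of i j] by auto
  \<comment> \<open>The position vector fixes these values: \<open>B (\<alpha> u v) f\<close> is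
    \<open>- g u v\<close>, and in the expansion of \<open>f\<close> only the index \<open>i\<close>
    contributes on the line of \<open>E i\<close>.\<close>
  have Aval: "a i * A i (E i) (E i) = -1" "a i * A i (E i) (J (E i)) = 0" "a i * A i (J (E i)) (J (E i)) = -1"
    if i: "i < n" for i
    using gA[of "E i" "E i"] gA[of "E i" "J (E i)"] gA[of "J (E i)" "J (E i)"]
      only[OF i zero(1)[OF i]] only[OF i zero(2)[OF i]] E[OF i i] EJ[OF i i] JE[OF i i] by auto
  have A3: "A i Z W = (1/2) * B (\<eta> i) (b Z W)" if i: "i < n" for i Z W
  proof -
    have a0: "a i \<noteq> 0" using ai[OF i] by auto
    have half: "x = B (\<eta> i) (\<eta> i) / 2" if "a i * x = -1" for x
    proof -
      have "a i * (x - B (\<eta> i) (\<eta> i) / 2) = 0" using that ai[OF i] by (simp add: right_diff_distrib)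
      then show ?thesis using a0 by simp
    qed
    have v: "A i (E i) (E i) = B (\<eta> i) (\<eta> i) / 2" "A i (E i) (J (E i)) = 0" "A i (J (E i)) (J (E i)) = B (\<eta> i) (\<eta> i) / 2"
      using Aval[OF i] a0 half by auto
    have "B (\<eta> i) (b Z W) = (g (E i) Z * g (E i) W + g (J (E i)) Z * g (J (E i)) W) * B (\<eta> i) (\<eta> i)"
      using Bsum[OF i] B_sym[of "\<eta> i" "b Z W"] unfolding b_exp by simp
    then show ?thesis unfolding A2[OF i, of Z W] v by (simp add: field_simps)
  qed
  have \<alpha>b: "\<alpha> u v = (1/2) *\<^sub>R b u v" for u v
  proof (rule eqN[OF \<alpha>_N])
    show "(1/2) *\<^sub>R b u v \<in> N" using N(1) b_N by (intro subspace_scale)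
    show "B (\<eta> i) (\<alpha> u v) = B (\<eta> i) ((1/2) *\<^sub>R b u v)" if "i < n" for i
      using A3[OF that, of u v] by (simp add: A_def B_simps)
  qed
  define \<nu> where "\<nu> i = (1/2) *\<^sub>R \<eta> i" for i
  define c where "c i = B (\<nu> i) (\<nu> i)" for i
  have c: "c i = B (\<eta> i) (\<eta> i) / 4" for i by (simp add: c_def \<nu>_def B_simps)
  \<comment> \<open>Expansion of \<open>B f f = -1\<close> in the basis \<open>\<eta>\<close>: the
    coefficient \<open>- 2 / B (\<eta> i) (\<eta> i)\<close> times
    \<open>B (\<eta> i) f = -2\<close> is \<open>1 / c i\<close>.\<close>
  have sum: "(\<Sum>i<n. 1 / c i) = -1"
  proof -
    have "-1 = B f f" by (simp add: B_f)
    also have "\<dots> = (\<Sum>i<n. a i * B (\<eta> i) f)" by (subst a) (simp add: linear_sum[OF B_linear_left] B_simps)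
    also have "\<dots> = (\<Sum>i<n. 1 / c i)"
    proof (rule sum.cong)
      fix i assume i: "i \<in> {..<n}"
      then have "a i = - 2 / B (\<eta> i) (\<eta> i)" using ai[of i] nonnull[of i] by (simp add: field_simps)
      then show "a i * B (\<eta> i) f = 1 / c i" using \<eta>f[of i] i by (simp add: c)
    qed simp
    finally show ?thesis by simp
  qed
  have "\<exists>k<n. c k < 0"
  proof (rule ccontr)
    assume "\<not> ?thesis"
    then have "(\<Sum>i<n. 1 / c i) \<ge> 0" by (intro sum_nonneg) (metis lessThan_iff not_less zero_le_divide_1_iff)
    then show False using sum by simp
  qed
  then obtain k where k: "k < n" "c k < 0" by blast
  \<comment> \<open>The difference of two of the \<open>\<eta>\<close> is orthogonal to
    \<open>f\<close>, hence spacelike. This gives \<open>c i + c k > 0\<close>, so a second negative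
    constant is impossible.\<close>
  have pos: "c i > 0" if i: "i < n" "i \<noteq> k" for i
  proof -
    let ?v = "\<eta> i - \<eta> k"
    have "?v \<in> N" using N(1) \<eta>N by (intro subspace_diff)
    moreover have "B f ?v = 0" using \<eta>f i k by (simp add: B_simps B_sym[of f])
    moreover have "?v \<noteq> 0"
    proof
      assume "?v = 0" then have "\<eta> i = \<eta> k" by simp
      then show False using orth[of i k] nonnull[of k] i k by simp
    qed
    ultimately have "B ?v ?v > 0" by (rule B_pos)
    moreover have "B ?v ?v = 4 * (c i + c k)" using orth[of i k] orth[of k i] i k by (simp add: B_simps c)
    ultimately have "0 < c i + c k" by simp
    then show ?thesis using k(2) by simp
  qed
  show thesis
  proof (rule that[of E \<nu>])
    show "\<nu> i \<in> N" if "i < n" for i unfolding \<nu>_def using N(1) \<eta>N by (intro subspace_scale)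
    show "B (\<nu> i) f = -1" if "i < n" for i using \<eta>f[OF that] by (simp add: \<nu>_def B_simps)
    show "B (\<nu> i) (\<nu> j) = 0" if "i < n" "j < n" "i \<noteq> j" for i j
      using orth[OF that] by (simp add: \<nu>_def B_simps)
    show "B (\<nu> i) (\<nu> i) \<noteq> 0" if "i < n" for i using nonnull[OF that] by (simp add: \<nu>_def B_simps)
    show "\<alpha> u v = (\<Sum>i<n. (g (E i) u * g (E i) v + g (J (E i)) u * g (J (E i)) v) *\<^sub>R \<nu> i)" for u v
      unfolding \<alpha>b b_exp \<nu>_def by (simp add: scaleR_sum_right mult.commute)
    show "(\<Sum>i<n. 1 / B (\<nu> i) (\<nu> i)) = -1" using sum by (simp add: c_def)
    show "\<exists>k<n. \<forall>i<n. if i = k then B (\<nu> i) (\<nu> i) < 0 else B (\<nu> i) (\<nu> i) > 0"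
      using k pos by (intro exI[of _ k]) (auto simp: c_def)
  qed (use E EJ in auto)
qed

text \<open>Each summand of the diagonal form involves only the Hermitian metric of one complex
  line. The hypothesis is a regular element, which is an open condition; so the invariance spreads
  to a neighbourhood.\<close>

lemma \<alpha>_J_invariant:
  assumes "\<And>Y. \<beta> X Y = 0 \<Longrightarrow> Y = 0" "n = Suc p"
  shows "\<alpha> (J u) (J v) = \<alpha> u v"
proof (rule principal_frame[OF assms])
  fix E \<nu>
  assume \<alpha>: "\<And>u v. \<alpha> u v = (\<Sum>i<n. (g (E i) u * g (E i) v + g (J (E i)) u * g (J (E i)) v) *\<^sub>R \<nu> i)"
  have e: "g (E i) (J u) = - g (J (E i)) u" "g (J (E i)) (J u) = g (E i) u" for i u
    by (simp_all add: g_J_left J_square g_simps)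
  show ?thesis unfolding \<alpha>[of "J u"] \<alpha>[of u] e by (simp add: add.commute)
qed

end

section \<open>Kaehler charts in Lorentzian space\<close>

lemma frechet_derivative_cong:
  assumes "open S" "y \<in> S" "smooth_on f S" "\<And>z. z \<in> S \<Longrightarrow> f z = h z"
  shows "frechet_derivative h (at y) v = frechet_derivative f (at y) v"
  by (rule frechet_derivativeI[OF has_derivative_transform_within_open[OF
          smooth_on_has_derivative[OF assms(3,2)] assms(1,2,4)]])

lemma frechet_derivative_apply:
  fixes L :: "'z::real_normed_vector \<Rightarrow> 'x::euclidean_space \<Rightarrow> 'y::real_normed_vector"
  assumes "open S" "\<And>x. smooth_on (\<lambda>z. L z x) S" "\<And>z. z \<in> S \<Longrightarrow> linear (L z)" "smooth_on s S" "y \<in> S"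
  shows "frechet_derivative (\<lambda>z. L z (s z)) (at y) v =
    frechet_derivative (\<lambda>z. L z (s y)) (at y) v + L y (frechet_derivative s (at y) v)"
  by (rule frechet_derivativeI[OF has_derivative_apply[OF assms(1,2) smooth_on_has_derivative[OF assms(4,5)] assms(5,3)]])

lemma frechet_derivative_bilinear:
  assumes "bounded_bilinear pr" "smooth_on a S" "smooth_on b S" "y \<in> S"
  shows "frechet_derivative (\<lambda>z. pr (a z) (b z)) (at y) v =
    pr (a y) (frechet_derivative b (at y) v) + pr (frechet_derivative a (at y) v) (b y)"
  by (rule frechet_derivativeI[OF bounded_bilinear.FDERIV[OF assms(1) smooth_on_has_derivative smooth_on_has_derivative]])
    (use assms in auto)

lemma frechet_derivative_linear:
  assumes "bounded_linear L" "smooth_on a S" "y \<in> S"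
  shows "frechet_derivative (\<lambda>z. L (a z)) (at y) v = L (frechet_derivative a (at y) v)"
  by (rule frechet_derivativeI[OF bounded_linear.has_derivative[OF assms(1) smooth_on_has_derivative[OF assms(2,3)]]])

lemma frechet_derivative_add:
  assumes "smooth_on a S" "smooth_on b S" "y \<in> S"
  shows "frechet_derivative (\<lambda>z. a z + b z) (at y) v =
    frechet_derivative a (at y) v + frechet_derivative b (at y) v"
  by (rule frechet_derivativeI[OF has_derivative_add[OF smooth_on_has_derivative smooth_on_has_derivative]])
    (use assms in auto)

lemma frechet_derivative_diff:
  assumes "smooth_on a S" "smooth_on b S" "y \<in> S"
  shows "frechet_derivative (\<lambda>z. a z - b z) (at y) v =
    frechet_derivative a (at y) v - frechet_derivative b (at y) v"
  by (rule frechet_derivativeI[OF has_derivative_diff[OF smooth_on_has_derivative smooth_on_has_derivative]])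
    (use assms in auto)

lemma derivative_in_subspace:
  fixes f :: "'a::real_normed_vector \<Rightarrow> 'w::euclidean_space"
  assumes S: "open S" "y \<in> S" and f: "smooth_on f S" and R: "subspace R" "\<And>z. z \<in> S \<Longrightarrow> f z \<in> R"
  shows "frechet_derivative f (at y) v \<in> R"
proof -
  obtain a b where ab: "a \<in> span R" "\<And>w. w \<in> span R \<Longrightarrow> orthogonal b w" "frechet_derivative f (at y) v = a + b"
    using orthogonal_subspace_decomp_exists[of R "frechet_derivative f (at y) v"] by metis
  have sp: "span R = R" using R(1) by (simp add: span_eq_iff)
  have bz: "w \<bullet> b = 0" if "w \<in> R" for w
    using ab(2)[of w] that sp by (simp add: orthogonal_def inner_commute del: span_eq_iff)
  have "frechet_derivative (\<lambda>z. f z \<bullet> b) (at y) v = frechet_derivative (\<lambda>z. 0) (at y) v"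
    by (rule frechet_derivative_cong[OF S smooth_on_const]) (simp add: bz R(2))
  then have "frechet_derivative f (at y) v \<bullet> b = 0"
    using frechet_derivative_linear[OF bounded_linear_inner_left f S(2)] by simp
  then have "b \<bullet> b = 0" using bz[of a] ab(1,3) sp by (simp add: inner_add_left del: span_eq_iff)
  then show ?thesis using ab sp by (simp del: span_eq_iff)
qed

text \<open>For a unit vector \<open>e\<close> this is the Euclidean product with the sign of the
  direction \<open>e\<close> reversed.\<close>

definition lor :: "'w::euclidean_space \<Rightarrow> 'w \<Rightarrow> 'w \<Rightarrow> real" where
  "lor e x y = x \<bullet> y - 2 * (x \<bullet> e) * (y \<bullet> e)"

lemma lor_bilinear: "bilinear (lor e)"
  unfolding bilinear_def lor_def
  by (intro conjI allI linearI) (simp_all add: inner_add_left inner_add_right algebra_simps)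

lemma lor_bounded_bilinear: "bounded_bilinear (lor e)"
  using lor_bilinear bilinear_conv_bounded_bilinear by blast

lemma lor_sym: "lor e x y = lor e y x"
  by (simp add: lor_def inner_commute)

text \<open>Orthogonality and Cauchy-Schwarz give \<open>\<bar>f \<bullet> e\<bar> * \<bar>v
  \<bullet> e\<bar> \<le> norm f' * norm v'\<close>, while
  \<open>norm f' < \<bar>f \<bullet> e\<bar>\<close> for timelike \<open>f\<close>; so the part of
  \<open>v\<close> orthogonal to \<open>e\<close> dominates.\<close>

lemma lor_timelike_complement:
  assumes e: "e \<in> Basis" and f: "lor e f f < 0" and v: "lor e f v = 0" "v \<noteq> 0"
  shows "lor e v v > 0"
proof -
  define f' where "f' = f - (f \<bullet> e) *\<^sub>R e"
  define v' where "v' = v - (v \<bullet> e) *\<^sub>R e"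
  have ee: "e \<bullet> e = 1" using e by simp
  have 1: "lor e f f = f' \<bullet> f' - (f \<bullet> e)\<^sup>2" "lor e v v = v' \<bullet> v' - (v \<bullet> e)\<^sup>2"
    "lor e f v = f' \<bullet> v' - (f \<bullet> e) * (v \<bullet> e)"
    by (simp_all add: lor_def f'_def v'_def inner_diff_left inner_diff_right ee inner_commute power2_eq_square)
  have f2: "(norm f')\<^sup>2 < (f \<bullet> e)\<^sup>2" using f 1(1) by (simp add: power2_norm_eq_inner)
  then have fe: "norm f' < \<bar>f \<bullet> e\<bar>" using abs_le_square_iff[of "f \<bullet> e" "norm f'"] by fastforce
  have cs: "\<bar>f \<bullet> e\<bar> * \<bar>v \<bullet> e\<bar> \<le> norm f' * norm v'"
    using Cauchy_Schwarz_ineq2[of f' v'] v(1) 1(3) by (simp add: abs_mult)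
  have v'0: "norm v' > 0"
  proof (rule ccontr)
    assume "\<not> norm v' > 0"
    then have z: "v' = 0" by simp
    then have "\<bar>f \<bullet> e\<bar> * \<bar>v \<bullet> e\<bar> \<le> 0" using cs by simp
    then have "v \<bullet> e = 0" using fe norm_ge_zero[of f'] by (auto simp: mult_le_0_iff)
    then show False using z v(2) by (simp add: v'_def)
  qed
  have "\<bar>f \<bullet> e\<bar> * \<bar>v \<bullet> e\<bar> < \<bar>f \<bullet> e\<bar> * norm v'"
    using cs fe v'0 by (smt (verit) mult_strict_right_mono)
  then have "\<bar>v \<bullet> e\<bar> < norm v'" using fe norm_ge_zero[of f'] by (simp add: mult_less_cancel_left)
  then have "\<bar>v \<bullet> e\<bar>\<^sup>2 < (norm v')\<^sup>2" by (intro power_strict_mono) auto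
  then show ?thesis using 1(2) by (simp add: power2_norm_eq_inner)
qed

text \<open>The immersion in one chart. The ambient space has a dimension depending on the numbers
  \<open>n\<close> and \<open>p\<close>, so it is a subspace \<open>R\<close> of a larger Euclidean
  space. The connection enters through its characterising properties, vanishing torsion and
  compatibility with the metric.\<close>

locale kaehler_chart =
  fixes U :: "'e::euclidean_space set" and F :: "'e \<Rightarrow> 'w::euclidean_space"
    and J :: "'e \<Rightarrow> 'e \<Rightarrow> 'e" and \<Gamma> :: "'e \<Rightarrow> 'e \<Rightarrow> 'e \<Rightarrow> 'e"
    and e0 :: 'w and R :: "'w set" and n p :: nat
  assumes U: "open U" and e0: "e0 \<in> Basis"
    and F_smooth: "smooth_on F U"
    and R: "subspace R" "dim R = 2 * n + p + 1"
    and F_R: "z \<in> U \<Longrightarrow> F z \<in> R"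
    and F_hyperboloid: "z \<in> U \<Longrightarrow> lor e0 (F z) (F z) = -1"
    and immersion: "z \<in> U \<Longrightarrow> u \<noteq> 0 \<Longrightarrow>
      lor e0 (frechet_derivative F (at z) u) (frechet_derivative F (at z) u) > 0"
    and Jz_linear: "z \<in> U \<Longrightarrow> linear (J z)"
    and Jz_square: "z \<in> U \<Longrightarrow> J z (J z u) = - u"
    and Jz_orthogonal: "z \<in> U \<Longrightarrow>
      lor e0 (frechet_derivative F (at z) (J z u)) (frechet_derivative F (at z) (J z v)) =
      lor e0 (frechet_derivative F (at z) u) (frechet_derivative F (at z) v)"
    and J_smooth: "smooth_on (\<lambda>z. J z v) U"
    and \<Gamma>_sym: "z \<in> U \<Longrightarrow> \<Gamma> z u v = \<Gamma> z v u"
    and \<Gamma>_metric: "z \<in> U \<Longrightarrow>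
      frechet_derivative (\<lambda>z. lor e0 (frechet_derivative F (at z) v) (frechet_derivative F (at z) w)) (at z) u =
      lor e0 (frechet_derivative F (at z) (\<Gamma> z u v)) (frechet_derivative F (at z) w) +
      lor e0 (frechet_derivative F (at z) v) (frechet_derivative F (at z) (\<Gamma> z u w))"
    and J_parallel: "z \<in> U \<Longrightarrow> frechet_derivative (\<lambda>z. J z v) (at z) u + \<Gamma> z u (J z v) = J z (\<Gamma> z u v)"
    and dim_e: "DIM('e) = 2 * n" and p_less: "p < n"
begin

abbreviation B :: "'w \<Rightarrow> 'w \<Rightarrow> real" where "B \<equiv> lor e0"

lemmas B_simps =
  bilinear_ladd[OF lor_bilinear] bilinear_radd[OF lor_bilinear] bilinear_lmul[OF lor_bilinear]
  bilinear_rmul[OF lor_bilinear] bilinear_lsub[OF lor_bilinear] bilinear_rsub[OF lor_bilinear]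
  bilinear_lneg[OF lor_bilinear] bilinear_rneg[OF lor_bilinear]
  bilinear_lzero[OF lor_bilinear] bilinear_rzero[OF lor_bilinear]

definition dF :: "'e \<Rightarrow> 'e \<Rightarrow> 'w" where "dF z u = frechet_derivative F (at z) u"

definition ddF :: "'e \<Rightarrow> 'e \<Rightarrow> 'e \<Rightarrow> 'w" where "ddF z u v = frechet_derivative (\<lambda>z. dF z v) (at z) u"

definition g :: "'e \<Rightarrow> 'e \<Rightarrow> 'e \<Rightarrow> real" where "g z u v = B (dF z u) (dF z v)"

lemma dF_smooth: "smooth_on (\<lambda>z. dF z v) U"
  unfolding dF_def by (rule smooth_on_deriv[OF F_smooth])

lemma ddF_smooth: "smooth_on (\<lambda>z. ddF z u v) U"
  unfolding ddF_def by (rule smooth_on_deriv[OF dF_smooth])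

lemma dF_linear: "z \<in> U \<Longrightarrow> linear (dF z)"
  unfolding dF_def using has_derivative_linear[OF smooth_on_has_derivative[OF F_smooth]] by simp

lemma ddF_sym: "z \<in> U \<Longrightarrow> ddF z u v = ddF z v u"
  unfolding ddF_def dF_def by (rule second_derivative_symmetric[OF U _ F_smooth])

lemma ddF_linear_left: "z \<in> U \<Longrightarrow> linear (\<lambda>u. ddF z u v)"
  unfolding ddF_def using has_derivative_linear[OF smooth_on_has_derivative[OF dF_smooth]] by simp

lemma ddF_linear_right: "z \<in> U \<Longrightarrow> linear (ddF z u)"
  using ddF_linear_left[of z u] ddF_sym[of z u _] by (metis (no_types, lifting) linear_iff)

lemma dF_R: "z \<in> U \<Longrightarrow> dF z u \<in> R"
  unfolding dF_def by (rule derivative_in_subspace[OF U _ F_smooth R(1) F_R])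

lemma ddF_R: "z \<in> U \<Longrightarrow> ddF z u v \<in> R"
  unfolding ddF_def by (rule derivative_in_subspace[OF U _ dF_smooth R(1) dF_R])

lemma hermitian: assumes z: "z \<in> U" shows "hermitian (g z) (J z)"
proof (rule hermitian.intro)
  show "bilinear (g z)" unfolding bilinear_def g_def
    by (intro conjI allI linearI)
      (simp_all add: B_simps linear_add[OF dF_linear[OF z]] linear_scale[OF dF_linear[OF z]])
  show "g z u v = g z v u" for u v by (simp add: g_def lor_sym)
  show "g z u u > 0" if "u \<noteq> 0" for u using immersion[OF z that] by (simp add: g_def dF_def)
  show "linear (J z)" by (rule Jz_linear[OF z])
  show "J z (J z u) = - u" for u by (rule Jz_square[OF z])
  show "g z (J z u) (J z v) = g z u v" for u v using Jz_orthogonal[OF z] by (simp add: g_def dF_def)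
qed

lemmas g_simps = hermitian.g_simps[OF hermitian]
lemmas J_simps = hermitian.J_simps[OF hermitian]

lemma g_eqI: "z \<in> U \<Longrightarrow> (\<And>w. g z u w = g z v w) \<Longrightarrow> u = v"
  using hermitian.g_eqI[OF hermitian] by blast

lemma g_smooth: "smooth_on (\<lambda>z. g z u v) U"
  unfolding g_def by (rule smooth_on_bilinear[OF lor_bounded_bilinear U dF_smooth dF_smooth])

section \<open>Tangential projection, Levi-Civita connection and second fundamental form\<close>

definition rep :: "'e \<Rightarrow> ('e \<Rightarrow> real) \<Rightarrow> 'e" where
  "rep z l = (SOME r. \<forall>t. g z r t = l t)"

lemma rep: assumes "z \<in> U" "linear l" shows "g z (rep z l) t = l t"
  using someI_ex[OF riesz_form[OF hermitian.g_bilinear[OF hermitian[OF assms(1)]]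
        hermitian.g_pos[OF hermitian[OF assms(1)]] assms(2)]]
  unfolding rep_def by blast

lemma rep_smooth:
  assumes "\<And>z. z \<in> U \<Longrightarrow> linear (l z)" "\<And>t. smooth_on (\<lambda>z. l z t) U"
  shows "smooth_on (\<lambda>z. rep z (l z)) U"
proof (rule smooth_on_linear_solve[OF U])
  let ?G = "\<lambda>z x. \<Sum>i\<in>Basis. g z x i *\<^sub>R (i::'e)"
  have inn: "?G z x \<bullet> w = g z x w" if "z \<in> U" for z x w
    using linear_basis_expand[OF hermitian.g_linear_right[OF hermitian[OF that]], of x w]
    by (simp add: inner_sum_left inner_commute[of w] mult.commute)
  show lin: "linear (?G z)" if "z \<in> U" for z
    by (intro linearI) (simp_all add: g_simps[OF that] scaleR_add_left sum.distrib scaleR_sum_right)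
  show "inj (?G z)" if z: "z \<in> U" for z
  proof (rule linear_injective_0[OF lin[OF z], THEN iffD2], intro allI impI)
    fix a assume "?G z a = 0"
    then have "g z a a = 0" using inn[OF z, of a a] by simp
    then show "a = 0" using hermitian.g_pos[OF hermitian[OF z], of a] by force
  qed
  show "smooth_on (\<lambda>z. ?G z x) U" for x
    by (intro smooth_on_sum U smooth_on_linear[OF bounded_linear_scaleR_left] g_smooth)
  show "smooth_on (\<lambda>z. \<Sum>i\<in>Basis. l z i *\<^sub>R (i::'e)) U"
    by (intro smooth_on_sum U smooth_on_linear[OF bounded_linear_scaleR_left] assms)
  show "?G z (rep z (l z)) = (\<Sum>i\<in>Basis. l z i *\<^sub>R i)" if "z \<in> U" for z
    by (simp add: rep[OF that assms(1)[OF that]])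
qed

text \<open>Chart coordinates of the tangential part: \<open>dF z (\<tau> z \<xi>)\<close> is the
  orthogonal projection of \<open>\<xi>\<close> to the tangent space.\<close>

definition \<tau> :: "'e \<Rightarrow> 'w \<Rightarrow> 'e" where "\<tau> z \<xi> = rep z (\<lambda>t. B \<xi> (dF z t))"

lemma \<tau>: assumes "z \<in> U" shows "g z (\<tau> z \<xi>) t = B \<xi> (dF z t)"
proof -
  have "linear (\<lambda>t. B \<xi> (dF z t))"
    by (intro linearI) (simp_all add: B_simps linear_add[OF dF_linear[OF assms]] linear_scale[OF dF_linear[OF assms]])
  then show ?thesis unfolding \<tau>_def by (rule rep[OF assms])
qed

lemma \<tau>_smooth: "smooth_on (\<lambda>z. \<tau> z \<xi>) U"
  unfolding \<tau>_def
proof (rule rep_smooth)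
  show "linear (\<lambda>t. B \<xi> (dF z t))" if "z \<in> U" for z
    by (intro linearI) (simp_all add: B_simps linear_add[OF dF_linear[OF that]] linear_scale[OF dF_linear[OF that]])
  show "smooth_on (\<lambda>z. B \<xi> (dF z t)) U" for t
    by (rule smooth_on_bilinear[OF lor_bounded_bilinear U smooth_on_const dF_smooth])
qed

lemma \<tau>_linear: assumes z: "z \<in> U" shows "linear (\<tau> z)"
  by (intro linearI; rule g_eqI[OF z]) (simp_all add: g_simps[OF z] \<tau>[OF z] B_simps)

lemma \<tau>_dF: assumes z: "z \<in> U" shows "\<tau> z (dF z u) = u"
  by (rule g_eqI[OF z]) (simp add: \<tau>[OF z] g_def[symmetric])

lemma \<tau>_zero: assumes z: "z \<in> U" and "\<And>t. B \<xi> (dF z t) = 0" shows "\<tau> z \<xi> = 0"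
  by (rule g_eqI[OF z]) (simp add: assms(2) \<tau>[OF z] g_simps[OF z])

definition \<alpha> :: "'e \<Rightarrow> 'e \<Rightarrow> 'e \<Rightarrow> 'w" where "\<alpha> z u v = ddF z u v - dF z (\<Gamma> z u v)"

lemma ddF_split: "ddF z u v = dF z (\<Gamma> z u v) + \<alpha> z u v"
  by (simp add: \<alpha>_def)

text \<open>Koszul's argument: three cyclic instances of the metric identity and the symmetries
  isolate \<open>g z (\<Gamma> z u v) w\<close>. Smoothness and linearity of \<open>\<Gamma>\<close>
  are derived from this formula.\<close>

lemma \<Gamma>_\<tau>: assumes z: "z \<in> U" shows "\<Gamma> z u v = \<tau> z (ddF z u v)"
proof (rule g_eqI[OF z])
  fix w
  have k: "B (ddF z u v) (dF z w) + B (dF z v) (ddF z u w) = g z (\<Gamma> z u v) w + g z v (\<Gamma> z u w)" for u v w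
    using \<Gamma>_metric[OF z, of v w u]
      frechet_derivative_bilinear[OF lor_bounded_bilinear dF_smooth dF_smooth z, of e0 v w u]
    by (simp add: g_def ddF_def[symmetric] flip: dF_def)
  have "g z (\<Gamma> z u v) w = B (ddF z u v) (dF z w)"
    using k[of u v w] k[of v u w] k[of w u v] hermitian.g_sym[OF hermitian[OF z]]
      ddF_sym[OF z, of u v] ddF_sym[OF z, of u w] ddF_sym[OF z, of v w] lor_sym[of e0]
      \<Gamma>_sym[OF z, of u v] \<Gamma>_sym[OF z, of u w] \<Gamma>_sym[OF z, of v w]
    by simp
  then show "g z (\<Gamma> z u v) w = g z (\<tau> z (ddF z u v)) w" by (simp add: \<tau>[OF z])
qed

lemma \<alpha>_normal: assumes z: "z \<in> U" shows "B (\<alpha> z u v) (dF z t) = 0" "B (dF z t) (\<alpha> z u v) = 0"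
proof -
  have "g z (\<Gamma> z u v) t = B (ddF z u v) (dF z t)" by (simp add: \<Gamma>_\<tau>[OF z] \<tau>[OF z])
  then show "B (\<alpha> z u v) (dF z t) = 0" by (simp add: \<alpha>_def B_simps g_def)
  then show "B (dF z t) (\<alpha> z u v) = 0" by (simp add: lor_sym)
qed

lemma \<Gamma>_smooth: "smooth_on (\<lambda>z. \<Gamma> z u v) U"
  by (rule smooth_on_cong[OF U smooth_on_apply[OF U \<tau>_smooth ddF_smooth \<tau>_linear]]) (simp_all add: \<Gamma>_\<tau>)

lemma \<alpha>_smooth: "smooth_on (\<lambda>z. \<alpha> z u v) U"
  unfolding \<alpha>_def by (intro smooth_on_diff U ddF_smooth smooth_on_apply[OF U dF_smooth \<Gamma>_smooth dF_linear])

lemma \<Gamma>_linear: "z \<in> U \<Longrightarrow> linear (\<Gamma> z u)" "z \<in> U \<Longrightarrow> linear (\<lambda>u. \<Gamma> z u v)"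
  by (intro linearI; simp add: \<Gamma>_\<tau> linear_add[OF ddF_linear_right] linear_scale[OF ddF_linear_right]
      linear_add[OF ddF_linear_left] linear_scale[OF ddF_linear_left] linear_add[OF \<tau>_linear] linear_scale[OF \<tau>_linear])+

lemma \<alpha>_linear: "z \<in> U \<Longrightarrow> linear (\<alpha> z u)" "z \<in> U \<Longrightarrow> linear (\<lambda>u. \<alpha> z u v)"
  by (intro linearI; simp add: \<alpha>_def linear_add[OF ddF_linear_right] linear_scale[OF ddF_linear_right]
      linear_add[OF ddF_linear_left] linear_scale[OF ddF_linear_left] linear_add[OF \<Gamma>_linear(1)] linear_scale[OF \<Gamma>_linear(1)]
      linear_add[OF \<Gamma>_linear(2)] linear_scale[OF \<Gamma>_linear(2)] linear_add[OF dF_linear] linear_scale[OF dF_linear] algebra_simps)+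

lemma \<alpha>_bilinear: "z \<in> U \<Longrightarrow> bilinear (\<alpha> z)"
  using \<alpha>_linear by (auto simp: bilinear_def)

lemma \<alpha>_sym: "z \<in> U \<Longrightarrow> \<alpha> z u v = \<alpha> z v u"
  by (simp add: \<alpha>_def ddF_sym[of z u v] \<Gamma>_sym[of z u v])

lemma \<alpha>_R: "z \<in> U \<Longrightarrow> \<alpha> z u v \<in> R"
  unfolding \<alpha>_def by (intro subspace_diff R(1) ddF_R dF_R)

lemma F_normal: assumes z: "z \<in> U" shows "B (F z) (dF z u) = 0" "B (dF z u) (F z) = 0"
proof -
  have "frechet_derivative (\<lambda>z. B (F z) (F z)) (at z) u = frechet_derivative (\<lambda>z. -1) (at z) u"
    by (rule frechet_derivative_cong[OF U z smooth_on_const]) (simp add: F_hyperboloid)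
  then show "B (F z) (dF z u) = 0"
    using frechet_derivative_bilinear[OF lor_bounded_bilinear F_smooth F_smooth z, of e0 u]
    by (simp add: dF_def lor_sym[of e0 "F z"])
  then show "B (dF z u) (F z) = 0" by (simp add: lor_sym)
qed

lemma \<alpha>_F: assumes z: "z \<in> U" shows "B (\<alpha> z u v) (F z) = - g z u v"
proof -
  have "frechet_derivative (\<lambda>z. B (dF z v) (F z)) (at z) u = frechet_derivative (\<lambda>z. 0) (at z) u"
    by (rule frechet_derivative_cong[OF U z smooth_on_const]) (simp add: F_normal)
  then have "B (dF z v) (dF z u) + B (ddF z u v) (F z) = 0"
    using frechet_derivative_bilinear[OF lor_bounded_bilinear dF_smooth F_smooth z, of e0 v u]
    by (simp add: ddF_def) (simp add: dF_def)
  then show ?thesis using F_normal[OF z] by (simp add: \<alpha>_def B_simps g_def lor_sym[of e0 "dF z v"])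
qed

section \<open>The structure equations of the immersion\<close>

definition curv :: "'e \<Rightarrow> 'e \<Rightarrow> 'e \<Rightarrow> 'e \<Rightarrow> 'e" where
  "curv z u v w = frechet_derivative (\<lambda>z. \<Gamma> z v w) (at z) u - frechet_derivative (\<lambda>z. \<Gamma> z u w) (at z) v
     + \<Gamma> z u (\<Gamma> z v w) - \<Gamma> z v (\<Gamma> z u w)"

text \<open>The second derivatives of \<open>dF (L v)\<close> for a parallel field \<open>L\<close> of endomorphisms. The cases
  \<open>L = id\<close> and \<open>L = J\<close> give the Gauss and Codazzi equations and the curvature identity of Kaehler
  manifolds.\<close>

lemma parallel_second_derivative:
  assumes L: "\<And>z. z \<in> U \<Longrightarrow> linear (L z)" "\<And>v. smooth_on (\<lambda>z. L z v) U"
    and par: "\<And>z u v. z \<in> U \<Longrightarrow> frechet_derivative (\<lambda>z. L z v) (at z) u + \<Gamma> z u (L z v) = L z (\<Gamma> z u v)"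
    and y: "y \<in> U"
  shows "frechet_derivative (\<lambda>z. frechet_derivative (\<lambda>z. dF z (L z v)) (at z) u) (at y) w =
    \<alpha> y w (L y (\<Gamma> y u v)) + dF y (L y (\<Gamma> y w (\<Gamma> y u v) + frechet_derivative (\<lambda>z. \<Gamma> z u v) (at y) w))
    + frechet_derivative (\<lambda>z. \<alpha> z u (L z v)) (at y) w"
proof -
  \<comment> \<open>The Gauss formula for \<open>ddF\<close> contributes
    \<open>\<Gamma> z u (L z (s z))\<close>, which cancels against the same term in the derivative
    of \<open>L s\<close>; what is left is \<open>L\<close> of the covariant derivative of
    \<open>s\<close>.\<close>
  have first: "frechet_derivative (\<lambda>z. dF z (L z (s z))) (at z) u =
      \<alpha> z u (L z (s z)) + dF z (L z (\<Gamma> z u (s z) + frechet_derivative s (at z) u))"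
    if z: "z \<in> U" and s: "smooth_on s U" for s z u
  proof -
    have Ls: "smooth_on (\<lambda>z. L z (s z)) U" by (rule smooth_on_apply[OF U L(2) s L(1)])
    have "frechet_derivative (\<lambda>z. dF z (L z (s z))) (at z) u =
      ddF z u (L z (s z)) + dF z (frechet_derivative (\<lambda>z. L z (s z)) (at z) u)"
      using frechet_derivative_apply[OF U dF_smooth dF_linear Ls z] by (simp add: ddF_def)
    also have "frechet_derivative (\<lambda>z. L z (s z)) (at z) u =
      L z (\<Gamma> z u (s z)) - \<Gamma> z u (L z (s z)) + L z (frechet_derivative s (at z) u)"
      using frechet_derivative_apply[OF U L(2,1) s z, of u] par[OF z, of "s z" u] by (simp add: algebra_simps)
    finally show ?thesis
      by (simp add: ddF_split linear_add[OF dF_linear[OF z]] linear_diff[OF dF_linear[OF z]] linear_add[OF L(1)[OF z]])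
  qed
  have sm1: "smooth_on (\<lambda>z. \<alpha> z u (L z v)) U"
    by (rule smooth_on_apply[OF U \<alpha>_smooth L(2) \<alpha>_linear(1)])
  have sm2: "smooth_on (\<lambda>z. dF z (L z (\<Gamma> z u v))) U"
    by (rule smooth_on_apply[OF U dF_smooth smooth_on_apply[OF U L(2) \<Gamma>_smooth L(1)] dF_linear])
  have "frechet_derivative (\<lambda>z. frechet_derivative (\<lambda>z. dF z (L z v)) (at z) u) (at y) w =
    frechet_derivative (\<lambda>z. dF z (L z (\<Gamma> z u v)) + \<alpha> z u (L z v)) (at y) w"
    using first[OF _ smooth_on_const, of _ v u]
    by (intro frechet_derivative_cong[OF U y] smooth_on_add U sm1 sm2) simp
  also have "\<dots> = frechet_derivative (\<lambda>z. dF z (L z (\<Gamma> z u v))) (at y) w + frechet_derivative (\<lambda>z. \<alpha> z u (L z v)) (at y) w"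
    by (rule frechet_derivative_add[OF sm2 sm1 y])
  finally show ?thesis by (simp add: first[OF y \<Gamma>_smooth])
qed

text \<open>Weingarten's formula, by differentiating
  \<open>B (\<alpha> z u (s z)) (dF z t) = 0\<close>.\<close>

lemma \<alpha>_derivative_tangential:
  assumes y: "y \<in> U" and s: "smooth_on s U"
  shows "B (frechet_derivative (\<lambda>z. \<alpha> z u (s z)) (at y) w) (dF y t) = - B (\<alpha> y u (s y)) (\<alpha> y w t)"
proof -
  have sm: "smooth_on (\<lambda>z. \<alpha> z u (s z)) U" by (rule smooth_on_apply[OF U \<alpha>_smooth s \<alpha>_linear(1)])
  have "frechet_derivative (\<lambda>z. B (\<alpha> z u (s z)) (dF z t)) (at y) w = frechet_derivative (\<lambda>z. 0) (at y) w"
    by (rule frechet_derivative_cong[OF U y smooth_on_const]) (simp add: \<alpha>_normal)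
  then have "B (\<alpha> y u (s y)) (ddF y w t) + B (frechet_derivative (\<lambda>z. \<alpha> z u (s z)) (at y) w) (dF y t) = 0"
    using frechet_derivative_bilinear[OF lor_bounded_bilinear sm dF_smooth y, of e0 t w] by (simp add: ddF_def)
  then show ?thesis using \<alpha>_normal[OF y] by (simp add: ddF_split B_simps)
qed

text \<open>The tangential part of the symmetry of second derivatives in \<open>u\<close> and
  \<open>w\<close>, where the difference of the Christoffel terms is the curvature.\<close>

lemma gauss_parallel:
  assumes L: "\<And>z. z \<in> U \<Longrightarrow> linear (L z)" "\<And>v. smooth_on (\<lambda>z. L z v) U"
    and par: "\<And>z u v. z \<in> U \<Longrightarrow> frechet_derivative (\<lambda>z. L z v) (at z) u + \<Gamma> z u (L z v) = L z (\<Gamma> z u v)"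
    and y: "y \<in> U"
  shows "g y (L y (curv y w u v)) t = B (\<alpha> y u (L y v)) (\<alpha> y w t) - B (\<alpha> y w (L y v)) (\<alpha> y u t)"
proof -
  have sm: "smooth_on (\<lambda>z. dF z (L z v)) U" by (rule smooth_on_apply[OF U dF_smooth L(2) dF_linear])
  have D: "B (frechet_derivative (\<lambda>z. frechet_derivative (\<lambda>z. dF z (L z v)) (at z) u) (at y) w) (dF y t) =
    g y (L y (\<Gamma> y w (\<Gamma> y u v) + frechet_derivative (\<lambda>z. \<Gamma> z u v) (at y) w)) t - B (\<alpha> y u (L y v)) (\<alpha> y w t)" for u w
    using parallel_second_derivative[OF L par y, of v u w]
    by (simp add: B_simps \<alpha>_normal[OF y] \<alpha>_derivative_tangential[OF y L(2)] g_def)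
  show ?thesis
    using D[of u w] D[of w u] second_derivative_symmetric[OF U y sm, of u w]
    by (simp add: curv_def linear_add[OF L(1)[OF y]] linear_diff[OF L(1)[OF y]] g_simps[OF y])
qed

lemma id_parallel: "frechet_derivative (\<lambda>z. v) (at z) u + \<Gamma> z u v = \<Gamma> z u v" by simp

lemma gauss: "y \<in> U \<Longrightarrow> g y (curv y w u v) t = B (\<alpha> y u v) (\<alpha> y w t) - B (\<alpha> y w v) (\<alpha> y u t)"
  using gauss_parallel[of "\<lambda>z v. v", OF linear_ident smooth_on_const id_parallel] by simp

text \<open>The product of \<open>J\<close> applied to the curvature with \<open>t\<close> is
  computed twice: with \<open>L = J\<close>, and with the plain Gauss equation against
  \<open>J t\<close>, as \<open>J\<close> is skew for \<open>g\<close>.\<close>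

lemma kaehler_identity:
  assumes y: "y \<in> U"
  shows "B (\<alpha> y u (J y v)) (\<alpha> y w t) - B (\<alpha> y w (J y v)) (\<alpha> y u t)
      + B (\<alpha> y u v) (\<alpha> y w (J y t)) - B (\<alpha> y w v) (\<alpha> y u (J y t)) = 0"
  using gauss_parallel[OF Jz_linear J_smooth J_parallel y, of w u v t] gauss[OF y, of w u v "J y t"]
    hermitian.g_J_left[OF hermitian[OF y]] by simp

text \<open>The normal part of the symmetry of the second derivatives of \<open>dF v\<close>, with
  the normal projection written out.\<close>

lemma codazzi:
  assumes y: "y \<in> U"
  shows "frechet_derivative (\<lambda>z. \<alpha> z u v) (at y) w - dF y (\<tau> y (frechet_derivative (\<lambda>z. \<alpha> z u v) (at y) w))
      + \<alpha> y w (\<Gamma> y u v) =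
    frechet_derivative (\<lambda>z. \<alpha> z w v) (at y) u - dF y (\<tau> y (frechet_derivative (\<lambda>z. \<alpha> z w v) (at y) u))
      + \<alpha> y u (\<Gamma> y w v)"
proof -
  let ?D = "\<lambda>u w. frechet_derivative (\<lambda>z. frechet_derivative (\<lambda>z. dF z v) (at z) u) (at y) w"
  let ?\<nu> = "\<lambda>\<xi>. \<xi> - dF y (\<tau> y \<xi>)"
  have \<nu>: "?\<nu> (\<alpha> y a b + dF y c + d) = \<alpha> y a b + ?\<nu> d" for a b c d
    using \<tau>_zero[OF y \<alpha>_normal(1)[OF y], of a b]
    by (simp add: linear_add[OF \<tau>_linear[OF y]] linear_add[OF dF_linear[OF y]] \<tau>_dF[OF y])
  have D: "?\<nu> (?D u w) = \<alpha> y w (\<Gamma> y u v) + ?\<nu> (frechet_derivative (\<lambda>z. \<alpha> z u v) (at y) w)" for u w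
  proof -
    have "?D u w = \<alpha> y w (\<Gamma> y u v) + dF y (\<Gamma> y w (\<Gamma> y u v) + frechet_derivative (\<lambda>z. \<Gamma> z u v) (at y) w)
      + frechet_derivative (\<lambda>z. \<alpha> z u v) (at y) w"
      by (rule parallel_second_derivative[of "\<lambda>z v. v", OF linear_ident smooth_on_const id_parallel y])
    then show ?thesis by (simp only: \<nu>)
  qed
  have sym: "?D u w = ?D w u" by (rule second_derivative_symmetric[OF U y dF_smooth])
  have "\<alpha> y w (\<Gamma> y u v) + ?\<nu> (frechet_derivative (\<lambda>z. \<alpha> z u v) (at y) w) =
      \<alpha> y u (\<Gamma> y w v) + ?\<nu> (frechet_derivative (\<lambda>z. \<alpha> z w v) (at y) u)"
    by (rule trans[OF D[of u w, symmetric] trans[OF arg_cong[OF sym, of ?\<nu>] D[of w u]]])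
  then show ?thesis by (metis (no_types) add.commute)
qed

end

section \<open>Parallelism of the second fundamental form\<close>

lemma Ck_on_subset: "Ck_on k f S \<Longrightarrow> T \<subseteq> S \<Longrightarrow> Ck_on k f T"
  by (induction k arbitrary: f) (auto intro: continuous_on_subset)

lemma smooth_on_subset: "smooth_on f S \<Longrightarrow> T \<subseteq> S \<Longrightarrow> smooth_on f T"
  unfolding smooth_on_def using Ck_on_subset by blast

lemma bilinear_norm_le:
  fixes h :: "'x::euclidean_space \<Rightarrow> 'y::euclidean_space \<Rightarrow> 'z::real_normed_vector"
  assumes "bilinear h"
  shows "norm (h u v) \<le> norm u * norm v * (\<Sum>(i, b)\<in>Basis \<times> Basis. norm (h i b))"
proof -
  have l1: "linear (\<lambda>u. h u v)" and l2: "linear (h u)" for u v using assms by (auto simp: bilinear_def)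
  have "h u v = (\<Sum>i\<in>Basis. (u \<bullet> i) *\<^sub>R h i v)" by (rule linear_basis_expand[OF l1])
  also have "\<dots> = (\<Sum>i\<in>Basis. \<Sum>b\<in>Basis. ((u \<bullet> i) * (v \<bullet> b)) *\<^sub>R h i b)"
    by (simp add: linear_basis_expand[OF l2, of _ v] scaleR_sum_right)
  also have "\<dots> = (\<Sum>(i, b)\<in>Basis \<times> Basis. ((u \<bullet> i) * (v \<bullet> b)) *\<^sub>R h i b)"
    by (simp add: sum.cartesian_product)
  also have "norm \<dots> \<le> (\<Sum>(i, b)\<in>Basis \<times> Basis. norm u * norm v * norm (h i b))"
    by (rule sum_norm_le) (auto simp: abs_mult intro!: mult_right_mono mult_mono Basis_le_norm)
  finally show ?thesis by (simp add: sum_distrib_left case_prod_unfold)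
qed

context kaehler_chart
begin

definition \<nu> :: "'e \<Rightarrow> 'w \<Rightarrow> 'w" where "\<nu> z \<xi> = \<xi> - dF z (\<tau> z \<xi>)"

lemma \<nu>_linear: "z \<in> U \<Longrightarrow> linear (\<nu> z)"
  unfolding \<nu>_def by (intro linearI)
    (simp_all add: linear_add[OF \<tau>_linear] linear_scale[OF \<tau>_linear] linear_add[OF dF_linear] linear_scale[OF dF_linear] algebra_simps)

lemma \<nu>_\<alpha>: "z \<in> U \<Longrightarrow> \<nu> z (\<alpha> z u v) = \<alpha> z u v"
  by (simp add: \<nu>_def \<tau>_zero \<alpha>_normal linear_0[OF dF_linear])

lemma \<nu>_dF: "z \<in> U \<Longrightarrow> \<nu> z (dF z u) = 0"
  by (simp add: \<nu>_def \<tau>_dF)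

lemma \<nu>_normal: assumes z: "z \<in> U" shows "B (\<nu> z \<xi>) (dF z t) = 0"
  using \<tau>[OF z, of \<xi> t] by (simp add: \<nu>_def B_simps g_def)

lemma eq_by_parts:
  assumes "z \<in> U" "\<nu> z x = \<nu> z y" "\<And>t. B x (dF z t) = B y (dF z t)" shows "x = y"
proof -
  have "\<tau> z x = \<tau> z y" using assms by (intro g_eqI[of z]) (simp_all add: \<tau>)
  then show ?thesis using assms(2) by (simp add: \<nu>_def)
qed

lemma \<alpha>_lin: assumes z: "z \<in> U"
  shows "\<alpha> z (u + u') v = \<alpha> z u v + \<alpha> z u' v" "\<alpha> z u (v + v') = \<alpha> z u v + \<alpha> z u v'"
    "\<alpha> z (u - u') v = \<alpha> z u v - \<alpha> z u' v" "\<alpha> z u (v - v') = \<alpha> z u v - \<alpha> z u v'"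
    "\<alpha> z (- u) v = - \<alpha> z u v" "\<alpha> z u (- v) = - \<alpha> z u v"
    "\<alpha> z (c *\<^sub>R u) v = c *\<^sub>R \<alpha> z u v" "\<alpha> z u (c *\<^sub>R v) = c *\<^sub>R \<alpha> z u v"
  by (simp_all add: linear_add[OF \<alpha>_linear(1)[OF z]] linear_diff[OF \<alpha>_linear(1)[OF z]] linear_neg[OF \<alpha>_linear(1)[OF z]]
      linear_scale[OF \<alpha>_linear(1)[OF z]]
      linear_add[OF \<alpha>_linear(2)[OF z]] linear_diff[OF \<alpha>_linear(2)[OF z]] linear_neg[OF \<alpha>_linear(2)[OF z]]
      linear_scale[OF \<alpha>_linear(2)[OF z]])

abbreviation D\<alpha> :: "'e \<Rightarrow> 'e \<Rightarrow> 'e \<Rightarrow> 'e \<Rightarrow> 'w" where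
  "D\<alpha> y w u v \<equiv> frechet_derivative (\<lambda>z. \<alpha> z u v) (at y) w"

lemma \<alpha>_smooth_apply:
  assumes "smooth_on s U" "smooth_on t U"
  shows "smooth_on (\<lambda>z. \<alpha> z (s z) (t z)) U"
  by (rule smooth_on_apply[OF U smooth_on_apply[OF U \<alpha>_smooth assms(2) \<alpha>_linear(1)] assms(1) \<alpha>_linear(2)])

lemma \<alpha>_product_rule:
  assumes y: "y \<in> U" and s: "smooth_on s U" and t: "smooth_on t U"
  shows "frechet_derivative (\<lambda>z. \<alpha> z (s z) (t z)) (at y) w =
    D\<alpha> y w (s y) (t y) + \<alpha> y (frechet_derivative s (at y) w) (t y) + \<alpha> y (s y) (frechet_derivative t (at y) w)"
  using frechet_derivative_apply[OF U smooth_on_apply[OF U \<alpha>_smooth t \<alpha>_linear(1)] \<alpha>_linear(2) s y, of w]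
    frechet_derivative_apply[OF U \<alpha>_smooth \<alpha>_linear(1) t y, of "s y" w] by simp

text \<open>The covariant derivative of a \<open>J\<close>-invariant second fundamental form is totally symmetric by
  Codazzi and \<open>J\<close>-invariant in two slots, hence zero.\<close>

lemma parallel_second_form:
  assumes W: "open W" "W \<subseteq> U" "y \<in> W"
    and inv: "\<And>z u v. z \<in> W \<Longrightarrow> \<alpha> z (J z u) (J z v) = \<alpha> z u v"
  shows "D\<alpha> y w u v = \<alpha> y (\<Gamma> y w u) v + \<alpha> y u (\<Gamma> y w v) + dF y (\<tau> y (D\<alpha> y w u v))"
proof -
  have y: "y \<in> U" using W by blast
  \<comment> \<open>The normal covariant derivative of the second fundamental form in the direction
    \<open>w\<close>.\<close>
  define C where "C w u v = \<nu> y (D\<alpha> y w u v) - \<alpha> y (\<Gamma> y w u) v - \<alpha> y u (\<Gamma> y w v)" for w u v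
  have s12: "C w u v = C u w v" for w u v
    using codazzi[OF y, of u v w] \<Gamma>_sym[OF y, of w u] by (simp add: C_def \<nu>_def algebra_simps)
  have s23: "C w u v = C w v u" for w u v
  proof -
    have "D\<alpha> y w v u = D\<alpha> y w u v"
      by (rule frechet_derivative_cong[OF U y \<alpha>_smooth]) (rule \<alpha>_sym)
    then show ?thesis using \<alpha>_sym[OF y] by (simp add: C_def algebra_simps)
  qed
  have neg: "C w (- u) v = - C w u v" for w u v
  proof -
    have "D\<alpha> y w (- u) v = frechet_derivative (\<lambda>z. - \<alpha> z u v) (at y) w"
      by (rule frechet_derivative_cong[OF U y smooth_on_linear[OF bounded_linear_minus[OF bounded_linear_ident] U \<alpha>_smooth]])
        (simp add: \<alpha>_lin)
    also have "\<dots> = - D\<alpha> y w u v"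
      by (rule frechet_derivative_linear[OF bounded_linear_minus[OF bounded_linear_ident] \<alpha>_smooth y])
    finally show ?thesis
      by (simp add: C_def \<alpha>_lin[OF y] linear_neg[OF \<nu>_linear[OF y]] linear_neg[OF \<Gamma>_linear(1)[OF y]])
  qed
  have CJ: "C w (J y u) (J y v) = C w u v" for w u v
  proof -
    have DJ: "frechet_derivative (\<lambda>z. J z u) (at y) w = J y (\<Gamma> y w u) - \<Gamma> y w (J y u)" for u
      using J_parallel[OF y, of u w] by (simp add: eq_diff_eq)
    have "frechet_derivative (\<lambda>z. \<alpha> z (J z u) (J z v)) (at y) w = D\<alpha> y w u v"
      using inv by (intro frechet_derivative_cong[OF W(1,3) smooth_on_subset[OF \<alpha>_smooth W(2)]]) simp
    then have "D\<alpha> y w u v = D\<alpha> y w (J y u) (J y v) + \<alpha> y (J y (\<Gamma> y w u) - \<Gamma> y w (J y u)) (J y v)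
        + \<alpha> y (J y u) (J y (\<Gamma> y w v) - \<Gamma> y w (J y v))"
      by (simp add: \<alpha>_product_rule[OF y J_smooth J_smooth] DJ)
    then have "\<nu> y (D\<alpha> y w u v) = \<nu> y (D\<alpha> y w (J y u) (J y v)) + \<alpha> y (\<Gamma> y w u) v - \<alpha> y (\<Gamma> y w (J y u)) (J y v)
        + \<alpha> y u (\<Gamma> y w v) - \<alpha> y (J y u) (\<Gamma> y w (J y v))"
      by (simp add: \<alpha>_lin[OF y] inv[OF W(3)] linear_add[OF \<nu>_linear[OF y]] linear_diff[OF \<nu>_linear[OF y]] \<nu>_\<alpha>[OF y])
    then show ?thesis by (simp add: C_def algebra_simps)
  qed
  \<comment> \<open>Each use of \<open>CJ\<close> inserts or removes a pair of \<open>J\<close>,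
    each permutation is free. On the way \<open>J\<close> meets itself once, in the slot of
    \<open>u\<close>, and \<open>J (J u) = - u\<close> gives the sign.\<close>
  have "C w u v = C w (J y u) (J y v)" by (simp add: CJ)
  also have "\<dots> = C (J y v) (J y u) w" by (metis s12 s23)
  also have "\<dots> = C (J y v) (J y (J y u)) (J y w)" by (simp add: CJ)
  also have "\<dots> = - C u (J y v) (J y w)" by (simp add: Jz_square[OF y] neg) (metis s12)
  also have "\<dots> = - C w u v" by (metis CJ s12 s23)
  finally have "C w u v + C w u v = 0" unfolding eq_neg_iff_add_eq_0 .
  then have "2 *\<^sub>R C w u v = 0" unfolding scaleR_2 .
  then have "C w u v = 0" by simp
  then show ?thesis by (simp add: C_def \<nu>_def algebra_simps)
qed

section \<open>Derivatives of the splitting into tangent and normal spaces\<close>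

definition shp :: "'e \<Rightarrow> 'e \<Rightarrow> 'w \<Rightarrow> 'e" where "shp z u \<xi> = rep z (\<lambda>t. B (\<alpha> z u t) \<xi>)"

lemma shp_functional: "z \<in> U \<Longrightarrow> linear (\<lambda>t. B (\<alpha> z u t) \<xi>)"
  by (intro linearI) (simp_all add: B_simps \<alpha>_lin)

lemma shp: "z \<in> U \<Longrightarrow> g z (shp z u \<xi>) t = B (\<alpha> z u t) \<xi>"
  unfolding shp_def by (rule rep[OF _ shp_functional])

lemma shp_smooth: "smooth_on (\<lambda>z. shp z u \<xi>) U"
  unfolding shp_def
  by (rule rep_smooth[OF shp_functional]) (auto intro: smooth_on_bilinear[OF lor_bounded_bilinear U \<alpha>_smooth smooth_on_const])

lemma shp_bilinear: assumes z: "z \<in> U" shows "bilinear (shp z)"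
  unfolding bilinear_def
  by (intro conjI allI linearI; rule g_eqI[OF z]) (simp_all add: shp[OF z] g_simps[OF z] \<alpha>_lin[OF z] B_simps)

text \<open>\<open>\<omega>\<close> is the connection form of the splitting of the ambient space into tangent and normal
  spaces: \<open>\<omega> u\<close> is the off-diagonal part of the derivative in the direction \<open>u\<close>.\<close>

definition \<omega> :: "'e \<Rightarrow> 'e \<Rightarrow> 'w \<Rightarrow> 'w" where
  "\<omega> z u \<xi> = \<alpha> z u (\<tau> z \<xi>) - dF z (shp z u \<xi>)"

lemma \<omega>_bilinear: assumes z: "z \<in> U" shows "bilinear (\<omega> z)"
  unfolding bilinear_def \<omega>_def
  by (intro conjI allI linearI)
    (simp_all add: \<alpha>_lin[OF z] linear_add[OF \<tau>_linear[OF z]] linear_scale[OF \<tau>_linear[OF z]]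
      bilinear_ladd[OF shp_bilinear[OF z]] bilinear_radd[OF shp_bilinear[OF z]]
      bilinear_lmul[OF shp_bilinear[OF z]] bilinear_rmul[OF shp_bilinear[OF z]]
      linear_add[OF dF_linear[OF z]] linear_scale[OF dF_linear[OF z]] algebra_simps)

lemma \<omega>_smooth: "smooth_on (\<lambda>z. \<omega> z u \<xi>) U"
  unfolding \<omega>_def
  by (intro smooth_on_diff U smooth_on_apply[OF U \<alpha>_smooth \<tau>_smooth \<alpha>_linear(1)]
      smooth_on_apply[OF U dF_smooth shp_smooth dF_linear])

lemma \<tau>_\<omega>: assumes z: "z \<in> U" shows "\<tau> z (\<omega> z u \<xi>) = - shp z u \<xi>"
  by (simp add: \<omega>_def linear_diff[OF \<tau>_linear[OF z]] \<tau>_dF[OF z] \<tau>_zero[OF z \<alpha>_normal(1)[OF z]])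

lemma \<nu>_\<omega>: assumes z: "z \<in> U" shows "\<nu> z (\<omega> z u \<xi>) = \<alpha> z u (\<tau> z \<xi>)"
  by (simp add: \<omega>_def linear_diff[OF \<nu>_linear[OF z]] \<nu>_dF[OF z] \<nu>_\<alpha>[OF z])

lemma B_\<omega>: assumes z: "z \<in> U" shows "B (\<omega> z u \<xi>) (dF z t) = - B (\<alpha> z u t) \<xi>"
  using shp[OF z, of u \<xi> t] by (simp add: \<omega>_def B_simps \<alpha>_normal[OF z] g_def)

text \<open>For constant \<open>\<xi>\<close> the relation
  \<open>B (\<nu> z \<xi>) (dF z t) = 0\<close> is differentiated; the second fundamental form
  enters through \<open>ddF z v t\<close>.\<close>

lemma \<tau>_derivative:
  assumes y: "y \<in> U"
  shows "frechet_derivative (\<lambda>z. \<tau> z \<xi>) (at y) v = shp y v \<xi> - \<Gamma> y v (\<tau> y \<xi>)"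
proof (rule g_eqI[OF y])
  fix t
  have sm: "smooth_on (\<lambda>z. \<xi> - dF z (\<tau> z \<xi>)) U"
    by (intro smooth_on_diff U smooth_on_const smooth_on_apply[OF U dF_smooth \<tau>_smooth dF_linear])
  have "frechet_derivative (\<lambda>z. B (\<xi> - dF z (\<tau> z \<xi>)) (dF z t)) (at y) v = frechet_derivative (\<lambda>z. 0) (at y) v"
    using \<nu>_normal by (intro frechet_derivative_cong[OF U y smooth_on_const]) (simp add: \<nu>_def)
  moreover have "frechet_derivative (\<lambda>z. \<xi> - dF z (\<tau> z \<xi>)) (at y) v =
     - (ddF y v (\<tau> y \<xi>) + dF y (frechet_derivative (\<lambda>z. \<tau> z \<xi>) (at y) v))"
    using frechet_derivative_diff[OF smooth_on_const smooth_on_apply[OF U dF_smooth \<tau>_smooth dF_linear] y, of \<xi> \<xi> v]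
      frechet_derivative_apply[OF U dF_smooth dF_linear \<tau>_smooth y, of \<xi> v] by (simp add: ddF_def)
  ultimately have "B (\<nu> y \<xi>) (ddF y v t) - B (ddF y v (\<tau> y \<xi>)) (dF y t) - g y (frechet_derivative (\<lambda>z. \<tau> z \<xi>) (at y) v) t = 0"
    using frechet_derivative_bilinear[OF lor_bounded_bilinear sm dF_smooth y, of e0 t v]
    by (simp add: ddF_def[symmetric] \<nu>_def[symmetric] g_def B_simps)
  moreover have "B (\<nu> y \<xi>) (ddF y v t) = B (\<alpha> y v t) \<xi>"
    by (simp add: ddF_split B_simps \<nu>_normal[OF y]) (simp add: \<nu>_def B_simps \<alpha>_normal[OF y] lor_sym[of e0 \<xi>])
  moreover have "B (ddF y v (\<tau> y \<xi>)) (dF y t) = g y (\<Gamma> y v (\<tau> y \<xi>)) t"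
    by (simp add: ddF_split B_simps \<alpha>_normal[OF y] g_def)
  ultimately show "g y (frechet_derivative (\<lambda>z. \<tau> z \<xi>) (at y) v) t = g y (shp y v \<xi> - \<Gamma> y v (\<tau> y \<xi>)) t"
    by (simp add: g_simps[OF y] shp[OF y])
qed

text \<open>The tangential projection as an endomorphism of the fixed ambient space, where it can be
  compared with constant maps.\<close>

definition E :: "'e \<Rightarrow> 'w \<Rightarrow> 'w" where "E z \<xi> = dF z (\<tau> z \<xi>)"

lemma E_smooth: "smooth_on (\<lambda>z. E z \<xi>) U"
  unfolding E_def by (rule smooth_on_apply[OF U dF_smooth \<tau>_smooth dF_linear])

lemma E_linear: "z \<in> U \<Longrightarrow> linear (E z)"
  unfolding E_def using linear_compose[OF \<tau>_linear dF_linear] by (simp add: o_def)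

text \<open>The derivative of a projection interchanges its image and its kernel, so it is the
  commutator with the off-diagonal map \<open>\<omega>\<close>.\<close>

lemma E_derivative:
  assumes y: "y \<in> U"
  shows "frechet_derivative (\<lambda>z. E z \<xi>) (at y) v = \<omega> y v (E y \<xi>) - E y (\<omega> y v \<xi>)"
proof -
  have s0: "shp y v (dF y t) = 0" for t
    by (rule g_eqI[OF y]) (simp add: shp[OF y] g_simps[OF y] \<alpha>_normal[OF y])
  have "frechet_derivative (\<lambda>z. E z \<xi>) (at y) v = ddF y v (\<tau> y \<xi>) + dF y (shp y v \<xi> - \<Gamma> y v (\<tau> y \<xi>))"
    using frechet_derivative_apply[OF U dF_smooth dF_linear \<tau>_smooth y, of \<xi> v]
    by (simp add: E_def ddF_def \<tau>_derivative[OF y])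
  also have "\<dots> = \<alpha> y v (\<tau> y \<xi>) + dF y (shp y v \<xi>)"
    by (simp add: ddF_split linear_diff[OF dF_linear[OF y]])
  also have "\<dots> = \<omega> y v (E y \<xi>) - E y (\<omega> y v \<xi>)"
    by (simp add: E_def \<tau>_\<omega>[OF y] linear_neg[OF dF_linear[OF y]])
      (simp add: \<omega>_def \<tau>_dF[OF y] s0 linear_0[OF dF_linear[OF y]])
  finally show ?thesis .
qed

text \<open>Parallelism eliminates the derivative of \<open>\<alpha>\<close>, so only
  \<open>\<omega>\<close> and \<open>\<Gamma>\<close> remain on the right. With
  \<open>E_derivative\<close> this is a closed system, and commutators of a constant map with
  \<open>\<omega>\<close> and \<open>E\<close> obey linear equations. The two sides are compared in
  normal and tangential parts.\<close>

lemma \<omega>_derivative: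
  assumes W: "open W" "W \<subseteq> U" "y \<in> W"
    and inv: "\<And>z u v. z \<in> W \<Longrightarrow> \<alpha> z (J z u) (J z v) = \<alpha> z u v"
  shows "frechet_derivative (\<lambda>z. \<omega> z u \<xi>) (at y) v =
    \<omega> y (\<Gamma> y v u) \<xi> + \<omega> y v (\<omega> y u \<xi>) - \<omega> y u (\<omega> y v \<xi>)" (is "?D = ?R")
proof (rule eq_by_parts)
  show y: "y \<in> U" using W by blast
  note par = parallel_second_form[OF W inv]
  have "?D = D\<alpha> y v u (\<tau> y \<xi>) + \<alpha> y u (shp y v \<xi> - \<Gamma> y v (\<tau> y \<xi>))
      - (ddF y v (shp y u \<xi>) + dF y (frechet_derivative (\<lambda>z. shp z u \<xi>) (at y) v))"
    unfolding \<omega>_def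
    using frechet_derivative_diff[OF smooth_on_apply[OF U \<alpha>_smooth \<tau>_smooth \<alpha>_linear(1)]
        smooth_on_apply[OF U dF_smooth shp_smooth dF_linear] y, of u \<xi> u \<xi> v]
      frechet_derivative_apply[OF U \<alpha>_smooth \<alpha>_linear(1) \<tau>_smooth y, of u \<xi> v]
      frechet_derivative_apply[OF U dF_smooth dF_linear shp_smooth y, of u \<xi> v]
    by (simp add: ddF_def \<tau>_derivative[OF y])
  moreover have "\<nu> y (D\<alpha> y v u (\<tau> y \<xi>)) = \<alpha> y (\<Gamma> y v u) (\<tau> y \<xi>) + \<alpha> y u (\<Gamma> y v (\<tau> y \<xi>))"
    using arg_cong[OF par[where w=v and u=u and v="\<tau> y \<xi>"], of "\<nu> y"]
    by (simp add: linear_add[OF \<nu>_linear[OF y]] \<nu>_\<alpha>[OF y] \<nu>_dF[OF y])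
  ultimately have "\<nu> y ?D = \<alpha> y (\<Gamma> y v u) (\<tau> y \<xi>) + \<alpha> y u (shp y v \<xi>) - \<alpha> y v (shp y u \<xi>)"
    by (simp add: ddF_split linear_add[OF \<nu>_linear[OF y]] linear_diff[OF \<nu>_linear[OF y]] \<nu>_\<alpha>[OF y] \<nu>_dF[OF y] \<alpha>_lin[OF y])
  moreover have "\<nu> y ?R = \<alpha> y (\<Gamma> y v u) (\<tau> y \<xi>) - \<alpha> y v (shp y u \<xi>) + \<alpha> y u (shp y v \<xi>)"
    by (simp add: linear_add[OF \<nu>_linear[OF y]] linear_diff[OF \<nu>_linear[OF y]] \<nu>_\<omega>[OF y] \<tau>_\<omega>[OF y] \<alpha>_lin[OF y])
  ultimately show "\<nu> y ?D = \<nu> y ?R" by simp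
  fix t
  \<comment> \<open>For the tangential part \<open>B_\<omega>\<close> is differentiated, which
    replaces the unknown derivative of \<open>shp\<close> by that of
    \<open>\<alpha>\<close>.\<close>
  have "frechet_derivative (\<lambda>z. B (\<omega> z u \<xi>) (dF z t)) (at y) v = frechet_derivative (\<lambda>z. - B (\<alpha> z u t) \<xi>) (at y) v"
    by (rule frechet_derivative_cong[OF U y smooth_on_linear[OF bounded_linear_minus[OF bounded_linear_ident] U
          smooth_on_bilinear[OF lor_bounded_bilinear U \<alpha>_smooth smooth_on_const]]]) (simp add: B_\<omega>)
  also have "\<dots> = - B (D\<alpha> y v u t) \<xi>"
    using frechet_derivative_linear[OF bounded_linear_minus[OF bounded_linear_ident]
        smooth_on_bilinear[OF lor_bounded_bilinear U \<alpha>_smooth smooth_on_const] y, of e0 u t \<xi> v]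
      frechet_derivative_bilinear[OF lor_bounded_bilinear \<alpha>_smooth smooth_on_const y, of e0 u t \<xi> v]
    by (simp add: B_simps)
  finally have 1: "B (\<omega> y u \<xi>) (ddF y v t) + B ?D (dF y t) = - B (D\<alpha> y v u t) \<xi>"
    using frechet_derivative_bilinear[OF lor_bounded_bilinear \<omega>_smooth dF_smooth y, of e0 u \<xi> t v]
    by (simp add: ddF_def)
  have "B (dF y (\<tau> y (D\<alpha> y v u t))) \<xi> = g y (\<tau> y (D\<alpha> y v u t)) (\<tau> y \<xi>)"
    using \<tau>[OF y, of \<xi> "\<tau> y (D\<alpha> y v u t)"] hermitian.g_sym[OF hermitian[OF y]] lor_sym[of e0 \<xi>] by simp
  also have "\<dots> = - B (\<alpha> y u t) (\<alpha> y v (\<tau> y \<xi>))"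
    using \<alpha>_derivative_tangential[OF y smooth_on_const, of u t v "\<tau> y \<xi>"] by (simp add: \<tau>[OF y])
  finally have 2: "B (D\<alpha> y v u t) \<xi> = B (\<alpha> y (\<Gamma> y v u) t) \<xi> + B (\<alpha> y u (\<Gamma> y v t)) \<xi> - B (\<alpha> y u t) (\<alpha> y v (\<tau> y \<xi>))"
    using arg_cong[OF par[where w=v and u=u and v=t], of "\<lambda>x. B x \<xi>"] by (simp add: B_simps)
  have 3: "B (\<omega> y u \<xi>) (ddF y v t) = - B (\<alpha> y u (\<Gamma> y v t)) \<xi> + B (\<alpha> y u (\<tau> y \<xi>)) (\<alpha> y v t)"
    by (simp add: ddF_split B_simps B_\<omega>[OF y]) (simp add: \<omega>_def B_simps \<alpha>_normal[OF y])
  have 4: "B (\<alpha> y v t) (\<omega> y u \<xi>) = B (\<alpha> y u (\<tau> y \<xi>)) (\<alpha> y v t)" for u v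
    by (simp add: \<omega>_def B_simps \<alpha>_normal[OF y] lor_sym)
  show "B ?D (dF y t) = B ?R (dF y t)"
    using 1 2 3 by (simp add: B_simps B_\<omega>[OF y] 4) (simp add: lor_sym)
qed

end

lemma linear_norm_le:
  fixes h :: "'x::euclidean_space \<Rightarrow> 'z::real_normed_vector"
  assumes "linear h"
  shows "norm (h u) \<le> norm u * (\<Sum>b\<in>Basis. norm (h b))"
proof -
  have "norm (h u) = norm (\<Sum>i\<in>Basis. (u \<bullet> i) *\<^sub>R h i)" by (rule arg_cong[OF linear_basis_expand[OF assms]])
  also have "\<dots> \<le> (\<Sum>b\<in>Basis. norm u * norm (h b))"
    by (rule sum_norm_le) (auto intro!: mult_right_mono Basis_le_norm)
  finally show ?thesis by (simp add: sum_distrib_left)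
qed

section \<open>Constant maps that respect the splitting\<close>

context kaehler_chart
begin

text \<open>The commutator with \<open>\<omega>\<close> satisfies a homogeneous linear system and
  vanishes at \<open>y\<close>, hence near \<open>y\<close>. Only where it vanishes does the
  commutator with \<open>E\<close> satisfy a homogeneous system as well, so the two are treated in
  this order.\<close>

lemma projection_propagates:
  assumes W: "open W" "W \<subseteq> U" "y \<in> W"
    and inv: "\<And>z u v. z \<in> W \<Longrightarrow> \<alpha> z (J z u) (J z v) = \<alpha> z u v"
    and P: "linear P" "\<And>u \<xi>. P (\<omega> y u \<xi>) = \<omega> y u (P \<xi>)" "\<And>\<xi>. P (E y \<xi>) = E y (P \<xi>)"
  obtains r where "r > 0" "ball y r \<subseteq> W" "\<And>z \<xi>. z \<in> ball y r \<Longrightarrow> P (E z \<xi>) = E z (P \<xi>)"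
proof -
  have bP: "bounded_linear P" using P(1) by (simp add: linear_conv_bounded_linear)
  define \<Delta> where "\<Delta> z u \<xi> = P (\<omega> z u \<xi>) - \<omega> z u (P \<xi>)" for z u \<xi>
  define Wn where "Wn z = (\<Sum>(i, b)\<in>Basis \<times> Basis. norm (\<omega> z i b))" for z
  define G where "G z = (\<Sum>(i, j)\<in>Basis \<times> Basis. norm (\<Gamma> z i j))" for z
  have Wn0: "Wn z \<ge> 0" for z
    unfolding Wn_def by (auto intro!: sum_nonneg)
  have bil: "bilinear (\<Delta> z)" if z: "z \<in> U" for z
    unfolding bilinear_def \<Delta>_def
    by (intro conjI allI linearI)
      (simp_all add: bilinear_ladd[OF \<omega>_bilinear[OF z]] bilinear_radd[OF \<omega>_bilinear[OF z]]
        bilinear_lmul[OF \<omega>_bilinear[OF z]] bilinear_rmul[OF \<omega>_bilinear[OF z]]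
        linear_add[OF P(1)] linear_scale[OF P(1)] algebra_simps)
  have \<omega>le: "norm (\<omega> z u \<xi>) \<le> norm u * norm \<xi> * Wn z" if "z \<in> U" for z u \<xi>
    unfolding Wn_def by (rule bilinear_norm_le[OF \<omega>_bilinear[OF that]])
  have \<Delta>le: "norm (\<Delta> z u \<xi>) \<le> norm u * norm \<xi> * (\<Sum>(i, b)\<in>Basis \<times> Basis. norm (\<Delta> z i b))" if "z \<in> U" for z u \<xi>
    by (rule bilinear_norm_le[OF bil[OF that]])
  have P\<omega>: "smooth_on (\<lambda>z. P (\<omega> z u \<xi>)) U" for u \<xi>
    by (rule smooth_on_linear[OF bP U \<omega>_smooth])
  have cont\<omega>: "continuous_on W (\<lambda>z. \<omega> z i b)" for i b
    using smooth_on_imp_continuous_on[OF smooth_on_subset[OF \<omega>_smooth W(2)]] .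
  have contWn: "continuous_on W Wn"
    unfolding Wn_def case_prod_unfold by (intro continuous_on_sum continuous_on_norm cont\<omega>)
  have contG: "continuous_on W G"
    unfolding G_def case_prod_unfold
    by (intro continuous_on_sum continuous_on_norm smooth_on_imp_continuous_on[OF smooth_on_subset[OF \<Gamma>_smooth W(2)]])
  define h where "h = (\<lambda>(i, b) z. \<Delta> z i b)"
  \<comment> \<open>The derivative of \<open>\<Delta>\<close> given by
    \<open>\<omega>_derivative\<close>, with
    \<open>P \<omega> \<omega> - \<omega> \<omega> P\<close> rewritten as
    \<open>\<Delta> \<omega> + \<omega> \<Delta>\<close>.\<close>
  define h' where "h' = (\<lambda>(i, b) z v. \<Delta> z (\<Gamma> z v i) b + \<Delta> z v (\<omega> z i b) + \<omega> z v (\<Delta> z i b) - \<Delta> z i (\<omega> z v b) - \<omega> z i (\<Delta> z v b))"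
  have der: "(h ib has_derivative h' ib z) (at z)" if z: "z \<in> W" for ib z
  proof -
    obtain i b where ib: "ib = (i, b)" by fastforce
    have zU: "z \<in> U" using z W by blast
    have "smooth_on (\<lambda>z. \<Delta> z i b) U" unfolding \<Delta>_def by (intro smooth_on_diff U P\<omega> \<omega>_smooth)
    from smooth_on_has_derivative[OF this zU]
    have d: "((\<lambda>z. \<Delta> z i b) has_derivative frechet_derivative (\<lambda>z. \<Delta> z i b) (at z)) (at z)" .
    have "frechet_derivative (\<lambda>z. \<Delta> z i b) (at z) v = h' ib z v" for v
    proof -
      have "frechet_derivative (\<lambda>z. \<Delta> z i b) (at z) v =
        P (frechet_derivative (\<lambda>z. \<omega> z i b) (at z) v) - frechet_derivative (\<lambda>z. \<omega> z i (P b)) (at z) v"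
        unfolding \<Delta>_def
        by (simp add: frechet_derivative_diff[OF P\<omega> \<omega>_smooth zU] frechet_derivative_linear[OF bP \<omega>_smooth zU])
      then show ?thesis
        by (simp add: \<omega>_derivative[OF W(1,2) z inv] linear_add[OF P(1)] linear_diff[OF P(1)] ib h'_def \<Delta>_def
            bilinear_rsub[OF \<omega>_bilinear[OF zU]])
    qed
    then have "frechet_derivative (\<lambda>z. \<Delta> z i b) (at z) = h' ib z" by blast
    then show ?thesis using d by (simp add: ib h_def)
  qed
  have bound: "norm (h' ib z v) \<le> (G z + 4 * Wn z) * (\<Sum>j\<in>Basis \<times> Basis. norm (h j z))"
    if I: "ib \<in> Basis \<times> Basis" and z: "z \<in> W" and v: "v \<in> Basis" for ib z v
  proof -
    obtain i b where ib: "ib = (i, b)" by fastforce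
    have i: "i \<in> Basis" "b \<in> Basis" using I ib by auto
    have zU: "z \<in> U" using z W by blast
    let ?T = "\<Sum>j\<in>Basis \<times> Basis. norm (h j z)"
    have T: "(\<Sum>(i, b)\<in>Basis \<times> Basis. norm (\<Delta> z i b)) = ?T" by (simp add: h_def case_prod_unfold)
    have T0: "?T \<ge> 0" by (rule sum_nonneg) simp
    have w1: "norm (\<omega> z a c) \<le> Wn z" if "a \<in> Basis" "c \<in> Basis" for a c using \<omega>le[OF zU, of a c] that by simp
    have d1: "norm (\<Delta> z a c) \<le> ?T" if "a \<in> Basis" "c \<in> Basis" for a c using \<Delta>le[OF zU, of a c] that T by simp
    have "norm (\<Gamma> z v i) \<le> G z" unfolding G_def
      using member_le_sum[of "(v, i)" "Basis \<times> Basis" "\<lambda>(i, j). norm (\<Gamma> z i j)"] v i by auto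
    then have 1: "norm (\<Delta> z (\<Gamma> z v i) b) \<le> G z * ?T"
      using \<Delta>le[OF zU, of "\<Gamma> z v i" b] i T0 unfolding T by (simp add: mult_right_mono order_trans)
    have 2: "norm (\<Delta> z a (\<omega> z a' c)) \<le> Wn z * ?T" if "a \<in> Basis" "a' \<in> Basis" "c \<in> Basis" for a a' c
      using \<Delta>le[OF zU, of a "\<omega> z a' c"] w1[of a' c] T0 that unfolding T by (simp add: mult_right_mono order_trans)
    have 3: "norm (\<omega> z a (\<Delta> z a' c)) \<le> Wn z * ?T" if "a \<in> Basis" "a' \<in> Basis" "c \<in> Basis" for a a' c
    proof -
      have "norm (\<omega> z a (\<Delta> z a' c)) \<le> norm (\<Delta> z a' c) * Wn z" using \<omega>le[OF zU, of a "\<Delta> z a' c"] that by simp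
      also have "\<dots> \<le> ?T * Wn z" using d1[of a' c] that Wn0 by (intro mult_right_mono) auto
      finally show ?thesis by (simp add: mult.commute)
    qed
    have tri: "norm (a + b + c - d - e) \<le> norm a + norm b + norm c + norm d + norm e" for a b c d e :: 'w
      by (smt (verit) norm_triangle_ineq norm_triangle_ineq4)
    have "norm (h' ib z v) \<le> G z * ?T + Wn z * ?T + Wn z * ?T + Wn z * ?T + Wn z * ?T"
      unfolding h'_def ib prod.case
      by (rule order_trans[OF tri]) (intro add_mono 1 2 3 v i)
    then show ?thesis by (simp add: algebra_simps)
  qed
  obtain r1 where r1: "r1 > 0" "ball y r1 \<subseteq> W" "\<And>ib z. ib \<in> Basis \<times> Basis \<Longrightarrow> z \<in> ball y r1 \<Longrightarrow> h ib z = 0"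
  proof (rule vanishing_near[of W y "Basis \<times> Basis" h h' "\<lambda>z. G z + 4 * Wn z"])
    show "continuous_on W (\<lambda>z. G z + 4 * Wn z)" using contG contWn by (intro continuous_intros)
    show "h ib y = 0" for ib using P(2) by (simp add: h_def \<Delta>_def case_prod_unfold)
  qed (use W der bound that in auto)
  have \<Delta>0: "P (\<omega> z u \<xi>) = \<omega> z u (P \<xi>)" if z: "z \<in> ball y r1" for z u \<xi>
  proof -
    have zU: "z \<in> U" using z r1 W by blast
    have "(\<Sum>(i, b)\<in>Basis \<times> Basis. norm (\<Delta> z i b)) = 0"
      using r1(3)[OF _ z] by (intro sum.neutral) (auto simp: h_def)
    then show ?thesis using \<Delta>le[OF zU, of u \<xi>] by (simp add: \<Delta>_def)
  qed
  define k where "k b z = P (E z b) - E z (P b)" for b z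
  \<comment> \<open>The derivative of \<open>k b\<close> on \<open>ball y r1\<close>, where
    \<open>P\<close> already commutes with \<open>\<omega>\<close>.\<close>
  define k' where "k' b z v = \<omega> z v (k b z) - k (\<omega> z v b) z" for b z v
  have PE: "smooth_on (\<lambda>z. P (E z \<xi>)) U" for \<xi>
    by (rule smooth_on_linear[OF bP U E_smooth])
  have linE: "linear (\<lambda>b. k b z)" if z: "z \<in> U" for z
    unfolding k_def by (intro linearI)
      (simp_all add: linear_add[OF E_linear[OF z]] linear_scale[OF E_linear[OF z]] linear_add[OF P(1)] linear_scale[OF P(1)] algebra_simps)
  obtain r where r: "r > 0" "ball y r \<subseteq> ball y r1" "\<And>b z. b \<in> Basis \<Longrightarrow> z \<in> ball y r \<Longrightarrow> k b z = 0"
  proof (rule vanishing_near[of "ball y r1" y Basis k k' "\<lambda>z. 2 * Wn z"])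
    show "continuous_on (ball y r1) (\<lambda>z. 2 * Wn z)"
      using continuous_on_subset[OF contWn r1(2)] by (intro continuous_intros)
    show "k b y = 0" for b using P(3) by (simp add: k_def)
    show "(k b has_derivative k' b z) (at z)" if z: "z \<in> ball y r1" for b z
    proof -
      have zU: "z \<in> U" using z r1 W by blast
      have sm: "smooth_on (k b) U" unfolding k_def by (intro smooth_on_diff U PE E_smooth)
      have "frechet_derivative (k b) (at z) v = k' b z v" for v
      proof -
        have "frechet_derivative (k b) (at z) v =
          P (frechet_derivative (\<lambda>z. E z b) (at z) v) - frechet_derivative (\<lambda>z. E z (P b)) (at z) v"
          unfolding k_def by (simp add: frechet_derivative_diff[OF PE E_smooth zU] frechet_derivative_linear[OF bP E_smooth zU])
        then show ?thesis
          by (simp add: E_derivative[OF zU] linear_diff[OF P(1)] \<Delta>0[OF z] k'_def k_def bilinear_rsub[OF \<omega>_bilinear[OF zU]])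
      qed
      then have "frechet_derivative (k b) (at z) = k' b z" by blast
      then show ?thesis using smooth_on_has_derivative[OF sm zU] by simp
    qed
    show "norm (k' b z v) \<le> 2 * Wn z * (\<Sum>j\<in>Basis. norm (k j z))"
      if b: "b \<in> Basis" and z: "z \<in> ball y r1" and v: "v \<in> Basis" for b z v
    proof -
      have zU: "z \<in> U" using z r1 W by blast
      let ?T = "\<Sum>j\<in>Basis. norm (k j z)"
      have T0: "?T \<ge> 0" by (rule sum_nonneg) simp
      have kT: "norm (k b z) \<le> ?T" using b by (intro member_le_sum) auto
      have "norm (\<omega> z v (k b z)) \<le> norm (k b z) * Wn z" using \<omega>le[OF zU, of v "k b z"] v by simp
      also have "\<dots> \<le> ?T * Wn z" using kT Wn0 by (intro mult_right_mono)
      finally have 1: "norm (\<omega> z v (k b z)) \<le> ?T * Wn z" .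
      have "norm (k (\<omega> z v b) z) \<le> norm (\<omega> z v b) * ?T" by (rule linear_norm_le[OF linE[OF zU]])
      also have "\<dots> \<le> Wn z * ?T" using \<omega>le[OF zU, of v b] v b T0 by (intro mult_right_mono) auto
      finally have 2: "norm (k (\<omega> z v b) z) \<le> Wn z * ?T" .
      have "norm (k' b z v) \<le> norm (\<omega> z v (k b z)) + norm (k (\<omega> z v b) z)"
        unfolding k'_def by (rule norm_triangle_ineq4)
      then show ?thesis using 1 2 by (simp add: algebra_simps)
    qed
  qed (use r1 that in auto)
  show thesis
  proof (rule that[OF r(1)])
    show "ball y r \<subseteq> W" using r r1 by blast
    fix z \<xi> assume z: "z \<in> ball y r"
    then have zU: "z \<in> U" using r r1 W by blast
    have "(\<Sum>b\<in>Basis. norm (k b z)) = 0" using r(3)[OF _ z] by (intro sum.neutral) auto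
    then have "k \<xi> z = 0" using linear_norm_le[OF linE[OF zU], of \<xi>] by simp
    then show "P (E z \<xi>) = E z (P \<xi>)" by (simp add: k_def)
  qed
qed

section \<open>The normal space at the points of a chart\<close>

definition N :: "'e \<Rightarrow> 'w set" where "N z = {x \<in> R. \<forall>u\<in>range (dF z). B x u = 0}"

lemma R_nondegenerate:
  assumes z: "z \<in> U" and u: "u \<in> R" "\<And>w. w \<in> R \<Longrightarrow> B w u = 0"
  shows "u = 0"
  using lor_timelike_complement[OF e0, of "F z" u] F_hyperboloid[OF z] u(2)[OF F_R[OF z]] u(2)[OF u(1)] by force

text \<open>The dimension \<open>p + 1\<close> of the normal space is the codimension in hyperbolic
  space plus one for the position vector; the axioms on \<open>\<alpha>\<close> are the structure
  equations above.\<close>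

lemma kaehler_point: assumes z: "z \<in> U" shows "kaehler_point (g z) (J z) B (N z) (F z) (\<alpha> z) n p"
proof (rule kaehler_point.intro[OF hermitian[OF z]], rule kaehler_point_axioms.intro)
  show "bilinear B" by (rule lor_bilinear)
  show "B x y = B y x" for x y by (rule lor_sym)
  show sub: "subspace (N z)"
  proof -
    have "subspace {x. \<forall>u\<in>range (dF z). B x u = 0}" by (auto simp: subspace_def B_simps)
    moreover have "N z = R \<inter> {x. \<forall>u\<in>range (dF z). B x u = 0}" by (auto simp: N_def)
    ultimately show ?thesis using R(1) by (simp add: subspace_inter)
  qed
  have "dim (N z) + dim (range (dF z)) = dim R"
    unfolding N_def using dF_R[OF z] R_nondegenerate[OF z]
    by (intro dim_form_complement[OF lor_bilinear R(1)] linear_subspace_image[OF dF_linear[OF z]]) auto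
  moreover have "dim (range (dF z)) = 2 * n"
  proof -
    have "x = 0" if "dF z x = 0" for x
      using immersion[OF z, of x] that by (force simp: dF_def B_simps)
    then have "inj (dF z)" using linear_injective_0[OF dF_linear[OF z]] by blast
    then show ?thesis using dim_image_eq[OF dF_linear[OF z], of UNIV] dim_e by (simp add: inj_on_subset)
  qed
  ultimately show "dim (N z) = Suc p" using R(2) by simp
  show "F z \<in> N z" using F_R[OF z] F_normal[OF z] by (auto simp: N_def)
  show "B (F z) (F z) = - 1" by (rule F_hyperboloid[OF z])
  show "0 < B x x" if "x \<in> N z" "B (F z) x = 0" "x \<noteq> 0" for x
    using lor_timelike_complement[OF e0 _ that(2,3)] F_hyperboloid[OF z] by simp
  show "bilinear (\<alpha> z)" by (rule \<alpha>_bilinear[OF z])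
  show "\<alpha> z u v = \<alpha> z v u" for u v by (rule \<alpha>_sym[OF z])
  show "\<alpha> z u v \<in> N z" for u v using \<alpha>_R[OF z] \<alpha>_normal[OF z] by (auto simp: N_def)
  show "B (\<alpha> z u v) (F z) = - g z u v" for u v by (rule \<alpha>_F[OF z])
  show "B (\<alpha> z u (J z v)) (\<alpha> z w t) - B (\<alpha> z w (J z v)) (\<alpha> z u t) + B (\<alpha> z u v) (\<alpha> z w (J z t))
      - B (\<alpha> z w v) (\<alpha> z u (J z t)) = 0" for u v w t by (rule kaehler_identity[OF z])
  show "DIM('e) = 2 * n" by (rule dim_e)
  show "p < n" by (rule p_less)
qed

end

section \<open>Local product structure\<close>

lemma dim_span_UN_le:
  fixes S :: "'i \<Rightarrow> 'a::euclidean_space set"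
  assumes "finite I" shows "dim (span (\<Union>i\<in>I. S i)) \<le> (\<Sum>i\<in>I. dim (S i))"
proof -
  have "\<exists>B. B \<subseteq> S i \<and> finite B \<and> S i \<subseteq> span B \<and> card B = dim (S i)" for i
    using basis_exists[of "S i"] independent_imp_finite by metis
  then obtain B where B: "\<And>i. finite (B i)" "\<And>i. S i \<subseteq> span (B i)" "\<And>i. card (B i) = dim (S i)" by metis
  have "span (\<Union>i\<in>I. S i) \<subseteq> span (\<Union>i\<in>I. B i)"
  proof (rule span_minimal)
    show "(\<Union>i\<in>I. S i) \<subseteq> span (\<Union>i\<in>I. B i)"
      using B(2) span_mono[of "B _" "\<Union>i\<in>I. B i"] by blast
  qed simp
  then have "dim (span (\<Union>i\<in>I. S i)) \<le> card (\<Union>i\<in>I. B i)"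
    using assms B(1) by (intro dim_le_card) auto
  also have "\<dots> \<le> (\<Sum>i\<in>I. card (B i))" by (rule card_UN_le[OF assms])
  finally show ?thesis by (simp add: B(3))
qed

text \<open>An orthogonal splitting of \<open>R\<close> by constant projections, one block for each
  factor surface; \<open>k0\<close> marks the block of the negative constant. An upper bound 3 for
  the block dimensions suffices, since a count of tangent dimensions supplies the lower bound used
  later.\<close>

locale lorentz_splitting =
  fixes e0 :: "'w::euclidean_space" and R :: "'w set" and n :: nat
    and P :: "nat \<Rightarrow> 'w \<Rightarrow> 'w" and c :: "nat \<Rightarrow> real" and k0 :: nat
  assumes P_linear: "j < n \<Longrightarrow> linear (P j)"
    and P_sym: "j < n \<Longrightarrow> lor e0 (P j x) y = lor e0 x (P j y)"
    and P_proj: "i < n \<Longrightarrow> j < n \<Longrightarrow> P i (P j x) = (if i = j then P j x else 0)"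
    and P_R: "j < n \<Longrightarrow> P j x \<in> R"
    and P_sum: "x \<in> R \<Longrightarrow> (\<Sum>j<n. P j x) = x"
    and P_dim: "j < n \<Longrightarrow> dim (range (P j)) \<le> 3"
    and k0: "k0 < n"
    and c: "j < n \<Longrightarrow> if j = k0 then c j < 0 else c j > 0"

context kaehler_chart
begin

lemma first_order_orthogonal:
  assumes spl: "lorentz_splitting e0 R n P c k0" and y: "y \<in> U"
    and c3: "\<And>j. j < n \<Longrightarrow> B (P j (F y)) (F y) = 1 / c j" and ij: "i < n" "j < n"
  shows "B (P i (F y)) (P j (F y)) = (if i = j then 1 / c j else 0)"
proof -
  interpret sp: lorentz_splitting e0 R n P c k0 by (rule spl)
  show ?thesis using c3[OF ij(2)] ij by (simp add: sp.P_sym sp.P_proj B_simps)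
qed

text \<open>The vectors \<open>P j (F y)\<close> are normal, mutually orthogonal and not null. There
  are \<open>n = Suc p\<close> of them, so they form a basis of the normal space.\<close>

lemma normal_eq_zero:
  assumes spl: "lorentz_splitting e0 R n P c k0" and np: "n = Suc p" and y: "y \<in> U"
    and c1: "\<And>j u. j < n \<Longrightarrow> B (P j (F y)) (dF y u) = 0"
    and c3: "\<And>j. j < n \<Longrightarrow> B (P j (F y)) (F y) = 1 / c j"
    and x: "x \<in> N y" "\<And>j. j < n \<Longrightarrow> B x (P j (F y)) = 0"
  shows "x = 0"
proof -
  interpret kp: kaehler_point "g y" "J y" B "N y" "F y" "\<alpha> y" n p by (rule kaehler_point[OF y])
  interpret sp: lorentz_splitting e0 R n P c k0 by (rule spl)
  have c0: "c j \<noteq> 0" if "j < n" for j using sp.c[OF that] by (auto split: if_splits)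
  define f where "f j = P j (F y)" for j
  have Bff: "B (f i) (f j) = (if i = j then 1 / c j else 0)" if "i < n" "j < n" for i j
    unfolding f_def by (rule first_order_orthogonal[OF spl y c3 that])
  have fN: "f j \<in> N y" if "j < n" for j
    using sp.P_R[OF that] c1[OF that] by (auto simp: N_def f_def)
  have inj_f: "inj_on f {..<n}"
  proof (rule inj_onI)
    fix i j assume a: "i \<in> {..<n}" "j \<in> {..<n}" "f i = f j"
    show "i = j"
    proof (rule ccontr)
      assume "i \<noteq> j"
      then show False using Bff[of i j] Bff[of j j] a c0[of j] by simp
    qed
  qed
  have "independent (f ` {..<n})"
  proof (rule independent_if_scalars_zero)
    fix s x assume s: "(\<Sum>x\<in>f ` {..<n}. s x *\<^sub>R x) = 0" and "x \<in> f ` {..<n}"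
    then obtain j where j: "j < n" "x = f j" by blast
    have "(\<Sum>i<n. s (f i) *\<^sub>R f i) = 0" using s by (simp add: sum.reindex[OF inj_f])
    then have "0 = B (\<Sum>i<n. s (f i) *\<^sub>R f i) (f j)" by (simp add: B_simps)
    also have "\<dots> = (\<Sum>i<n. s (f i) * B (f i) (f j))"
      by (simp add: linear_sum[OF kp.B_linear_left] B_simps)
    also have "\<dots> = (\<Sum>i<n. if i = j then s (f j) * (1 / c j) else 0)"
      using Bff j by (intro sum.cong) auto
    finally show "s x = 0" using j c0 by simp
  qed simp
  then have "dim (span (f ` {..<n})) = card (f ` {..<n})" by (rule dim_span_eq_card_independent)
  then have "dim (span (f ` {..<n})) = n" by (simp only: card_image[OF inj_f] card_lessThan)
  then have spanN: "span (f ` {..<n}) = N y"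
    using fN np kp.N by (intro subspace_dim_equal span_minimal) auto
  show ?thesis
  proof (rule kp.B_nondegenerate[OF x(1)])
    fix w assume "w \<in> N y"
    moreover have "span (f ` {..<n}) \<subseteq> {w. B x w = 0}"
      using x(2) by (intro span_minimal) (auto simp: subspace_def B_simps f_def)
    ultimately show "B x w = 0" using spanN by blast
  qed
qed

text \<open>The hypotheses on \<open>y\<close> are the conditions of order at most two that \<open>B (P j F) F = 1 / c j\<close>
  imposes at a point; they persist at limit points.\<close>

theorem local_product:
  assumes spl: "lorentz_splitting e0 R n P c k0" and np: "n = Suc p" and y: "y \<in> U"
    and c1: "\<And>j u. j < n \<Longrightarrow> B (P j (F y)) (dF y u) = 0"
    and c2: "\<And>j u v. j < n \<Longrightarrow> B (P j (F y)) (ddF y u v) = - B (P j (dF y u)) (dF y v)"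
    and c3: "\<And>j. j < n \<Longrightarrow> B (P j (F y)) (F y) = 1 / c j"
  obtains r where "r > 0" "ball y r \<subseteq> U"
    "\<And>z j. z \<in> ball y r \<Longrightarrow> j < n \<Longrightarrow> B (P j (F z)) (F z) = 1 / c j"
proof -
  interpret kp: kaehler_point "g y" "J y" B "N y" "F y" "\<alpha> y" n p by (rule kaehler_point[OF y])
  interpret sp: lorentz_splitting e0 R n P c k0 by (rule spl)
  have c0: "c j \<noteq> 0" if "j < n" for j using sp.c[OF that] by (auto split: if_splits)
  define f where "f j = P j (F y)" for j
  have Bff: "B (f i) (f j) = (if i = j then 1 / c j else 0)" if "i < n" "j < n" for i j
    unfolding f_def by (rule first_order_orthogonal[OF spl y c3 that])
  have fN: "f j \<in> N y" if "j < n" for j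
    using sp.P_R[OF that] c1[OF that] by (auto simp: N_def f_def)
  have zeroN: "x = 0" if "x \<in> N y" "\<And>j. j < n \<Longrightarrow> B x (f j) = 0" for x
    by (rule normal_eq_zero[OF spl np y c1 c3]) (use that in \<open>simp_all add: f_def\<close>)
  have Bsum: "B (\<Sum>i<n. a i *\<^sub>R f i) (f j) = a j / c j" if "j < n" for a j
  proof -
    have "B (\<Sum>i<n. a i *\<^sub>R f i) (f j) = (\<Sum>i<n. a i * B (f i) (f j))"
      by (simp add: linear_sum[OF kp.B_linear_left] B_simps)
    also have "\<dots> = (\<Sum>i<n. if i = j then a j / c j else 0)"
      using Bff that by (intro sum.cong) auto
    finally show ?thesis using that by simp
  qed
  have expN: "x = (\<Sum>j<n. (c j * B x (f j)) *\<^sub>R f j)" if "x \<in> N y" for x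
  proof -
    have "x - (\<Sum>j<n. (c j * B x (f j)) *\<^sub>R f j) = 0"
    proof (rule zeroN)
      show "x - (\<Sum>j<n. (c j * B x (f j)) *\<^sub>R f j) \<in> N y"
        using that fN kp.N(1) by (intro subspace_diff subspace_sum subspace_scale) auto
      show "B (x - (\<Sum>j<n. (c j * B x (f j)) *\<^sub>R f j)) (f j) = 0" if "j < n" for j
        using Bsum[OF that, of "\<lambda>j. c j * B x (f j)"] c0[OF that] by (simp add: B_simps)
    qed
    then show ?thesis by simp
  qed
  \<comment> \<open>By \<open>c2\<close> the product of \<open>\<alpha>\<close> with
    \<open>f j\<close> is \<open>- h j\<close>, so the splitting determines the second fundamental
    form at \<open>y\<close>.\<close>
  define h where "h j u v = B (P j (dF y u)) (dF y v)" for j u v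
  have \<alpha>f: "B (\<alpha> y u v) (f j) = - h j u v" if "j < n" for j u v
    using c2[OF that, of u v] c1[OF that] by (simp add: \<alpha>_def B_simps f_def h_def lor_sym[of e0 _ "P j (F y)"])
  have \<alpha>_exp: "\<alpha> y u v = (\<Sum>j<n. (- (c j * h j u v)) *\<^sub>R f j)" for u v
    using expN[OF kp.\<alpha>_N, of u v] \<alpha>f by simp
  define \<pi> where "\<pi> j u = \<tau> y (P j (dF y u))" for j u
  \<comment> \<open>By symmetry \<open>P j\<close> can be moved onto \<open>f i\<close>, where it
    gives \<open>f j\<close> or 0; these are normal by \<open>c1\<close>, so \<open>P j\<close>
    preserves the tangent space.\<close>
  have tang: "P j (dF y u) = dF y (\<pi> j u)" if j: "j < n" for j u
  proof -
    have "\<nu> y (P j (dF y u)) = 0"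
    proof (rule zeroN)
      show "\<nu> y (P j (dF y u)) \<in> N y"
        using \<nu>_normal[OF y] sp.P_R[OF j] dF_R[OF y] R(1) by (auto simp: N_def \<nu>_def intro: subspace_diff)
      fix i assume i: "i < n"
      have "B (dF y t) (f i) = 0" for t using c1[OF i] by (simp add: f_def lor_sym)
      then show "B (\<nu> y (P j (dF y u))) (f i) = 0"
        using i j by (simp add: \<nu>_def B_simps f_def sp.P_sym[OF j] sp.P_proj)
    qed
    then show ?thesis by (simp add: \<nu>_def \<pi>_def)
  qed
  have hg: "h j u v = g y (\<pi> j u) v" if "j < n" for j u v
    by (simp add: h_def tang[OF that] g_def)
  have h_sym: "h j u v = h j v u" if "j < n" for j u v
    by (simp add: h_def sp.P_sym[OF that] lor_sym[of e0 "dF y u"])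
  have h\<pi>: "h j u (\<pi> i v) = (if i = j then h j u v else 0)" if "i < n" "j < n" for i j u v
    using that by (simp add: h_def flip: tang) (simp add: sp.P_sym sp.P_proj B_simps)
  have h_pos: "h j u u = g y (\<pi> j u) (\<pi> j u)" if "j < n" for j u
    using h\<pi>[OF that that, of u u] hg[OF that] by simp
  have h_sum: "(\<Sum>j<n. h j u v) = g y u v" for u v
  proof -
    have "B (\<Sum>j<n. P j (dF y u)) (dF y v) = g y u v" by (simp add: sp.P_sum dF_R[OF y] g_def)
    then show ?thesis by (simp add: linear_sum[OF kp.B_linear_left] h_def)
  qed
  have PE: "P j (E y \<xi>) = E y (P j \<xi>)" if j: "j < n" for j \<xi>
  proof (rule eq_by_parts[OF y])
    show "\<nu> y (P j (E y \<xi>)) = \<nu> y (E y (P j \<xi>))" by (simp add: E_def tang[OF j] \<nu>_dF[OF y])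
    show "B (P j (E y \<xi>)) (dF y t) = B (E y (P j \<xi>)) (dF y t)" for t
    proof -
      have BE: "B (E y x) (dF y t) = B x (dF y t)" for x t using \<tau>[OF y, of x t] by (simp add: E_def g_def)
      show ?thesis by (simp add: BE sp.P_sym[OF j] tang[OF j])
    qed
  qed
  have P\<alpha>: "P j (\<alpha> y u v) = \<alpha> y u (\<pi> j v)" if j: "j < n" for j u v
  proof -
    have Pf: "P j (f i) = (if i = j then f j else 0)" if "i < n" for i
      using sp.P_proj[OF j that] by (simp add: f_def)
    have "P j (\<alpha> y u v) = (\<Sum>i<n. (- (c i * h i u v)) *\<^sub>R P j (f i))"
      unfolding \<alpha>_exp by (simp add: linear_sum[OF sp.P_linear[OF j]] linear_neg[OF sp.P_linear[OF j]] linear_scale[OF sp.P_linear[OF j]])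
    also have "\<dots> = (\<Sum>i<n. (- (c i * h i u (\<pi> j v))) *\<^sub>R f i)"
      using Pf h\<pi>[OF j] by (intro sum.cong) auto
    finally show ?thesis by (simp add: \<alpha>_exp)
  qed
  have P\<omega>: "P j (\<omega> y u \<xi>) = \<omega> y u (P j \<xi>)" if j: "j < n" for j u \<xi>
  proof (rule eq_by_parts[OF y])
    have \<nu>P: "\<nu> y (P j x) = P j (\<nu> y x)" for x
      using PE[OF j, of x] by (simp add: \<nu>_def E_def linear_diff[OF sp.P_linear[OF j]])
    have \<tau>P: "\<tau> y (P j \<xi>) = \<pi> j (\<tau> y \<xi>)"
      using arg_cong[OF PE[OF j, of \<xi>], of "\<tau> y"] by (simp add: E_def \<tau>_dF[OF y] \<pi>_def)
    show "\<nu> y (P j (\<omega> y u \<xi>)) = \<nu> y (\<omega> y u (P j \<xi>))"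
      by (simp add: \<nu>P \<nu>_\<omega>[OF y] P\<alpha>[OF j] \<tau>P)
    show "B (P j (\<omega> y u \<xi>)) (dF y t) = B (\<omega> y u (P j \<xi>)) (dF y t)" for t
      by (simp add: sp.P_sym[OF j] tang[OF j] B_\<omega>[OF y] flip: P\<alpha>[OF j])
  qed
  have \<pi>_linear: "linear (\<pi> j)" if j: "j < n" for j
    unfolding \<pi>_def
    by (intro linearI) (simp_all add: linear_add[OF \<tau>_linear[OF y]] linear_scale[OF \<tau>_linear[OF y]]
        linear_add[OF sp.P_linear[OF j]] linear_scale[OF sp.P_linear[OF j]] linear_add[OF dF_linear[OF y]] linear_scale[OF dF_linear[OF y]])
  \<comment> \<open>The tangent vectors of a block are orthogonal to the non-null vector
    \<open>f j\<close> in a space of dimension at most 3.\<close>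
  have dim\<pi>: "dim (range (\<pi> j)) \<le> 2" if j: "j < n" for j
  proof -
    let ?S = "{x \<in> range (P j). B x (f j) = 0}"
    have subP: "subspace (range (P j))" by (simp add: linear_subspace_image sp.P_linear[OF j])
    have subS: "subspace ?S" using subP by (auto simp: subspace_def B_simps)
    have "f j \<in> range (P j)" "f j \<notin> ?S" using Bff[OF j j] c0[OF j] by (auto simp: f_def)
    then have "?S \<subset> range (P j)" by blast
    then have "dim ?S < dim (range (P j))"
      using subP subS by (intro dim_psubset) (simp add: span_eq_iff[THEN iffD2])
    then have S2: "dim ?S \<le> 2" using sp.P_dim[OF j] by simp
    have "range (\<pi> j) \<subseteq> \<tau> y ` ?S"
    proof (intro image_subsetI)
      fix u
      have "B (P j (dF y u)) (f j) = 0"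
        using c1[OF j, of u] sp.P_sym[OF j, of "dF y u" "f j"] sp.P_proj[OF j j] lor_sym[of e0 "dF y u"] by (simp add: f_def)
      then show "\<pi> j u \<in> \<tau> y ` ?S" unfolding \<pi>_def by blast
    qed
    then have "dim (range (\<pi> j)) \<le> dim (\<tau> y ` ?S)" by (rule dim_subset)
    also have "\<dots> \<le> dim ?S" by (rule dim_image_le[OF \<tau>_linear[OF y]])
    finally show ?thesis using S2 by simp
  qed
  have \<pi>_sum: "(\<Sum>j<n. \<pi> j u) = u" for u
  proof -
    have "\<tau> y (\<Sum>j<n. P j (dF y u)) = u" by (simp add: sp.P_sum dF_R[OF y] \<tau>_dF[OF y])
    then show ?thesis by (simp add: linear_sum[OF \<tau>_linear[OF y]] \<pi>_def)
  qed
  have "u \<in> span (\<Union>j<n. range (\<pi> j))" for u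
  proof -
    have "(\<Sum>j<n. \<pi> j u) \<in> span (\<Union>j<n. range (\<pi> j))" by (intro span_sum span_base) blast
    then show ?thesis by (simp add: \<pi>_sum)
  qed
  then have "span (\<Union>j<n. range (\<pi> j)) = UNIV" by blast
  then have total: "2 * n \<le> (\<Sum>j<n. dim (range (\<pi> j)))"
    using dim_span_UN_le[of "{..<n}" "\<lambda>j. range (\<pi> j)"] dim_e by simp
  \<comment> \<open>The \<open>n\<close> blocks together fill \<open>2 * n\<close> tangent
    dimensions and none contributes more than 2.\<close>
  have dimk: "dim (range (\<pi> k0)) = 2"
  proof (rule ccontr)
    assume "dim (range (\<pi> k0)) \<noteq> 2"
    then have "dim (range (\<pi> k0)) < 2" using dim\<pi>[OF sp.k0] by simp
    then have "(\<Sum>j<n. dim (range (\<pi> j))) < (\<Sum>j<n. 2)"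
      using dim\<pi> sp.k0 by (intro sum_strict_mono_ex1) auto
    then show False using total by simp
  qed
  \<comment> \<open>The substitute for the space \<open>V\<close> of the theorem at a point without
    any curvature assumption.\<close>
  define V where "V = {u \<in> UNIV. \<forall>w\<in>range (\<pi> k0). g y u w = 0}"
  have dimV: "dim V = 2 * p"
  proof -
    have "dim V + dim (range (\<pi> k0)) = dim (UNIV :: 'e set)"
      unfolding V_def using kp.g_eqI[of _ 0] kp.g_sym
      by (intro dim_form_complement kp.g_bilinear subspace_UNIV linear_subspace_image[OF \<pi>_linear[OF sp.k0]])
        (auto simp: kp.g_simps)
    then show ?thesis using dimk dim_e np by simp
  qed
  have subV: "subspace V" unfolding V_def by (auto simp: subspace_def kp.g_simps)
  have Vh: "h k0 u v = 0" if "v \<in> V" for u v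
    using that hg[OF sp.k0, of u v] kp.g_sym by (auto simp: V_def)
  have \<alpha>k: "\<alpha> y u t = (- (c k0 * g y u t)) *\<^sub>R f k0" if u: "u \<in> range (\<pi> k0)" for u t
  proof -
    obtain a where a: "u = \<pi> k0 a" using u by blast
    have hz: "h j u t = (if j = k0 then h k0 a t else 0)" if "j < n" for j t
      using h\<pi>[OF sp.k0 that, of t a] h_sym[OF that, of t "\<pi> k0 a"] h_sym[OF sp.k0, of t a] by (auto simp: a)
    have "g y u t = h k0 u t"
      using hg[OF sp.k0, of a t] hz[OF sp.k0, of t] by (simp add: a)
    moreover have "\<alpha> y u t = (\<Sum>j<n. if j = k0 then (- (c k0 * h k0 u t)) *\<^sub>R f k0 else 0)"
      unfolding \<alpha>_exp using hz by (intro sum.cong) auto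
    ultimately show ?thesis using sp.k0 by simp
  qed
  \<comment> \<open>On the tangent plane of block \<open>k0\<close> the form is umbilical by
    \<open>\<alpha>k\<close>. Flatness with a second vector \<open>w\<close> of the plane,
    orthogonal to \<open>u\<close>, yields \<open>g y u (J y v) * g y w w = 0\<close>; this is where
    dimension 2 of the plane enters.\<close>
  have JV: "J y v \<in> V" if v: "v \<in> V" for v
  proof -
    have flat: "g y u (J y v) * g y w s = g y u s * g y w (J y v)"
      if u: "u \<in> range (\<pi> k0)" and w: "w \<in> range (\<pi> k0)" for u w s
    proof -
      have "g y u v = 0" "g y w v = 0" using v u w kp.g_sym by (auto simp: V_def)
      moreover have "B (\<alpha> y u v) (\<alpha> y w (- J y s)) - B (\<alpha> y u (J y v)) (\<alpha> y w (J y (- J y s))) =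
        B (\<alpha> y u (- J y s)) (\<alpha> y w v) - B (\<alpha> y u (J y (- J y s))) (\<alpha> y w (J y v))"
        by (rule kp.\<alpha>_flat)
      moreover have "J y (- J y s) = s" by (simp add: kp.J_simps)
      ultimately show ?thesis
        using c0[OF sp.k0] by (simp add: \<alpha>k[OF u] \<alpha>k[OF w] B_simps Bff[OF sp.k0 sp.k0] mult.commute)
    qed
    have "g y (J y v) u = 0" if u: "u \<in> range (\<pi> k0)" for u
    proof (cases "u = 0")
      case False
      have subE: "subspace (range (\<pi> k0))" by (simp add: linear_subspace_image \<pi>_linear[OF sp.k0])
      have "\<not> range (\<pi> k0) \<subseteq> span {u}"
      proof
        assume "range (\<pi> k0) \<subseteq> span {u}"
        then have "dim (range (\<pi> k0)) \<le> card {u}" by (intro dim_le_card) auto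
        then show False using dimk by simp
      qed
      then obtain w0 where w0: "w0 \<in> range (\<pi> k0)" "w0 \<notin> span {u}" by blast
      define w where "w = w0 - (g y u w0 / g y u u) *\<^sub>R u"
      have uu: "g y u u > 0" by (rule kp.g_pos[OF False])
      have wE: "w \<in> range (\<pi> k0)" unfolding w_def by (intro subspace_diff subspace_scale subE w0 u)
      have uw: "g y u w = 0" using uu by (simp add: w_def kp.g_simps)
      have "w \<noteq> 0"
      proof
        assume "w = 0"
        then have "w0 = (g y u w0 / g y u u) *\<^sub>R u" by (simp add: w_def)
        then show False using w0(2) by (metis span_base span_scale singletonI)
      qed
      then have "g y w w > 0" by (rule kp.g_pos)
      then have "g y u (J y v) = 0" using flat[OF u wE, of w] uw by simp
      then show ?thesis using kp.g_sym by simp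
    qed (simp add: kp.g_simps)
    then show ?thesis by (auto simp: V_def)
  qed
  have "\<exists>X. \<forall>Y. kp.\<beta> X Y = 0 \<longrightarrow> Y = 0"
  proof (rule kp.exists_regular(2)[OF subV JV])
    show "2 * p \<le> dim V" using dimV by simp
    fix S assume S: "S \<in> V" "S \<noteq> 0"
    \<comment> \<open>The weight of the complex line of \<open>S\<close> in block \<open>j\<close>.
      In the sum of the \<open>c j * (q j)\<^sup>2\<close> below, the only negative coefficient
      meets \<open>q k0 = 0\<close>.\<close>
    define q where "q j = h j S S + h j (J y S) (J y S)" for j
    have q0: "q j \<ge> 0" if "j < n" for j
      using h_pos[OF that] kp.g_pos kp.g_simps unfolding q_def
      by (metis add_nonneg_nonneg less_eq_real_def)
    have qk: "q k0 = 0" using Vh[OF S(1)] Vh[OF JV[OF S(1)]] by (simp add: q_def)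
    have b: "kp.b S S = (\<Sum>j<n. (- (c j * q j)) *\<^sub>R f j)"
      unfolding kp.b_def \<alpha>_exp q_def by (simp add: algebra_simps sum.distrib sum_subtractf flip: sum.distrib)
    have "B (kp.b S S) (kp.b S S) = (\<Sum>j<n. (- (c j * q j)) * B (kp.b S S) (f j))"
      by (subst (2) b) (simp add: linear_sum[OF kp.B_linear_right] B_simps)
    also have "\<dots> = (\<Sum>j<n. c j * (q j)\<^sup>2)"
    proof (rule sum.cong)
      fix j assume "j \<in> {..<n}"
      then have j: "j < n" by simp
      have "B (kp.b S S) (f j) = - q j" unfolding b using Bsum[OF j, of "\<lambda>j. - (c j * q j)"] c0[OF j] by simp
      then show "(- (c j * q j)) * B (kp.b S S) (f j) = c j * (q j)\<^sup>2" by (simp add: power2_eq_square)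
    qed simp
    also have "\<dots> > 0"
    proof -
      have "(\<Sum>j<n. q j) = g y S S + g y (J y S) (J y S)" by (simp add: q_def sum.distrib h_sum)
      then have "(\<Sum>j<n. q j) > 0" using kp.g_pos[OF S(2)] by (simp add: kp.J_orthogonal)
      then obtain j where j: "j < n" "q j \<noteq> 0" by (metis lessThan_iff less_irrefl sum.neutral)
      have nn: "c i * (q i)\<^sup>2 \<ge> 0" if "i < n" for i
        using sp.c[OF that] qk by (cases "i = k0") auto
      have "c j * (q j)\<^sup>2 > 0" using sp.c[OF j(1)] qk j by (cases "j = k0") auto
      then show ?thesis using nn j(1) by (intro sum_pos2[of _ j]) auto
    qed
    finally show "B (kp.b S S) (kp.b S S) > 0" .
  qed
  then obtain X where X: "\<And>Y. kp.\<beta> X Y = 0 \<Longrightarrow> Y = 0" by blast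
  \<comment> \<open>Outside \<open>U\<close> the value at \<open>y\<close> serves as default, so
    that \<open>L z\<close> is linear for every \<open>z\<close>, as
    \<open>injective_on_perturb\<close> requires.\<close>
  define L where "L z Y = (if z \<in> U then (\<alpha> z X Y + \<alpha> z (J z X) (J z Y), \<alpha> z X (J z Y) + \<alpha> z (J z X) (J z (J z Y)))
      else kp.\<beta> X Y)" for z Y
  have Ly: "L y = kp.\<beta> X" using y by (simp add: L_def kp.\<beta>_def kp.b_def fun_eq_iff)
  have linL: "linear (L z)" for z
  proof (cases "z \<in> U")
    case True
    then show ?thesis unfolding L_def
      by (intro linearI) (simp_all add: \<alpha>_lin[OF True] linear_add[OF Jz_linear[OF True]] linear_scale[OF Jz_linear[OF True]] scaleR_add_right)
  next
    case False
    then show ?thesis using kp.\<beta>_linear[of X] by (simp add: L_def[abs_def])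
  qed
  have lim: "((\<lambda>z. L z Y) \<longlongrightarrow> L y Y) (at y)" for Y
  proof -
    have cont: "isCont q y" if "smooth_on q U" for q :: "'e \<Rightarrow> 'w"
      using smooth_on_imp_continuous_on[OF that] U y by (simp add: continuous_on_eq_continuous_at)
    have JJ: "smooth_on (\<lambda>z. J z (J z Y)) U" by (rule smooth_on_apply[OF U J_smooth J_smooth Jz_linear])
    have "((\<lambda>z. (\<alpha> z X Y + \<alpha> z (J z X) (J z Y), \<alpha> z X (J z Y) + \<alpha> z (J z X) (J z (J z Y)))) \<longlongrightarrow>
       (\<alpha> y X Y + \<alpha> y (J y X) (J y Y), \<alpha> y X (J y Y) + \<alpha> y (J y X) (J y (J y Y)))) (at y)"
      by (intro tendsto_Pair tendsto_add isContD cont \<alpha>_smooth_apply smooth_on_const J_smooth JJ)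
    then show ?thesis
      using U y by (subst tendsto_cong[where g="\<lambda>z. (\<alpha> z X Y + \<alpha> z (J z X) (J z Y), \<alpha> z X (J z Y) + \<alpha> z (J z X) (J z (J z Y)))"])
        (auto simp: L_def eventually_at_topological)
  qed
  have "\<forall>\<^sub>F z in at y. \<forall>x\<in>UNIV. L z x = 0 \<longrightarrow> x = 0"
    by (rule injective_on_perturb[OF subspace_UNIV linL linL _ lim]) (use X Ly in auto)
  then have "\<forall>\<^sub>F z in nhds y. \<forall>x. L z x = 0 \<longrightarrow> x = 0"
    unfolding eventually_nhds_conv_at using X Ly by simp
  then obtain W0 where W0: "open W0" "y \<in> W0" "\<And>z x. z \<in> W0 \<Longrightarrow> L z x = 0 \<Longrightarrow> x = 0"
    unfolding eventually_nhds by blast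
  \<comment> \<open>On \<open>W\<close> the same \<open>X\<close> stays regular, so the second
    fundamental form is \<open>J\<close>-invariant there.\<close>
  define W where "W = W0 \<inter> U"
  have W: "open W" "W \<subseteq> U" "y \<in> W" using W0 U y by (auto simp: W_def)
  have inv: "\<alpha> z (J z u) (J z v) = \<alpha> z u v" if z: "z \<in> W" for z u v
  proof -
    have zU: "z \<in> U" using z W by blast
    interpret kz: kaehler_point "g z" "J z" B "N z" "F z" "\<alpha> z" n p by (rule kaehler_point[OF zU])
    have "L z Y = kz.\<beta> X Y" for Y using zU by (simp add: L_def kz.\<beta>_def kz.b_def)
    then show ?thesis using W0(3)[of z] z by (intro kz.\<alpha>_J_invariant[of X] np) (auto simp: W_def)
  qed
  have ev: "\<forall>\<^sub>F z in nhds y. \<forall>\<xi>. P j (E z \<xi>) = E z (P j \<xi>)" if j: "j < n" for j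
  proof -
    obtain r where "r > 0" "\<And>z \<xi>. z \<in> ball y r \<Longrightarrow> P j (E z \<xi>) = E z (P j \<xi>)"
      using projection_propagates[OF W inv sp.P_linear[OF j] P\<omega>[OF j] PE[OF j]] by metis
    then show ?thesis unfolding eventually_nhds by (intro exI[of _ "ball y r"]) auto
  qed
  have "\<forall>\<^sub>F z in nhds y. z \<in> U \<and> (\<forall>j\<in>{..<n}. \<forall>\<xi>. P j (E z \<xi>) = E z (P j \<xi>))"
    using ev U y by (intro eventually_conj eventually_nhds_in_open eventually_ball_finite) auto
  then obtain r where r: "r > 0" "\<And>z. dist z y < r \<Longrightarrow> z \<in> U \<and> (\<forall>j\<in>{..<n}. \<forall>\<xi>. P j (E z \<xi>) = E z (P j \<xi>))"
    unfolding eventually_nhds_metric by blast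
  have rU: "z \<in> U" and rP: "j < n \<Longrightarrow> P j (E z \<xi>) = E z (P j \<xi>)" if "z \<in> ball y r" for z j \<xi>
    using r(2)[of z] that by (auto simp: dist_commute)
  show thesis
  proof (rule that[OF r(1)])
    show "ball y r \<subseteq> U" using rU by blast
    fix z j assume z: "z \<in> ball y r" and j: "j < n"
    have bP: "bounded_linear (P j)" using sp.P_linear[OF j] by (simp add: linear_conv_bounded_linear)
    have PF: "smooth_on (\<lambda>z. P j (F z)) U" by (rule smooth_on_linear[OF bP U F_smooth])
    \<comment> \<open>As \<open>P j\<close> commutes with \<open>E\<close>, it maps
      \<open>dF x u\<close> to a tangent vector, to which \<open>F x\<close> is orthogonal. So the
      function \<open>B (P j F) F\<close> has zero derivative on the ball.\<close>
    have PFn: "B (P j (F x)) (dF x u) = 0" if x: "x \<in> ball y r" for x u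
    proof -
      have "dF x u = E x (dF x u)" by (simp add: E_def \<tau>_dF[OF rU[OF x]])
      then have "P j (dF x u) = E x (P j (dF x u))" using rP[OF x j, of "dF x u"] by simp
      then have "B (F x) (P j (dF x u)) = 0" using F_normal(1)[OF rU[OF x]] by (metis E_def)
      then show ?thesis by (simp add: sp.P_sym[OF j])
    qed
    have d: "((\<lambda>z. B (P j (F z)) (F z)) has_derivative (\<lambda>h. 0)) (at x within ball y r)" if x: "x \<in> ball y r" for x
    proof -
      have xU: "x \<in> U" by (rule rU[OF x])
      have "smooth_on (\<lambda>z. B (P j (F z)) (F z)) U" by (rule smooth_on_bilinear[OF lor_bounded_bilinear U PF F_smooth])
      note sd = smooth_on_has_derivative[OF this xU]
      have "frechet_derivative (\<lambda>z. B (P j (F z)) (F z)) (at x) v = 0" for v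
        using frechet_derivative_bilinear[OF lor_bounded_bilinear PF F_smooth xU, of e0 v]
          frechet_derivative_linear[OF bP F_smooth xU, of v] PFn[OF x, of v]
        by (simp add: sp.P_sym[OF j] lor_sym[of e0 "dF x v"] flip: dF_def)
      then have "frechet_derivative (\<lambda>z. B (P j (F z)) (F z)) (at x) = (\<lambda>v. 0)" by (rule ext)
      then show ?thesis using has_derivative_at_withinI[OF sd] by simp
    qed
    have "B (P j (F z)) (F z) = B (P j (F y)) (F y)"
      using has_derivative_zero_unique[OF convex_ball d z] r(1) by simp
    then show "B (P j (F z)) (F z) = 1 / c j" using c3[OF j] by simp
  qed
qed

end

section \<open>Passage to limit points, and openness of the image\<close>

context kaehler_chart
begin

lemma conditions_of_level:
  assumes spl: "lorentz_splitting e0 R n P c k0" and T: "open T" "T \<subseteq> U" "z \<in> T" and j: "j < n"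
    and lev: "\<And>z. z \<in> T \<Longrightarrow> B (P j (F z)) (F z) = 1 / c j"
  shows "B (P j (F z)) (dF z v) = 0" "B (P j (F z)) (ddF z u v) = - B (P j (dF z u)) (dF z v)"
proof -
  interpret sp: lorentz_splitting e0 R n P c k0 by (rule spl)
  have bP: "bounded_linear (P j)" using sp.P_linear[OF j] by (simp add: linear_conv_bounded_linear)
  have PF: "smooth_on (\<lambda>z. P j (F z)) U" by (rule smooth_on_linear[OF bP U F_smooth])
  have c1: "B (P j (F x)) (dF x v) = 0" if x: "x \<in> T" for x v
  proof -
    have xU: "x \<in> U" using x T by blast
    have "frechet_derivative (\<lambda>z. B (P j (F z)) (F z)) (at x) v = frechet_derivative (\<lambda>z. 1 / c j) (at x) v"
      by (rule frechet_derivative_cong[OF T(1) x smooth_on_const]) (simp add: lev)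
    then have "B (P j (F x)) (dF x v) + B (P j (dF x v)) (F x) = 0"
      using frechet_derivative_bilinear[OF lor_bounded_bilinear PF F_smooth xU, of e0 v]
        frechet_derivative_linear[OF bP F_smooth xU, of v] by (simp add: dF_def)
    moreover have "B (P j (dF x v)) (F x) = B (P j (F x)) (dF x v)"
      by (simp add: sp.P_sym[OF j]) (simp add: lor_sym[of e0 "dF x v"] sp.P_sym[OF j])
    ultimately show ?thesis by simp
  qed
  show "B (P j (F z)) (dF z v) = 0" by (rule c1[OF T(3)])
  have zU: "z \<in> U" using T by blast
  have "frechet_derivative (\<lambda>z. B (P j (F z)) (dF z v)) (at z) u = frechet_derivative (\<lambda>z. 0) (at z) u"
    by (rule frechet_derivative_cong[OF T(1,3) smooth_on_const]) (simp add: c1)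
  then have "B (P j (F z)) (ddF z u v) + B (P j (dF z u)) (dF z v) = 0"
    using frechet_derivative_bilinear[OF lor_bounded_bilinear PF dF_smooth zU, of e0 v u]
      frechet_derivative_linear[OF bP F_smooth zU, of u] by (simp add: dF_def[symmetric] ddF_def[symmetric])
  then show "B (P j (F z)) (ddF z u v) = - B (P j (dF z u)) (dF z v)" by simp
qed

text \<open>Each condition is the vanishing of a continuous function on \<open>U\<close>. These are
  the hypotheses of \<open>local_product\<close> at the single point \<open>y\<close>.\<close>

lemma conditions_at_limit:
  assumes spl: "lorentz_splitting e0 R n P c k0" and T: "open T" "T \<subseteq> U" "y \<in> closure T" "y \<in> U" and j: "j < n"
    and lev: "\<And>z. z \<in> T \<Longrightarrow> B (P j (F z)) (F z) = 1 / c j"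
  shows "B (P j (F y)) (dF y v) = 0" "B (P j (F y)) (ddF y u v) = - B (P j (dF y u)) (dF y v)"
    "B (P j (F y)) (F y) = 1 / c j"
proof -
  interpret sp: lorentz_splitting e0 R n P c k0 by (rule spl)
  have bP: "bounded_linear (P j)" using sp.P_linear[OF j] by (simp add: linear_conv_bounded_linear)
  have lim: "q y = 0" if q: "smooth_on q U" "\<And>z. z \<in> T \<Longrightarrow> q z = 0" for q :: "'e \<Rightarrow> real"
  proof -
    obtain x where x: "\<And>n. x n \<in> T" "x \<longlonglongrightarrow> y" using T(3) closure_sequential by blast
    have "isCont q y"
      using smooth_on_imp_continuous_on[OF q(1)] U T(4) by (simp add: continuous_on_eq_continuous_at)
    then have "(\<lambda>n. q (x n)) \<longlonglongrightarrow> q y" using x(2) isCont_tendsto_compose by blast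
    moreover have "(\<lambda>n. q (x n)) = (\<lambda>n. 0)" using x(1) q(2) by auto
    ultimately show ?thesis using LIMSEQ_unique[OF _ tendsto_const] by metis
  qed
  have PF: "smooth_on (\<lambda>z. P j (F z)) U" by (rule smooth_on_linear[OF bP U F_smooth])
  have PdF: "smooth_on (\<lambda>z. P j (dF z u)) U" for u by (rule smooth_on_linear[OF bP U dF_smooth])
  note sb = smooth_on_bilinear[OF lor_bounded_bilinear U]
  show "B (P j (F y)) (dF y v) = 0"
    by (rule lim[OF sb[OF PF dF_smooth]]) (rule conditions_of_level(1)[OF spl T(1,2) _ j lev])
  have "B (P j (F y)) (ddF y u v) + B (P j (dF y u)) (dF y v) = 0"
    by (rule lim[OF smooth_on_add[OF U sb[OF PF ddF_smooth] sb[OF PdF dF_smooth]]])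
      (simp add: conditions_of_level(2)[OF spl T(1,2) _ j lev])
  then show "B (P j (F y)) (ddF y u v) = - B (P j (dF y u)) (dF y v)" by simp
  have "B (P j (F y)) (F y) - 1 / c j = 0"
    by (rule lim[OF smooth_on_diff[OF U sb[OF PF F_smooth] smooth_on_const]]) (simp add: lev)
  then show "B (P j (F y)) (F y) = 1 / c j" by simp
qed

text \<open>Scaling the components \<open>P j F\<close> independently and adding the directions complementary to \<open>R\<close>
  turns \<open>F\<close> into a submersion onto the ambient space.\<close>

theorem image_locally_open:
  assumes spl: "lorentz_splitting e0 R n P c k0" and np: "n = Suc p" and y: "y \<in> U"
    and c1: "\<And>j u. j < n \<Longrightarrow> B (P j (F y)) (dF y u) = 0"
    and lev: "\<And>z j. z \<in> U \<Longrightarrow> j < n \<Longrightarrow> B (P j (F z)) (F z) = 1 / c j"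
  shows "\<exists>\<delta>>0. \<forall>w\<in>R. dist w (F y) < \<delta> \<and> (\<forall>j<n. B (P j w) w = 1 / c j) \<longrightarrow> w \<in> F ` U"
proof -
  interpret sp: lorentz_splitting e0 R n P c k0 by (rule spl)
  have c0: "c j \<noteq> 0" if "j < n" for j using sp.c[OF that] by (auto split: if_splits)
  define f where "f j = P j (F y)" for j
  have Bff: "B (f i) (f j) = (if i = j then 1 / c j else 0)" if "i < n" "j < n" for i j
    unfolding f_def by (rule first_order_orthogonal[OF spl y lev[OF y] that])
  \<comment> \<open>The maps \<open>P j\<close> are defined on the whole ambient type and add up to
    the identity only on \<open>R\<close>; their sum projects onto \<open>R\<close>.\<close>
  define pr where "pr \<xi> = (\<Sum>j<n. P j \<xi>)" for \<xi>
  have bP: "bounded_linear (P j)" if "j < n" for j using sp.P_linear[OF that] by (simp add: linear_conv_bounded_linear)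
  have bpr: "bounded_linear pr" unfolding pr_def by (rule bounded_linear_sum) (use bP in auto)
  have linpr: "linear pr" using bpr by (simp add: linear_conv_bounded_linear)
  have prR: "pr \<xi> \<in> R" for \<xi> unfolding pr_def using sp.P_R R(1) by (intro subspace_sum) auto
  have prid: "pr r = r" if "r \<in> R" for r using sp.P_sum[OF that] by (simp add: pr_def)
  have fR: "f j \<in> R" if "j < n" for j using sp.P_R[OF that] by (simp add: f_def)
  have fperp: "B (f j) (\<xi> - pr \<xi>) = 0" if "j < n" for j \<xi>
  proof -
    have "B (f j) (pr \<xi>) = B (pr (f j)) \<xi>"
      unfolding pr_def by (simp add: linear_sum[OF kaehler_point.B_linear_left[OF kaehler_point[OF y]]]
          linear_sum[OF kaehler_point.B_linear_right[OF kaehler_point[OF y]]] sp.P_sym)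
    then show ?thesis by (simp add: B_simps prid fR[OF that])
  qed
  \<comment> \<open>The second component carries all additional parameters: its products with the
    \<open>f j\<close> are the scalings, and its part complementary to \<open>R\<close> is added
    unchanged.\<close>
  define \<Psi> where "\<Psi> q = F (fst q) + (\<Sum>j<n. B (f j) (snd q) *\<^sub>R P j (F (fst q))) + (snd q - pr (snd q))" for q
  define D where "D q = dF y (fst q) + (\<Sum>j<n. B (f j) (snd q) *\<^sub>R f j) + (snd q - pr (snd q))" for q
  have bB: "bounded_linear (B x)" for x using lor_bounded_bilinear bounded_bilinear.bounded_linear_right by blast
  have dFz: "(F has_derivative dF z) (at z)" if "z \<in> U" for z
    using smooth_on_has_derivative[OF F_smooth that] by (simp add: dF_def[abs_def])
  have comp: "((\<lambda>q. G (fst q)) has_derivative (\<lambda>v. G' (fst v))) (at q)"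
    if "(G has_derivative G') (at (fst q))" for G :: "'e \<Rightarrow> 'w" and G' and q :: "'e \<times> 'w"
    using has_derivative_compose[OF has_derivative_fst[OF has_derivative_ident] that] by simp
  have d\<Psi>: "(\<Psi> has_derivative (\<lambda>v. dF (fst q) (fst v) + (\<Sum>j<n. B (f j) (snd q) *\<^sub>R P j (dF (fst q) (fst v)) + B (f j) (snd v) *\<^sub>R P j (F (fst q)))
      + (snd v - pr (snd v)))) (at q)" if "fst q \<in> U" for q
    unfolding \<Psi>_def
    by (intro has_derivative_add has_derivative_diff has_derivative_sum bounded_bilinear.FDERIV[OF bounded_bilinear_scaleR]
        bounded_linear.has_derivative[OF bB] bounded_linear.has_derivative[OF bpr] has_derivative_snd has_derivative_ident
        comp bounded_linear.has_derivative[OF bP] dFz that) auto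
  have D: "(\<Psi> has_derivative D) (at (y, 0))"
    using d\<Psi>[of "(y, 0)"] y by (simp add: D_def[abs_def] B_simps f_def)
  have linD: "linear D" using D has_derivative_linear by blast
  \<comment> \<open>After removal of the \<open>f j\<close>-components, the rest \<open>r\<close> of
    \<open>pr w\<close> is orthogonal to a basis of the normal space and therefore tangent.\<close>
  have "surj D"
  proof (rule surjI)
    fix w
    define a where "a j = c j * B (pr w) (f j)" for j
    define r where "r = pr w - (\<Sum>j<n. a j *\<^sub>R f j)"
    have rR: "r \<in> R" unfolding r_def using prR fR R(1) by (intro subspace_diff subspace_sum subspace_scale) auto
    have Bsum: "B (f j) (\<Sum>i<n. a i *\<^sub>R f i) = a j / c j" if "j < n" for a j
    proof -
      have "B (f j) (\<Sum>i<n. a i *\<^sub>R f i) = (\<Sum>i<n. a i * B (f j) (f i))"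
        by (simp add: linear_sum[OF kaehler_point.B_linear_right[OF kaehler_point[OF y]]] B_simps)
      also have "\<dots> = (\<Sum>i<n. if i = j then a j / c j else 0)"
        using Bff that by (intro sum.cong) auto
      finally show ?thesis using that by simp
    qed
    have rf: "B r (f j) = 0" if "j < n" for j
      using Bsum[OF that, of a] c0[OF that] by (simp add: r_def B_simps a_def lor_sym[of e0 _ "f j"])
    have "\<nu> y r = 0"
    proof (rule normal_eq_zero[OF spl np y c1 lev[OF y]])
      show "\<nu> y r \<in> N y"
        using \<nu>_normal[OF y] rR dF_R[OF y] R(1) by (auto simp: N_def \<nu>_def intro: subspace_diff)
      show "B (\<nu> y r) (P j (F y)) = 0" if "j < n" for j
        using rf[OF that] c1[OF that] by (simp add: \<nu>_def B_simps f_def lor_sym[of e0 "dF y _"])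
    qed
    then have r: "dF y (\<tau> y r) = r" by (simp add: \<nu>_def)
    \<comment> \<open>Since \<open>B (f j) (f j) = 1 / c j\<close>, the coefficient
      \<open>c j * a j\<close> produces \<open>B (f j) \<xi> = a j\<close>.\<close>
    define \<xi> where "\<xi> = (\<Sum>j<n. (c j * a j) *\<^sub>R f j) + (w - pr w)"
    have "B (f j) \<xi> = a j" if "j < n" for j
      using Bsum[OF that, of "\<lambda>j. c j * a j"] c0[OF that] fperp[OF that, of w] by (simp add: \<xi>_def bilinear_radd[OF lor_bilinear])
    moreover have "\<xi> - pr \<xi> = w - pr w"
    proof -
      have "(\<Sum>j<n. (c j * a j) *\<^sub>R f j) \<in> R" using fR R(1) by (intro subspace_sum subspace_scale) auto
      then show ?thesis by (simp add: \<xi>_def linear_add[OF linpr] linear_diff[OF linpr] prid prR)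
    qed
    ultimately show "D (\<tau> y r, \<xi>) = w" by (simp add: D_def r) (simp add: r_def)
  qed
  then obtain G where G: "linear G" "D \<circ> G = id" using linear_surjective_right_inverse[OF linD] by blast
  \<comment> \<open>The bound 1 excludes the solution \<open>s j = -2\<close> of
    \<open>(1 + s j)\<^sup>2 = 1\<close>.\<close>
  define T where "T = {q. fst q \<in> U \<and> (\<forall>j<n. \<bar>B (f j) (snd q)\<bar> < 1)}"
  have "T = (U \<times> UNIV) \<inter> (\<Inter>j\<in>{..<n}. {q. \<bar>B (f j) (snd q)\<bar> < 1})" by (auto simp: T_def)
  moreover have "open {q :: 'e \<times> 'w. \<bar>B (f j) (snd q)\<bar> < 1}" for j
    by (intro open_Collect_less continuous_on_rabs bounded_linear.continuous_on[OF bB] continuous_on_snd continuous_on_id continuous_on_const)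
  ultimately have openT: "open T" using U by (auto intro!: open_Int open_Times)
  have "\<Psi> (y, 0) \<in> interior (\<Psi> ` T)"
  proof (rule sussmann_open_mapping[of "U \<times> UNIV" \<Psi> "(y, 0)" D G T])
    show "open (U \<times> (UNIV :: 'w set))" using U by (simp add: open_Times)
    show "continuous_on (U \<times> UNIV) \<Psi>"
    proof (intro continuous_at_imp_continuous_on ballI)
      fix q :: "'e \<times> 'w" assume "q \<in> U \<times> UNIV"
      then have "fst q \<in> U" by auto
      from has_derivative_continuous[OF d\<Psi>[OF this]] show "isCont \<Psi> q" .
    qed
    show "(y, 0) \<in> interior T" using openT y by (simp add: interior_open T_def B_simps)
  qed (use y D G in \<open>auto simp: T_def linear_conv_bounded_linear\<close>)
  moreover have "\<Psi> (y, 0) = F y" by (simp add: \<Psi>_def B_simps linear_0[OF linpr])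
  ultimately obtain \<delta> where \<delta>: "\<delta> > 0" "ball (F y) \<delta> \<subseteq> \<Psi> ` T" by (auto simp: mem_interior)
  show ?thesis
  proof (intro exI[of _ \<delta>] conjI ballI impI \<delta>(1), elim conjE)
    fix w assume w: "w \<in> R" "dist w (F y) < \<delta>" and lw: "\<forall>j<n. B (P j w) w = 1 / c j"
    obtain z \<xi> where q: "(z, \<xi>) \<in> T" "w = \<Psi> (z, \<xi>)" using \<delta>(2) w(2) by (force simp: dist_commute)
    have z: "z \<in> U" using q by (simp add: T_def)
    define s where "s j = B (f j) \<xi>" for j
    have s1: "\<bar>s j\<bar> < 1" if "j < n" for j using q(1) that by (simp add: T_def s_def)
    have sumR: "F z + (\<Sum>j<n. s j *\<^sub>R P j (F z)) \<in> R"
      using F_R[OF z] sp.P_R R(1) by (intro subspace_add subspace_sum subspace_scale) auto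
    have w1: "w = (F z + (\<Sum>j<n. s j *\<^sub>R P j (F z))) + (\<xi> - pr \<xi>)" by (simp add: q(2) \<Psi>_def s_def)
    have "pr w = F z + (\<Sum>j<n. s j *\<^sub>R P j (F z))"
    proof -
      have "pr w = pr (F z + (\<Sum>j<n. s j *\<^sub>R P j (F z))) + pr (\<xi> - pr \<xi>)"
        unfolding w1 by (rule linear_add[OF linpr])
      moreover have "pr (\<xi> - pr \<xi>) = 0" by (simp add: linear_diff[OF linpr] prid prR)
      ultimately show ?thesis using prid[OF sumR] by simp
    qed
    then have w2: "w = F z + (\<Sum>j<n. s j *\<^sub>R P j (F z))" using prid[OF w(1)] by simp
    \<comment> \<open>Both \<open>w\<close> and \<open>F z\<close> have level \<open>1 / c j\<close>
      in block \<open>j\<close>, but \<open>P j w\<close> is \<open>1 + s j\<close> times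
      \<open>P j (F z)\<close>.\<close>
    have "s j = 0" if j: "j < n" for j
    proof -
      have "P j w = P j (F z) + (\<Sum>i<n. s i *\<^sub>R P j (P i (F z)))"
        by (simp add: w2 linear_add[OF sp.P_linear[OF j]] linear_sum[OF sp.P_linear[OF j]] linear_scale[OF sp.P_linear[OF j]])
      also have "(\<Sum>i<n. s i *\<^sub>R P j (P i (F z))) = (\<Sum>i<n. if i = j then s j *\<^sub>R P j (F z) else 0)"
        using j by (intro sum.cong) (auto simp: sp.P_proj)
      finally have Pw: "P j w = (1 + s j) *\<^sub>R P j (F z)" using j by (simp add: scaleR_add_left)
      have "B (P j w) w = B (P j (P j w)) w" using j by (simp add: sp.P_proj)
      also have "\<dots> = B (P j w) (P j w)" by (rule sp.P_sym[OF j])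
      also have "\<dots> = (1 + s j) * (1 + s j) * B (P j (F z)) (P j (F z))" by (simp add: Pw B_simps)
      also have "B (P j (F z)) (P j (F z)) = B (P j (P j (F z))) (F z)" by (rule sp.P_sym[OF j, symmetric])
      also have "\<dots> = 1 / c j" using j lev[OF z j] by (simp add: sp.P_proj)
      finally have "(1 + s j) * (1 + s j) * (1 / c j) = 1 / c j" using lw j by simp
      then have "s j * (2 + s j) = 0" using c0[OF j] by (simp add: field_simps)
      then show ?thesis using s1[OF j] by auto
    qed
    then have "w = F z" by (simp add: w2)
    then show "w \<in> F ` U" using z by blast
  qed
qed

end

section \<open>Lorentzian frames\<close>

text \<open>Orthogonal projection onto the span of the \<open>j\<close>-th triple of an orthonormal
  frame whose vector \<open>b 0\<close> is timelike, hence the sign at index 0.\<close>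

definition block_proj :: "'w::euclidean_space \<Rightarrow> (nat \<Rightarrow> 'w) \<Rightarrow> nat \<Rightarrow> 'w \<Rightarrow> 'w" where
  "block_proj e0 b j x = (\<Sum>i\<in>{3*j..<3*j+3}. ((if i = 0 then -1 else 1) * lor e0 x (b i)) *\<^sub>R b i)"

lemma sum_block: "(\<Sum>i\<in>{3*j..<3*j+3}. h i) = h (3*j) + h (3*j+1) + h (3*j+2)" for h :: "nat \<Rightarrow> 'a::comm_monoid_add"
proof -
  have "{3*j..<3*j+3} = {3*j, 3*j+1, 3*j+2}" by auto
  then show ?thesis by (simp add: add.assoc)
qed

locale lorentz_frame =
  fixes e0 :: "'w::euclidean_space" and R :: "'w set" and n :: nat and b :: "nat \<Rightarrow> 'w"
  assumes R: "subspace R" "dim R = 3 * n" and bR: "i < 3 * n \<Longrightarrow> b i \<in> R"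
    and orthonormal: "i < 3 * n \<Longrightarrow> j < 3 * n \<Longrightarrow>
      lor e0 (b i) (b j) = (if i = j then (if i = 0 then -1 else 1) else 0)"
begin

lemma linear_lor_left: "linear (\<lambda>x. lor e0 x y)" and linear_lor_right: "linear (lor e0 x)"
  using lor_bilinear by (auto simp: bilinear_def)

lemmas lor_simps =
  bilinear_ladd[OF lor_bilinear] bilinear_radd[OF lor_bilinear] bilinear_lmul[OF lor_bilinear]
  bilinear_rmul[OF lor_bilinear] bilinear_lsub[OF lor_bilinear] bilinear_rsub[OF lor_bilinear]
  bilinear_lzero[OF lor_bilinear] bilinear_rzero[OF lor_bilinear]

lemma lor_sum:
  assumes "I \<subseteq> {..<3 * n}" "j < 3 * n"
  shows "lor e0 (\<Sum>i\<in>I. a i *\<^sub>R b i) (b j) = (if j \<in> I then (if j = 0 then -1 else 1) * a j else 0)"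
proof -
  have fin: "finite I" using assms(1) finite_subset by blast
  have "lor e0 (\<Sum>i\<in>I. a i *\<^sub>R b i) (b j) = (\<Sum>i\<in>I. a i * lor e0 (b i) (b j))"
    by (simp add: linear_sum[OF linear_lor_left] lor_simps)
  also have "\<dots> = (\<Sum>i\<in>I. if i = j then (if j = 0 then -1 else 1) * a j else 0)"
    using assms orthonormal by (intro sum.cong) auto
  finally show ?thesis using fin by simp
qed

lemma frame_expand:
  assumes "x \<in> R" shows "x = (\<Sum>i<3 * n. ((if i = 0 then -1 else 1) * lor e0 x (b i)) *\<^sub>R b i)"
proof -
  have inj: "inj_on b {..<3 * n}"
  proof (rule inj_onI)
    fix i j assume a: "i \<in> {..<3 * n}" "j \<in> {..<3 * n}" "b i = b j"
    show "i = j"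
    proof (rule ccontr)
      assume "i \<noteq> j" then show False using orthonormal[of i j] orthonormal[of j j] a by (simp split: if_splits)
    qed
  qed
  have "independent (b ` {..<3 * n})"
  proof (rule independent_if_scalars_zero)
    fix s x assume s: "(\<Sum>x\<in>b ` {..<3 * n}. s x *\<^sub>R x) = 0" and "x \<in> b ` {..<3 * n}"
    then obtain j where j: "j < 3 * n" "x = b j" by blast
    have "(\<Sum>i<3 * n. s (b i) *\<^sub>R b i) = 0" using s by (simp add: sum.reindex[OF inj])
    then show "s x = 0"
      using lor_sum[of "{..<3*n}" j "\<lambda>i. s (b i)"] j by (simp add: lor_simps split: if_splits)
  qed simp
  then have "dim (span (b ` {..<3 * n})) = card (b ` {..<3 * n})" by (rule dim_span_eq_card_independent)
  then have "dim (span (b ` {..<3 * n})) = 3 * n" by (simp only: card_image[OF inj] card_lessThan)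
  then have "span (b ` {..<3 * n}) = R"
    using R bR by (intro subspace_dim_equal span_minimal) auto
  then obtain s where "x = (\<Sum>v\<in>b ` {..<3 * n}. s v *\<^sub>R v)"
    using assms span_finite[of "b ` {..<3 * n}"] by auto
  then have x: "x = (\<Sum>i<3 * n. s (b i) *\<^sub>R b i)" by (simp add: sum.reindex[OF inj])
  have "s (b i) = (if i = 0 then -1 else 1) * lor e0 x (b i)" if "i < 3 * n" for i
    using lor_sum[of "{..<3*n}" i "\<lambda>i. s (b i)"] that by (simp flip: x)
  then show ?thesis using x by (metis (no_types, lifting) lessThan_iff sum.cong)
qed

lemma lor_block_proj:
  assumes "j < n" "m < 3 * n"
  shows "lor e0 (block_proj e0 b j x) (b m) = (if m \<in> {3*j..<3*j+3} then lor e0 x (b m) else 0)"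
proof -
  have "{3*j..<3*j+3} \<subseteq> {..<3 * n}" using assms by auto
  from lor_sum[OF this assms(2)] show ?thesis unfolding block_proj_def by simp
qed

lemma lor_block_proj_self:
  "lor e0 (block_proj e0 b j x) y = (\<Sum>i\<in>{3*j..<3*j+3}. (if i = 0 then -1 else 1) * lor e0 x (b i) * lor e0 y (b i))"
  unfolding block_proj_def by (simp add: linear_sum[OF linear_lor_left] lor_simps lor_sym[of e0 y] cong: if_cong)

lemma splitting:
  assumes "0 < n" "\<And>j. j < n \<Longrightarrow> if j = 0 then c j < 0 else c j > (0::real)"
  shows "lorentz_splitting e0 R n (block_proj e0 b) c 0"
proof
  fix j assume j: "j < n"
  show "block_proj e0 b j x \<in> R" for x
    unfolding block_proj_def using bR j R(1) by (intro subspace_sum subspace_scale) auto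
  show "lor e0 (block_proj e0 b j x) y = lor e0 x (block_proj e0 b j y)" for x y
    unfolding lor_sym[of e0 x "block_proj e0 b j y"] lor_block_proj_self by (simp add: mult_ac)
  have "block_proj e0 b j x \<in> span (b ` {3*j..<3*j+3})" for x
    unfolding block_proj_def by (intro span_sum span_scale span_base) auto
  then have "dim (range (block_proj e0 b j)) \<le> card (b ` {3*j..<3*j+3})"
    by (intro dim_le_card) auto
  also have "\<dots> \<le> 3" using card_image_le[of "{3*j..<3*j+3}" b] by simp
  finally show "dim (range (block_proj e0 b j)) \<le> 3" .
  show "if j = 0 then c j < 0 else c j > 0" by (rule assms(2)[OF j])
  show "block_proj e0 b i (block_proj e0 b j x) = (if i = j then block_proj e0 b j x else 0)" if i: "i < n" for i x
  proof -
    have "block_proj e0 b i (block_proj e0 b j x) =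
      (\<Sum>m\<in>{3*i..<3*i+3}. if i = j then ((if m = 0 then -1 else 1) * lor e0 x (b m)) *\<^sub>R b m else 0)"
      unfolding block_proj_def[of e0 b i] using i lor_block_proj[OF j, of _ x] by (intro sum.cong) auto
    then show ?thesis by (simp add: block_proj_def)
  qed
  have "linear (block_proj e0 b j)" unfolding block_proj_def
    by (intro linearI) (simp_all add: lor_simps sum.distrib scaleR_sum_right algebra_simps cong: if_cong)
  then show "\<And>b1 b2. block_proj e0 b j (b1 + b2) = block_proj e0 b j b1 + block_proj e0 b j b2"
    "\<And>r v. block_proj e0 b j (r *\<^sub>R v) = r *\<^sub>R block_proj e0 b j v"
    by (auto simp: linear_add linear_scale)
next
  fix x assume x: "x \<in> R"
  have "(\<Sum>j<n. block_proj e0 b j x) = (\<Sum>i<n*3. ((if i = 0 then -1 else 1) * lor e0 x (b i)) *\<^sub>R b i)"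
    unfolding block_proj_def sum.nat_group[symmetric] by (simp add: mult.commute)
  then show "(\<Sum>j<n. block_proj e0 b j x) = x" using frame_expand[OF x] by (simp add: mult.commute)
qed (rule assms(1))

end

context kaehler_chart
begin

text \<open>Block \<open>j\<close> is spanned by the principal normal and the tangent complex line
  of the \<open>j\<close>-th frame vector. The projection of \<open>F\<close> to it is
  \<open>- \<nu>' j / c j\<close>, so the diagonal form of \<open>\<alpha>\<close> is precisely the
  second-order condition of \<open>local_product\<close>.\<close>

theorem frame_at:
  assumes y: "y \<in> U" and V: "subspace V" "\<And>v. v \<in> V \<Longrightarrow> J y v \<in> V" "2 * p \<le> dim V"
    and pos: "\<And>S. S \<in> V \<Longrightarrow> S \<noteq> 0 \<Longrightarrow> g y (curv y S (J y S) (J y S)) S > 0"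
  obtains b c where "n = Suc p" "lorentz_frame e0 R n b" "B (b 0) (F y) < 0"
    "\<And>j. j < n \<Longrightarrow> if j = 0 then c j < 0 else c j > (0::real)" "(\<Sum>j<n. 1 / c j) = -1"
    "\<And>j u. j < n \<Longrightarrow> B (block_proj e0 b j (F y)) (dF y u) = 0"
    "\<And>j u v. j < n \<Longrightarrow> B (block_proj e0 b j (F y)) (ddF y u v) = - B (block_proj e0 b j (dF y u)) (dF y v)"
    "\<And>j. j < n \<Longrightarrow> B (block_proj e0 b j (F y)) (F y) = 1 / c j"
proof -
  interpret kp: kaehler_point "g y" "J y" B "N y" "F y" "\<alpha> y" n p by (rule kaehler_point[OF y])
  have nn: "B x x \<ge> 0" if "x \<in> N y" "B (F y) x = 0" for x
    using kp.B_pos[OF that] by (cases "x = 0") (auto simp: B_simps)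
  \<comment> \<open>The square of \<open>b S S\<close> is that of \<open>?a - ?d\<close> plus
    \<open>4 * B ?d ?a\<close>. The Gauss equation and positive curvature give
    \<open>B ?d ?a > B ?m ?m\<close>, and \<open>?a - ?d\<close> and \<open>?m\<close> have
    nonnegative squares because they are normal and orthogonal to \<open>F\<close>.\<close>
  have bpos: "B (kp.b S S) (kp.b S S) > 0" if S: "S \<in> V" "S \<noteq> 0" for S
  proof -
    let ?a = "\<alpha> y S S" and ?d = "\<alpha> y (J y S) (J y S)" and ?m = "\<alpha> y S (J y S)"
    have "g y (curv y S (J y S) (J y S)) S = B ?d ?a - B ?m ?m"
      using gauss[OF y, of S "J y S" "J y S" S] \<alpha>_sym[OF y, of "J y S" S] by simp
    then have "B ?d ?a > B ?m ?m" using pos[OF S] by simp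
    moreover have "B ?m ?m \<ge> 0"
      using kp.\<alpha>_f[of S "J y S"] by (intro nn kp.\<alpha>_N) (simp add: kp.g_J_self lor_sym[of e0 "F y"])
    moreover have "B (?a - ?d) (?a - ?d) \<ge> 0"
      using kp.\<alpha>_f[of S S] kp.\<alpha>_f[of "J y S" "J y S"]
      by (intro nn subspace_diff kp.N(1) kp.\<alpha>_N) (simp add: B_simps lor_sym[of e0 "F y"] kp.J_orthogonal)
    moreover have "B (kp.b S S) (kp.b S S) = B (?a - ?d) (?a - ?d) + 4 * B ?d ?a"
      by (simp add: kp.b_def B_simps lor_sym[of e0 ?a ?d])
    ultimately show ?thesis by simp
  qed
  note reg = kp.exists_regular[OF V bpos]
  obtain X where X: "\<And>Y. kp.\<beta> X Y = 0 \<Longrightarrow> Y = 0" using reg(2) by blast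
  have n0: "0 < n" using reg(1) by simp
  show thesis
  proof (rule kp.principal_frame[OF X reg(1)])
    fix E0 \<nu>0
    assume E0: "\<And>i j. i < n \<Longrightarrow> j < n \<Longrightarrow> g y (E0 i) (E0 j) = (if i = j then 1 else 0)"
      and EJ0: "\<And>i j. i < n \<Longrightarrow> j < n \<Longrightarrow> g y (E0 i) (J y (E0 j)) = 0"
      and \<nu>N0: "\<And>i. i < n \<Longrightarrow> \<nu>0 i \<in> N y" and \<nu>F0: "\<And>i. i < n \<Longrightarrow> B (\<nu>0 i) (F y) = -1"
      and \<nu>o0: "\<And>i j. i < n \<Longrightarrow> j < n \<Longrightarrow> i \<noteq> j \<Longrightarrow> B (\<nu>0 i) (\<nu>0 j) = 0"
      and \<alpha>0: "\<And>u v. \<alpha> y u v = (\<Sum>i<n. (g y (E0 i) u * g y (E0 i) v + g y (J y (E0 i)) u * g y (J y (E0 i)) v) *\<^sub>R \<nu>0 i)"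
      and sum0: "(\<Sum>i<n. 1 / B (\<nu>0 i) (\<nu>0 i)) = -1"
      and sgn0: "\<exists>k<n. \<forall>i<n. if i = k then B (\<nu>0 i) (\<nu>0 i) < 0 else B (\<nu>0 i) (\<nu>0 i) > 0"
    obtain k where k: "k < n" "\<And>i. i < n \<Longrightarrow> if i = k then B (\<nu>0 i) (\<nu>0 i) < 0 else B (\<nu>0 i) (\<nu>0 i) > 0"
      using sgn0 by blast
    \<comment> \<open>Transposes 0 and \<open>k\<close>: the block with the timelike normal must
      come first, since time is coordinate 0.\<close>
    define \<sigma> where "\<sigma> i = (if i = 0 then k else if i = k then 0 else i)" for i
    have \<sigma>n: "\<sigma> i < n" if "i < n" for i using that k(1) n0 by (simp add: \<sigma>_def)
    have \<sigma>inj: "\<sigma> i = \<sigma> j \<longleftrightarrow> i = j" for i j by (auto simp: \<sigma>_def)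
    have \<sigma>\<sigma>: "\<sigma> (\<sigma> i) = i" for i by (auto simp: \<sigma>_def)
    have bij: "bij_betw \<sigma> {..<n} {..<n}"
      by (rule bij_betw_byWitness[where f'=\<sigma>]) (auto simp: \<sigma>\<sigma> \<sigma>n)
    define E' where "E' i = E0 (\<sigma> i)" for i
    define \<nu>' where "\<nu>' i = \<nu>0 (\<sigma> i)" for i
    define c where "c i = B (\<nu>' i) (\<nu>' i)" for i
    have E: "g y (E' i) (E' j) = (if i = j then 1 else 0)" "g y (E' i) (J y (E' j)) = 0" if "i < n" "j < n" for i j
      using that E0 EJ0 by (auto simp: E'_def \<sigma>n \<sigma>inj)
    have \<nu>N: "\<nu>' i \<in> N y" and \<nu>F: "B (\<nu>' i) (F y) = -1" if "i < n" for i
      using that \<nu>N0 \<nu>F0 by (auto simp: \<nu>'_def \<sigma>n)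
    have \<nu>o: "B (\<nu>' i) (\<nu>' j) = (if i = j then c i else 0)" if "i < n" "j < n" for i j
      using that \<nu>o0[of "\<sigma> i" "\<sigma> j"] by (auto simp: \<nu>'_def c_def \<sigma>n \<sigma>inj)
    have sgn: "if i = 0 then c i < 0 else c i > 0" if "i < n" for i
      using k(2)[OF \<sigma>n[OF that]] by (auto simp: c_def \<nu>'_def \<sigma>_def split: if_splits)
    have sum: "(\<Sum>i<n. 1 / c i) = -1"
      using sum.reindex_bij_betw[OF bij, of "\<lambda>i. 1 / B (\<nu>0 i) (\<nu>0 i)"] sum0 by (simp add: c_def \<nu>'_def)
    have \<alpha>': "\<alpha> y u v = (\<Sum>i<n. (g y (E' i) u * g y (E' i) v + g y (J y (E' i)) u * g y (J y (E' i)) v) *\<^sub>R \<nu>' i)" for u v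
      unfolding \<alpha>0 \<nu>'_def E'_def
      using sum.reindex_bij_betw[OF bij, of "\<lambda>i. (g y (E0 i) u * g y (E0 i) v + g y (J y (E0 i)) u * g y (J y (E0 i)) v) *\<^sub>R \<nu>0 i"] by simp
    have B\<nu>\<alpha>: "B (\<nu>' j) (\<alpha> y u v) = c j * (g y (E' j) u * g y (E' j) v + g y (J y (E' j)) u * g y (J y (E' j)) v)"
      if j: "j < n" for j u v
    proof -
      have "B (\<nu>' j) (\<alpha> y u v) = (\<Sum>i<n. (g y (E' i) u * g y (E' i) v + g y (J y (E' i)) u * g y (J y (E' i)) v) * B (\<nu>' j) (\<nu>' i))"
        unfolding \<alpha>' by (simp add: linear_sum[OF kp.B_linear_right] B_simps)
      also have "\<dots> = (\<Sum>i<n. if i = j then c j * (g y (E' j) u * g y (E' j) v + g y (J y (E' j)) u * g y (J y (E' j)) v) else 0)"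
        using \<nu>o j by (intro sum.cong) auto
      finally show ?thesis using j by simp
    qed
    have \<nu>dF: "B (\<nu>' i) (dF y u) = 0" "B (dF y u) (\<nu>' i) = 0" if "i < n" for i u
      using \<nu>N[OF that] by (auto simp: N_def lor_sym[of e0 "dF y u"])
    have JE: "g y (J y (E' i)) (E' j) = 0" "g y (J y (E' i)) (J y (E' j)) = (if i = j then 1 else 0)" if "i < n" "j < n" for i j
      using E[OF that] kp.g_J_left[of "E' i" "E' j"] by (auto simp: kp.J_orthogonal)
    \<comment> \<open>Index \<open>3 * j + r\<close> is vector \<open>r\<close> of block
      \<open>j\<close>, in agreement with \<open>concat_blocks\<close>. Normalising by the absolute
      value leaves \<open>b 0\<close> timelike.\<close>
    define b where "b i = (if i mod 3 = 0 then (1 / sqrt \<bar>c (i div 3)\<bar>) *\<^sub>R \<nu>' (i div 3)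
      else if i mod 3 = 1 then dF y (E' (i div 3)) else dF y (J y (E' (i div 3))))" for i
    have c0: "c i \<noteq> 0" if "i < n" for i using sgn[OF that] by (auto split: if_splits)
    have sq: "1 / sqrt \<bar>x\<bar> * (1 / sqrt \<bar>x\<bar>) = 1 / \<bar>x\<bar>" for x :: real by simp
    have frame: "lorentz_frame e0 R n b"
    proof
      show "subspace R" by (rule R(1))
      show "dim R = 3 * n" using R(2) reg(1) by simp
      show "b i \<in> R" if "i < 3 * n" for i
        using that \<nu>N[of "i div 3"] dF_R[OF y] R(1) by (auto simp: b_def N_def intro: subspace_scale)
      show "B (b i) (b j) = (if i = j then if i = 0 then - 1 else 1 else 0)" if ij: "i < 3 * n" "j < 3 * n" for i j
      proof -
        have d: "i div 3 < n" "j div 3 < n" using ij by auto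
        have eq: "i = j \<longleftrightarrow> i div 3 = j div 3 \<and> i mod 3 = j mod 3" by (metis div_mult_mod_eq)
        have i3: "m mod 3 = 0 \<or> m mod 3 = 1 \<or> m mod 3 = 2" for m :: nat by presburger
        have z: "i = 0 \<longleftrightarrow> i div 3 = 0 \<and> i mod 3 = 0" by presburger
        define v where "v r a = (if r = 0 then (1 / sqrt \<bar>c a\<bar>) *\<^sub>R \<nu>' a else if r = 1 then dF y (E' a) else dF y (J y (E' a)))"
          for r a :: nat
        have bv: "b m = v (m mod 3) (m div 3)" for m by (simp add: b_def v_def)
        have v00: "B (v 0 a) (v 0 a') = (if a = a' then if a = 0 then -1 else 1 else 0)" if "a < n" "a' < n" for a a'
          using sgn[OF that(1)] \<nu>o[OF that] by (cases "a = 0"; cases "a = a'") (auto simp: v_def B_simps)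
        have v0: "B (v 0 a) (v r a') = 0" "B (v r a') (v 0 a) = 0" if "a < n" "r \<noteq> 0" for a a' r
          using that by (simp_all add: v_def B_simps \<nu>dF)
        have v1: "B (v 1 a) (v 1 a') = (if a = a' then 1 else 0)" "B (v 1 a) (v 2 a') = 0" "B (v 2 a') (v 1 a) = 0"
          "B (v 2 a) (v 2 a') = (if a = a' then 1 else 0)" if "a < n" "a' < n" for a a'
          using E[OF that] JE[OF that] JE[OF that(2,1)] by (simp_all add: v_def flip: g_def)
        consider "i mod 3 = 0" "j mod 3 = 0" | "i mod 3 = 0" "j mod 3 \<noteq> 0" | "i mod 3 \<noteq> 0" "j mod 3 = 0"
          | "i mod 3 = 1" "j mod 3 = 1" | "i mod 3 = 1" "j mod 3 = 2" | "i mod 3 = 2" "j mod 3 = 1" | "i mod 3 = 2" "j mod 3 = 2"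
          using i3[of i] i3[of j] by metis
        then show ?thesis
        proof cases
          case 1 then show ?thesis unfolding eq z bv by (simp only: v00[OF d] simp_thms)
        next
          case 2 then show ?thesis unfolding eq z bv by (simp add: v0(1)[OF d(1)])
        next
          case 3 then show ?thesis unfolding eq z bv by (simp add: v0(2)[OF d(2)])
        next
          case 4 then show ?thesis unfolding eq z bv by (simp add: v1[OF d, unfolded One_nat_def])
        next
          case 5 then show ?thesis unfolding eq z bv by (simp add: v1[OF d, unfolded One_nat_def])
        next
          case 6 then show ?thesis unfolding eq z bv by (simp add: v1[OF d(2,1), unfolded One_nat_def])
        next
          case 7 then show ?thesis unfolding eq z bv by (simp add: v1[OF d, unfolded One_nat_def])
        qed
      qed
    qed
    have proj: "block_proj e0 b j x = (B x (\<nu>' j) / c j) *\<^sub>R \<nu>' j + B x (dF y (E' j)) *\<^sub>R dF y (E' j)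
        + B x (dF y (J y (E' j))) *\<^sub>R dF y (J y (E' j))" if j: "j < n" for j x
    proof -
      have 1: "(3 * j) div 3 = j" "(3 * j) mod 3 = 0" "(3 * j + 1) div 3 = j" "(3 * j + 1) mod 3 = 1"
        "(3 * j + 2) div 3 = j" "(3 * j + 2) mod 3 = 2" by presburger+
      \<comment> \<open>The sign of the timelike frame vector restores the sign lost in the absolute
        value.\<close>
      have cc: "(if j = 0 then -1 else 1) * (1 / sqrt \<bar>c j\<bar>) * (1 / sqrt \<bar>c j\<bar>) = 1 / c j"
        unfolding mult.assoc sq using sgn[OF j] by (cases "j = 0") simp_all
      have "((if 3 * j = 0 then -1 else 1) * B x (b (3 * j))) *\<^sub>R b (3 * j) = (B x (\<nu>' j) * ((if j = 0 then -1 else 1) * (1 / sqrt \<bar>c j\<bar>) * (1 / sqrt \<bar>c j\<bar>))) *\<^sub>R \<nu>' j"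
        unfolding b_def 1 by (simp add: B_simps mult_ac)
      also have "\<dots> = (B x (\<nu>' j) / c j) *\<^sub>R \<nu>' j" unfolding cc by simp
      finally have 2: "((if 3 * j = 0 then -1 else 1) * B x (b (3 * j))) *\<^sub>R b (3 * j) = (B x (\<nu>' j) / c j) *\<^sub>R \<nu>' j" .
      have 3: "b (3 * j + 1) = dF y (E' j)" "b (3 * j + 2) = dF y (J y (E' j))" unfolding b_def 1 by simp_all
      show ?thesis unfolding block_proj_def sum_block 2 3 by simp
    qed
    have PF: "block_proj e0 b j (F y) = (- 1 / c j) *\<^sub>R \<nu>' j" if j: "j < n" for j
      using \<nu>F[OF j] by (simp add: proj[OF j] F_normal[OF y] lor_sym[of e0 "F y"])
    show thesis
    proof (rule that[OF reg(1) frame _ sgn sum])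
      show "B (b 0) (F y) < 0" using \<nu>F[OF n0] c0[OF n0] by (simp add: b_def B_simps)
      fix j assume j: "j < n"
      show "B (block_proj e0 b j (F y)) (dF y u) = 0" for u by (simp add: PF[OF j] B_simps \<nu>dF[OF j])
      show "B (block_proj e0 b j (F y)) (F y) = 1 / c j" using \<nu>F[OF j] by (simp add: PF[OF j] B_simps)
      show "B (block_proj e0 b j (F y)) (ddF y u v) = - B (block_proj e0 b j (dF y u)) (dF y v)" for u v
      proof -
        have "B (block_proj e0 b j (F y)) (ddF y u v) = (- 1 / c j) * B (\<nu>' j) (\<alpha> y u v)"
          unfolding PF[OF j] ddF_split by (simp add: B_simps \<nu>dF[OF j])
        also have "\<dots> = - (g y (E' j) u * g y (E' j) v + g y (J y (E' j)) u * g y (J y (E' j)) v)"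
          unfolding B\<nu>\<alpha>[OF j] using c0[OF j] by simp
        also have "\<dots> = - B (block_proj e0 b j (dF y u)) (dF y v)"
          unfolding proj[OF j]
          by (simp add: B_simps \<nu>dF[OF j] kp.g_sym[of u "E' j"] kp.g_sym[of u "J y (E' j)"] flip: g_def)
        finally show ?thesis .
      qed
    qed
  qed
qed

end

section \<open>Coordinates and charts\<close>

text \<open>Copies Lorentzian space of dimension \<open>K\<close> isometrically into a Euclidean
  type with enough basis vectors; \<open>e 0\<close> receives the time coordinate.\<close>

locale lorentz_coordinates =
  fixes e :: "nat \<Rightarrow> 'w::euclidean_space" and K :: nat
  assumes e_inj: "inj_on e {..<K}" and e_Basis: "e ` {..<K} \<subseteq> Basis" and K: "0 < K"
begin

definition emb :: "(nat \<Rightarrow> real) \<Rightarrow> 'w" where "emb x = (\<Sum>i<K. x i *\<^sub>R e i)"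

lemma e_inner: "i < K \<Longrightarrow> j < K \<Longrightarrow> e i \<bullet> e j = (if i = j then 1 else 0)"
  using e_Basis inj_onD[OF e_inj, of i j] by (auto simp: inner_Basis image_subset_iff)

lemma emb_inner: assumes "j < K" shows "emb x \<bullet> e j = x j"
proof -
  have "emb x \<bullet> e j = (\<Sum>i<K. if i = j then x j else 0)"
    unfolding emb_def inner_sum_left using assms e_inner by (intro sum.cong) auto
  then show ?thesis using assms by simp
qed

lemma lor_emb: "lor (e 0) (emb x) (emb y) = lorentz K x y"
proof -
  have "emb x \<bullet> emb y = (\<Sum>i<K. x i * y i)"
    unfolding emb_def[of y] inner_sum_right by (simp add: emb_inner mult.commute)
  moreover have "(\<Sum>i<K. x i * y i) = x 0 * y 0 + (\<Sum>i\<in>{1..<K}. x i * y i)"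
    using K by (simp add: lessThan_atLeast0 sum.atLeast_Suc_lessThan)
  ultimately show ?thesis by (simp add: lor_def lorentz_def emb_inner K)
qed

abbreviation "R \<equiv> span (e ` {..<K})"

lemma emb_R: "emb x \<in> R"
  unfolding emb_def by (intro span_sum span_scale span_base) auto

lemma dim_R: "dim R = K"
proof -
  have "independent (e ` {..<K})" using e_Basis independent_Basis independent_mono by blast
  then have "dim R = card (e ` {..<K})" by (rule dim_span_eq_card_independent)
  then show ?thesis by (simp only: card_image[OF e_inj] card_lessThan)
qed

lemma emb_coordinates: assumes "w \<in> R" shows "emb (\<lambda>i. if i < K then w \<bullet> e i else 0) = w"
proof -
  have "(\<Sum>v\<in>e ` {..<K}. (w \<bullet> v) *\<^sub>R v) = w"
  proof (rule orthonormal_basis_expand)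
    show "pairwise orthogonal (e ` {..<K})"
      using e_Basis by (auto simp: pairwise_def orthogonal_def image_subset_iff inner_Basis)
    show "norm v = 1" if "v \<in> e ` {..<K}" for v using that e_Basis by (auto intro: norm_Basis)
  qed (use assms in auto)
  then show ?thesis by (simp add: emb_def sum.reindex[OF e_inj] cong: sum.cong_simp)
qed

text \<open>For timelike vectors the time components dominate, by Cauchy-Schwarz on the other
  components, so the Lorentzian product has the sign opposite to the product of the time
  components.\<close>

lemma time_orientation:
  assumes "lor (e 0) u u = -1" "lor (e 0) v v = -1" "u \<bullet> e 0 > 0"
  shows "lor (e 0) u v < 0 \<longleftrightarrow> v \<bullet> e 0 > 0"
proof -
  define u' where "u' = u - (u \<bullet> e 0) *\<^sub>R e 0"
  define v' where "v' = v - (v \<bullet> e 0) *\<^sub>R e 0"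
  have ee: "e 0 \<bullet> e 0 = 1" using e_inner[OF K K] by simp
  have 1: "lor (e 0) u u = u' \<bullet> u' - (u \<bullet> e 0)\<^sup>2" "lor (e 0) v v = v' \<bullet> v' - (v \<bullet> e 0)\<^sup>2"
    "lor (e 0) u v = u' \<bullet> v' - (u \<bullet> e 0) * (v \<bullet> e 0)"
    by (simp_all add: lor_def u'_def v'_def inner_diff_left inner_diff_right ee inner_commute power2_eq_square)
  have u2: "(norm u')\<^sup>2 < (u \<bullet> e 0)\<^sup>2" and v2: "(norm v')\<^sup>2 < (v \<bullet> e 0)\<^sup>2"
    using assms 1 by (simp_all add: power2_norm_eq_inner)
  have u: "norm u' < \<bar>u \<bullet> e 0\<bar>" and v: "norm v' < \<bar>v \<bullet> e 0\<bar>"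
    using abs_le_square_iff[of "u \<bullet> e 0" "norm u'"] abs_le_square_iff[of "v \<bullet> e 0" "norm v'"] u2 v2 by fastforce+
  have "\<bar>u' \<bullet> v'\<bar> \<le> norm u' * norm v'" by (rule Cauchy_Schwarz_ineq2)
  also have "\<dots> < \<bar>u \<bullet> e 0\<bar> * \<bar>v \<bullet> e 0\<bar>" using u v by (intro mult_strict_mono') auto
  finally have cs: "\<bar>u' \<bullet> v'\<bar> < \<bar>(u \<bullet> e 0) * (v \<bullet> e 0)\<bar>" by (simp add: abs_mult)
  show ?thesis
  proof (cases "v \<bullet> e 0 > 0")
    case True
    then have "(u \<bullet> e 0) * (v \<bullet> e 0) > 0" using assms(3) by simp
    then show ?thesis using cs 1(3) True by simp
  next
    case False
    then have "(u \<bullet> e 0) * (v \<bullet> e 0) \<le> 0" using assms(3) by (simp add: mult_le_0_iff)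
    then show ?thesis using cs 1(3) False by simp
  qed
qed

end

text \<open>The isometry taking a frame to the standard coordinates; \<open>b_future\<close> ensures
  that it preserves the sheet \<open>x 0 > 0\<close>.\<close>

locale lorentz_frame_coordinates = lorentz_coordinates e "3 * n" + lorentz_frame "e 0" "span (e ` {..<3 * n})" n b
  for e :: "nat \<Rightarrow> 'w::euclidean_space" and n :: nat and b :: "nat \<Rightarrow> 'w" +
  assumes b_future: "b 0 \<bullet> e 0 > 0"
begin

definition \<Phi> :: "(nat \<Rightarrow> real) \<Rightarrow> nat \<Rightarrow> real" where
  "\<Phi> x = (\<lambda>i. if i < 3 * n then (if i = 0 then -1 else 1) * lor (e 0) (emb x) (b i) else 0)"

definition comb :: "(nat \<Rightarrow> real) \<Rightarrow> 'w" where "comb q = (\<Sum>i<3 * n. q i *\<^sub>R b i)"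

lemma comb_\<Phi>: "comb (\<Phi> x) = emb x"
  unfolding comb_def \<Phi>_def using frame_expand[OF emb_R, of x] by (simp cong: sum.cong_simp)

lemma comb_R: "comb q \<in> R"
  unfolding comb_def using bR by (intro span_sum span_scale) auto

lemma lor_comb: "i < 3 * n \<Longrightarrow> lor (e 0) (comb q) (b i) = (if i = 0 then -1 else 1) * q i"
  unfolding comb_def using lor_sum[of "{..<3*n}" i q] by simp

lemma \<Phi>_inverse:
  assumes "\<And>i. 3 * n \<le> i \<Longrightarrow> q i = 0" "emb x = comb q" shows "\<Phi> x = q"
  using assms lor_comb[of _ q] by (auto simp: \<Phi>_def fun_eq_iff)

lemma lorentz_comb: "lor (e 0) (comb q) (comb r) = lorentz (3 * n) q r"
proof -
  have "lor (e 0) (comb q) (comb r) = (\<Sum>i<3 * n. r i * lor (e 0) (comb q) (b i))"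
    unfolding comb_def[of r] by (simp add: linear_sum[OF linear_lor_right] lor_simps)
  also have "\<dots> = (\<Sum>i<3 * n. (if i = 0 then -1 else 1) * q i * r i)"
    by (intro sum.cong) (auto simp: lor_comb)
  also have "\<dots> = lorentz (3 * n) q r"
    using K by (simp add: lorentz_def lessThan_atLeast0 sum.atLeast_Suc_lessThan cong: sum.cong_simp)
  finally show ?thesis .
qed

lemma lorentz_\<Phi>: "lorentz (3 * n) (\<Phi> x) (\<Phi> y) = lorentz (3 * n) x y"
  using lorentz_comb[of "\<Phi> x" "\<Phi> y"] by (simp add: comb_\<Phi> lor_emb)

lemma b0: "lor (e 0) (b 0) (b 0) = -1" using orthonormal[of 0 0] K by simp

lemma hyperbolic_iff:
  "x \<in> hyperbolic_space (-1) (3 * n - 1) \<longleftrightarrow>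
    (\<forall>i\<ge>3 * n. x i = 0) \<and> lorentz (3 * n) x x = -1 \<and> x 0 > 0"
  using K by (simp add: hyperbolic_space_def topspace_Euclidean_space)

lemma \<Phi>_future: assumes "lorentz (3 * n) x x = -1" shows "\<Phi> x 0 > 0 \<longleftrightarrow> x 0 > 0"
proof -
  have "lor (e 0) (b 0) (emb x) < 0 \<longleftrightarrow> emb x \<bullet> e 0 > 0"
    by (rule time_orientation[OF b0 _ b_future]) (simp add: lor_emb assms)
  then show ?thesis using K by (simp add: \<Phi>_def emb_inner lor_sym[of "e 0" "b 0"])
qed

lemma \<Phi>_isometry: "hyperbolic_isometry (3 * n - 1) \<Phi>"
  unfolding hyperbolic_isometry_def
proof (intro conjI ballI)
  let ?H = "hyperbolic_space (-1) (3 * n - 1)"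
  show "bij_betw \<Phi> ?H ?H"
  proof (rule bij_betwI')
    fix x y assume xy: "x \<in> ?H" "y \<in> ?H"
    show "\<Phi> x = \<Phi> y \<longleftrightarrow> x = y"
    proof
      assume "\<Phi> x = \<Phi> y"
      then have "emb x = emb y" by (metis comb_\<Phi>)
      then have "x i = y i" if "i < 3 * n" for i using emb_inner[OF that] by metis
      then show "x = y" using xy unfolding hyperbolic_iff by (intro ext) (metis not_less)
    qed simp
  next
    fix x assume x: "x \<in> ?H"
    then show "\<Phi> x \<in> ?H" using \<Phi>_future[of x] unfolding hyperbolic_iff by (simp add: lorentz_\<Phi>) (simp add: \<Phi>_def)
  next
    fix q assume q: "q \<in> ?H"
    define x where "x = (\<lambda>i. if i < 3 * n then comb q \<bullet> e i else 0)"
    have ex: "emb x = comb q" unfolding x_def by (rule emb_coordinates[OF comb_R])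
    have \<Phi>x: "\<Phi> x = q" using q ex unfolding hyperbolic_iff by (intro \<Phi>_inverse) auto
    have "lorentz (3 * n) x x = -1" using q lorentz_\<Phi>[of x x] unfolding \<Phi>x hyperbolic_iff by simp
    then have "x \<in> ?H" using q \<Phi>_future[of x] unfolding \<Phi>x hyperbolic_iff by (simp add: x_def)
    then show "\<exists>x\<in>?H. q = \<Phi> x" using \<Phi>x by blast
  qed
  show "hyperbolic_dist (3 * n - 1) (\<Phi> x) (\<Phi> y) = hyperbolic_dist (3 * n - 1) x y" for x y
    using K by (simp add: hyperbolic_dist_def lorentz_\<Phi>)
qed

lemma continuous_comb: "continuous_map (Euclidean_space (3 * n)) euclidean comb"
proof -
  have "continuous_on UNIV comb" unfolding comb_def
    by (intro continuous_on_sum continuous_on_scaleR continuous_on_product_coordinates continuous_on_const)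
  then have "continuous_map (powertop_real UNIV) euclidean comb"
    by (simp add: euclidean_product_topology)
  then show ?thesis unfolding Euclidean_space_def by (rule continuous_map_from_subtopology)
qed

lemma lor_block_comb:
  assumes "j < n"
  shows "lor (e 0) (block_proj (e 0) b j (comb q)) (comb q) =
    (\<Sum>i\<in>{3*j..<3*j+3}. (if i = 0 then -1 else 1) * (q i)\<^sup>2)"
  unfolding lor_block_proj_self using assms by (intro sum.cong) (auto simp: lor_comb power2_eq_square)

end

definition F_rep :: "(nat \<Rightarrow> 'w::euclidean_space) \<Rightarrow> nat \<Rightarrow> ('a \<Rightarrow> nat \<Rightarrow> real) \<Rightarrow> ('a, 'e) chart \<Rightarrow> 'e \<Rightarrow> 'w" where
  "F_rep e K f c z = lorentz_coordinates.emb e K (f (chart_inv c z))"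

text \<open>Blocks are counted from 0 here and from 1 in \<open>extrinsic_product\<close>, hence
  \<open>c (Suc j)\<close>. The sheet of the hyperbolic factor is selected by the time coordinate
  \<open>q 0\<close> of the whole vector.\<close>

lemma extrinsic_product_iff:
  assumes "0 < n"
  shows "q \<in> extrinsic_product n c \<longleftrightarrow> (\<forall>i\<ge>3 * n. q i = 0) \<and> q 0 > 0 \<and>
    (\<forall>j<n. (\<Sum>i\<in>{3*j..<3*j+3}. (if i = 0 then -1 else 1) * (q i)\<^sup>2) = 1 / c (Suc j))"
proof -
  have lt3: "{..<Suc 2} = {0, 1, 2::nat}" and at3: "{1..<Suc 2} = {1, 2::nat}" by auto
  have hyp: "x \<in> hyperbolic_space a 2 \<longleftrightarrow> (\<forall>i\<ge>3. x i = 0) \<and> - (x 0)\<^sup>2 + (x 1)\<^sup>2 + (x 2)\<^sup>2 = 1 / a \<and> x 0 > 0" for x a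
    unfolding hyperbolic_space_def lorentz_def at3 by (simp add: topspace_Euclidean_space power2_eq_square algebra_simps)
  have sph: "x \<in> round_sphere a 2 \<longleftrightarrow> (\<forall>i\<ge>3. x i = 0) \<and> (x 0)\<^sup>2 + (x 1)\<^sup>2 + (x 2)\<^sup>2 = 1 / a" for x a
    unfolding round_sphere_def lt3 by (simp add: topspace_Euclidean_space add.assoc)
  have 1: "(3 * j) div 3 = j" "(3 * j) mod 3 = 0" "(3 * j + 1) div 3 = j" "(3 * j + 1) mod 3 = 1"
    "(3 * j + 2) div 3 = j" "(3 * j + 2) mod 3 = 2" for j :: nat by presburger+
  show ?thesis
  proof
    assume "q \<in> extrinsic_product n c"
    then obtain x where q: "q = concat_blocks n x"
      and x: "x \<in> (\<Pi>\<^sub>E j\<in>{1..n}. if j = 1 then hyperbolic_space (c 1) 2 else round_sphere (c j) 2)"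
      by (auto simp: extrinsic_product_def)
    have xj: "x (Suc j) \<in> (if j = 0 then hyperbolic_space (c 1) 2 else round_sphere (c (Suc j)) 2)" if "j < n" for j
      using PiE_mem[OF x, of "Suc j"] that by simp
    have qj: "q (3 * j) = x (Suc j) 0" "q (3 * j + 1) = x (Suc j) 1" "q (3 * j + 2) = x (Suc j) 2" if "j < n" for j
      unfolding q concat_blocks_def 1 using that by simp_all
    show "(\<forall>i\<ge>3 * n. q i = 0) \<and> q 0 > 0 \<and>
      (\<forall>j<n. (\<Sum>i\<in>{3*j..<3*j+3}. (if i = 0 then -1 else 1) * (q i)\<^sup>2) = 1 / c (Suc j))"
    proof (intro conjI allI impI)
      show "q i = 0" if "3 * n \<le> i" for i using that by (simp add: q concat_blocks_def)
      show "q 0 > 0" using xj[OF assms] qj(1)[OF assms] by (simp add: hyp)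
      show "(\<Sum>i\<in>{3*j..<3*j+3}. (if i = 0 then -1 else 1) * (q i)\<^sup>2) = 1 / c (Suc j)" if "j < n" for j
        unfolding sum_block qj[OF that] using xj[OF that] by (cases "j = 0") (simp_all add: hyp sph)
    qed
  next
    assume q: "(\<forall>i\<ge>3 * n. q i = 0) \<and> q 0 > 0 \<and>
      (\<forall>j<n. (\<Sum>i\<in>{3*j..<3*j+3}. (if i = 0 then -1 else 1) * (q i)\<^sup>2) = 1 / c (Suc j))"
    define x where "x = (\<lambda>j\<in>{1..n}. \<lambda>k. if k < 3 then q (3 * (j - 1) + k) else 0)"
    have "x j \<in> (if j = 1 then hyperbolic_space (c 1) 2 else round_sphere (c j) 2)" if j: "j \<in> {1..n}" for j
    proof -
      obtain i where i: "j = Suc i" "i < n" using j by (cases j) auto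
      have "(\<Sum>m\<in>{3*i..<3*i+3}. (if m = 0 then -1 else 1) * (q m)\<^sup>2) = 1 / c (Suc i)" using q i by blast
      then show ?thesis
        using q j unfolding sum_block i by (cases "i = 0") (simp_all add: x_def hyp sph)
    qed
    moreover have "q = concat_blocks n x"
    proof
      fix i
      show "q i = concat_blocks n x i"
      proof (cases "i < 3 * n")
        case True
        then have d: "i div 3 < n" by auto
        have "3 * (i div 3) + i mod 3 = i" by simp
        then show ?thesis using True by (simp add: concat_blocks_def x_def Suc_le_eq d)
      qed (use q in \<open>simp add: concat_blocks_def\<close>)
    qed
    moreover have "x \<in> extensional {1..n}" by (simp add: x_def)
    ultimately show "q \<in> extrinsic_product n c"
      unfolding extrinsic_product_def by (intro image_eqI[of _ _ x] PiE_I) (auto simp: extensional_def)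
  qed
qed

section \<open>From the manifold to its charts\<close>

context smooth_manifold
begin

lemma chart_at_in: assumes "x \<in> topspace M" shows "chart_at x \<in> charts_at x"
proof -
  have "x \<in> (\<Union>c\<in>A. fst c)" using assms cover by simp
  then have "\<exists>c. c \<in> charts_at x" unfolding charts_at_def by blast
  then show ?thesis unfolding chart_at_def by (rule someI_ex)
qed

text \<open>\<open>differential\<close> uses the arbitrarily chosen chart at \<open>x\<close>; the
  chain rule for the transition map frees it from this choice.\<close>

lemma differential_tangent_of:
  assumes h: "smooth_fun h" and c: "c \<in> charts_at x"
  shows "differential h x (tangent_of c x u) = frechet_derivative (h \<circ> chart_inv c) (at (snd c x)) u"
proof -
  define d where "d = chart_at x"
  have cA: "c \<in> A" "x \<in> fst c" using c by (auto simp: charts_at_def)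
  have d: "d \<in> charts_at x" unfolding d_def using chart_at_in chartD(5)[OF cA(1)] cA(2) by blast
  have dA: "d \<in> A" "x \<in> fst d" using d by (auto simp: charts_at_def)
  let ?t = "frechet_derivative (transition c d) (at (snd c x))"
  let ?h = "frechet_derivative (h \<circ> chart_inv d) (at (snd d x))"
  have "smooth_on (h \<circ> chart_inv d) (snd d ` fst d)" using h dA by (simp add: smooth_fun_def)
  then have "(h \<circ> chart_inv d has_derivative ?h) (at (snd d x))"
    using dA by (intro smooth_on_has_derivative) auto
  moreover have "transition c d (snd c x) = snd d x" using cA by (simp add: transition_def chart_inv_left)
  ultimately have "((h \<circ> chart_inv d) \<circ> transition c d has_derivative ?h \<circ> ?t) (at (snd c x))"
    using diff_chain_at[OF transition_deriv[OF c d]] by simp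
  moreover have "((h \<circ> chart_inv d) \<circ> transition c d) y = (h \<circ> chart_inv c) y" if "y \<in> snd c ` (fst c \<inter> fst d)" for y
    using that cA dA by (auto simp: transition_def chart_inv_left)
  ultimately have "(h \<circ> chart_inv c has_derivative ?h \<circ> ?t) (at (snd c x))"
    using open_overlap[OF cA(1) dA(1)] cA dA by (auto intro: has_derivative_transform_within_open)
  from frechet_derivativeI[OF this, of u] show ?thesis
    using d by (simp add: differential_def tangent_of_def flip: d_def)
qed

lemma open_preimage_chart_inv:
  assumes "c \<in> A" "openin M V" shows "open {z \<in> snd c ` fst c. chart_inv c z \<in> V}"
proof -
  have "{z \<in> snd c ` fst c. chart_inv c z \<in> V} = snd c ` (fst c \<inter> V)"
    using chart_inv_left[OF assms(1)] by auto
  moreover have "openin (subtopology M (fst c)) (fst c \<inter> V)"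
    using assms(2) by (simp add: openin_subtopology_Int2)
  then have "openin (top_of_set (snd c ` fst c)) (snd c ` (fst c \<inter> V))"
    using chartD(4)[OF assms(1)] homeomorphic_imp_open_map open_map_def by blast
  ultimately show ?thesis using chartD(2)[OF assms(1)] openin_open_trans by metis
qed

lemma openin_chart_inv_image:
  assumes "c \<in> A" "open W" "W \<subseteq> snd c ` fst c" shows "openin M (chart_inv c ` W)"
proof -
  have "chart_inv c ` W = {x \<in> topspace (subtopology M (fst c)). snd c x \<in> W}"
  proof (intro set_eqI iffI)
    fix x assume "x \<in> chart_inv c ` W"
    then obtain z where z: "x = chart_inv c z" "z \<in> W" by blast
    then obtain x' where "x' \<in> fst c" "z = snd c x'" using assms(3) by blast
    then show "x \<in> {x \<in> topspace (subtopology M (fst c)). snd c x \<in> W}"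
      using z chart_inv_left[OF assms(1)] chartD(5)[OF assms(1)] by auto
  next
    fix x assume "x \<in> {x \<in> topspace (subtopology M (fst c)). snd c x \<in> W}"
    then have "x \<in> fst c" "snd c x \<in> W" by auto
    then show "x \<in> chart_inv c ` W" using chart_inv_left[OF assms(1)] by (metis imageI)
  qed
  moreover have "openin (subtopology M (fst c)) {x \<in> topspace (subtopology M (fst c)). snd c x \<in> W}"
  proof (rule openin_continuous_map_preimage)
    show "continuous_map (subtopology M (fst c)) (top_of_set (snd c ` fst c)) (snd c)"
      using chartD(4)[OF assms(1)] homeomorphic_imp_continuous_map by blast
    show "openin (top_of_set (snd c ` fst c)) W"
      using assms chartD(2)[OF assms(1)] by (simp add: open_subset)
  qed
  ultimately show ?thesis using chartD(1)[OF assms(1)] openin_trans_full by metis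
qed

end

context kaehler_manifold
begin

definition J_rep :: "('a, 'e) chart \<Rightarrow> 'e \<Rightarrow> 'e \<Rightarrow> 'e" where
  "J_rep c z w = J (chart_inv c z) (tangent_of c (chart_inv c z) w) c"

lemma chart_point:
  assumes "c \<in> A" "z \<in> snd c ` fst c"
  shows "c \<in> charts_at (chart_inv c z)" "chart_inv c z \<in> topspace M" "snd c (chart_inv c z) = z"
  using assms chart_inv_left[OF assms(1)] chartD(5)[OF assms(1)] by (auto simp: charts_at_def)

lemma tangent_of_J_rep:
  assumes "c \<in> A" "z \<in> snd c ` fst c"
  shows "tangent_of c (chart_inv c z) (J_rep c z w) = J (chart_inv c z) (tangent_of c (chart_inv c z) w)"
  unfolding J_rep_def using chart_point[OF assms] by (intro tangent_of_eq J_closed tangent_of_in)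

lemma tangent_of_inj:
  assumes "c \<in> charts_at x" "tangent_of c x u = tangent_of c x v" shows "u = v"
  using tangent_of_self[OF assms(1)] assms(2) by metis

lemma tangent_of_add: "c \<in> charts_at x \<Longrightarrow> tangent_of c x (u + v) = tangent_of c x u + tangent_of c x v"
  and tangent_of_scale: "c \<in> charts_at x \<Longrightarrow> tangent_of c x (a *\<^sub>R u) = a *\<^sub>R tangent_of c x u"
proof -
  assume c: "c \<in> charts_at x"
  show "tangent_of c x (u + v) = tangent_of c x u + tangent_of c x v" using tangent_of_lin[OF c, of 1 u v] by simp
  have "tangent_of c x 0 = 0" using tangent_of_lin[OF c, of 1 0 0] by simp
  then show "tangent_of c x (a *\<^sub>R u) = a *\<^sub>R tangent_of c x u" using tangent_of_lin[OF c, of a u 0] by simp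
qed

context
  fixes f :: "'a \<Rightarrow> nat \<Rightarrow> real" and n p :: nat and e :: "nat \<Rightarrow> 'w::euclidean_space"
  assumes f: "isometric_immersion_hyperbolic f (2 * n + p)"
    and dims: "DIM('e) = 2 * n" "p < n"
    and e: "lorentz_coordinates e (2 * n + p + 1)"
begin

interpretation lc: lorentz_coordinates e "2 * n + p + 1" by (rule e)

lemma F_rep_smooth: assumes "c \<in> A" shows "smooth_on (F_rep e (2 * n + p + 1) f c) (snd c ` fst c)"
proof -
  have "smooth_on (\<lambda>z. f (chart_inv c z) i) (snd c ` fst c)" for i
    using f assms by (auto simp: isometric_immersion_hyperbolic_def smooth_fun_def o_def)
  then show ?thesis unfolding F_rep_def lc.emb_def
    by (intro smooth_on_sum smooth_on_linear[OF bounded_linear_scaleR_left] chartD(2)[OF assms])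
qed

lemma metric_rep_F_rep:
  assumes c: "c \<in> A" "z \<in> snd c ` fst c"
  shows "metric_rep c z u v = lor (e 0) (frechet_derivative (F_rep e (2 * n + p + 1) f c) (at z) u) (frechet_derivative (F_rep e (2 * n + p + 1) f c) (at z) v)"
proof -
  note cp = chart_point[OF c]
  have sm: "smooth_fun (\<lambda>x. f x i)" for i using f by (simp add: isometric_immersion_hyperbolic_def)
  have d: "frechet_derivative (F_rep e (2 * n + p + 1) f c) (at z) u = lc.emb (\<lambda>i. differential (\<lambda>x. f x i) (chart_inv c z) (tangent_of c (chart_inv c z) u))" for u
  proof -
    have fi: "((\<lambda>y. f (chart_inv c y) i) has_derivative frechet_derivative ((\<lambda>x. f x i) \<circ> chart_inv c) (at z)) (at z)" for i
      using smooth_on_has_derivative[of "(\<lambda>x. f x i) \<circ> chart_inv c" "snd c ` fst c" z] sm[of i] c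
      by (simp add: smooth_fun_def o_def)
    have "(F_rep e (2 * n + p + 1) f c has_derivative (\<lambda>u. \<Sum>i<2*n+p+1. frechet_derivative ((\<lambda>x. f x i) \<circ> chart_inv c) (at z) u *\<^sub>R e i)) (at z)"
      unfolding F_rep_def lc.emb_def by (intro has_derivative_sum has_derivative_scaleR_left fi)
    from frechet_derivativeI[OF this, of u] show ?thesis
      using differential_tangent_of[OF sm cp(1), of _ u] cp(3) unfolding lc.emb_def by simp
  qed
  have "lorentz (Suc (2 * n + p)) (\<lambda>i. differential (\<lambda>x. f x i) (chart_inv c z) (tangent_of c (chart_inv c z) u))
    (\<lambda>i. differential (\<lambda>x. f x i) (chart_inv c z) (tangent_of c (chart_inv c z) v)) = metric_rep c z u v"
    using f cp(2) tangent_of_in[OF cp(1)] unfolding metric_rep_def isometric_immersion_hyperbolic_def by blast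
  then show ?thesis unfolding d lc.lor_emb by simp
qed

text \<open>The isometry condition identifies \<open>metric_rep\<close> with the form induced by
  \<open>F_rep\<close>; the properties of the Christoffel symbols are those of their definite
  description, justified by \<open>christoffel_ex1\<close>.\<close>

theorem kaehler_chart_rep:
  assumes c: "c \<in> A"
  shows "kaehler_chart (snd c ` fst c) (F_rep e (2 * n + p + 1) f c) (J_rep c) (christoffel c) (e 0) (span (e ` {..<2 * n + p + 1})) n p"
proof
  let ?U = "snd c ` fst c"
  show U: "open ?U" by (rule chartD(2)[OF c])
  show "e 0 \<in> Basis" using lc.e_Basis lc.K by (auto simp: image_subset_iff)
  show "smooth_on (F_rep e (2 * n + p + 1) f c) ?U" by (rule F_rep_smooth[OF c])
  show "subspace (span (e ` {..<2 * n + p + 1}))" by simp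
  show "dim (span (e ` {..<2 * n + p + 1})) = 2 * n + p + 1" by (rule lc.dim_R)
  show "DIM('e) = 2 * n" "p < n" by (rule dims)+
  show "smooth_on (\<lambda>z. J_rep c z v) ?U" for v unfolding J_rep_def by (rule J_smooth[OF c])
  fix z assume z: "z \<in> ?U"
  note cp = chart_point[OF c z] and mr = metric_rep_F_rep[OF c z]
  note tin = tangent_of_in[OF cp(1)]
  show "F_rep e (2 * n + p + 1) f c z \<in> span (e ` {..<2 * n + p + 1})" unfolding F_rep_def by (rule lc.emb_R)
  have "f (chart_inv c z) \<in> hyperbolic_space (-1) (2 * n + p)" using f cp(2) by (auto simp: isometric_immersion_hyperbolic_def)
  then show "lor (e 0) (F_rep e (2 * n + p + 1) f c z) (F_rep e (2 * n + p + 1) f c z) = - 1"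
    unfolding F_rep_def lc.lor_emb by (simp add: hyperbolic_space_def)
  show "0 < lor (e 0) (frechet_derivative (F_rep e (2 * n + p + 1) f c) (at z) u) (frechet_derivative (F_rep e (2 * n + p + 1) f c) (at z) u)" if "u \<noteq> 0" for u
  proof -
    have "tangent_of c (chart_inv c z) u \<noteq> 0" using tangent_of_self[OF cp(1), of u] that by auto
    then show ?thesis unfolding mr[symmetric] metric_rep_def by (rule metric_pos[OF cp(2) tin])
  qed
  show "J_rep c z (b1 + b2) = J_rep c z b1 + J_rep c z b2" for b1 b2
    using J_linear[OF cp(2) tin tin, of 1 b1 b2] by (simp add: J_rep_def tangent_of_add[OF cp(1)] plus_fun_def)
  show "J_rep c z (r *\<^sub>R b) = r *\<^sub>R J_rep c z b" for r b
  proof (rule tangent_of_inj[OF cp(1)])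
    have "J (chart_inv c z) (tangent_of c (chart_inv c z) 0) = 0"
      using J_linear[OF cp(2) tin tin, of 1 0 0] tangent_of_lin[OF cp(1), of 1 0 0] by simp
    then show "tangent_of c (chart_inv c z) (J_rep c z (r *\<^sub>R b)) = tangent_of c (chart_inv c z) (r *\<^sub>R J_rep c z b)"
      using J_linear[OF cp(2) tin tin, of r b 0] tangent_of_lin[OF cp(1), of 1 0 0]
      by (simp add: tangent_of_J_rep[OF c z] tangent_of_scale[OF cp(1)])
  qed
  show "J_rep c z (J_rep c z u) = - u" for u
  proof (rule tangent_of_inj[OF cp(1)])
    show "tangent_of c (chart_inv c z) (J_rep c z (J_rep c z u)) = tangent_of c (chart_inv c z) (- u)"
      using tangent_of_scale[OF cp(1), of "-1" u] by (simp add: tangent_of_J_rep[OF c z] J_square[OF cp(2) tin])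
  qed
  show "lor (e 0) (frechet_derivative (F_rep e (2 * n + p + 1) f c) (at z) (J_rep c z u)) (frechet_derivative (F_rep e (2 * n + p + 1) f c) (at z) (J_rep c z v)) =
    lor (e 0) (frechet_derivative (F_rep e (2 * n + p + 1) f c) (at z) u) (frechet_derivative (F_rep e (2 * n + p + 1) f c) (at z) v)" for u v
    unfolding mr[symmetric] metric_rep_def tangent_of_J_rep[OF c z] by (rule J_orthogonal[OF cp(2) tin tin])
  note ch = theI'[OF christoffel_ex1[OF c z], folded christoffel_def]
  show "christoffel c z u v = christoffel c z v u" for u v using ch by blast
  show "frechet_derivative (\<lambda>z. lor (e 0) (frechet_derivative (F_rep e (2 * n + p + 1) f c) (at z) v) (frechet_derivative (F_rep e (2 * n + p + 1) f c) (at z) w)) (at z) u =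
    lor (e 0) (frechet_derivative (F_rep e (2 * n + p + 1) f c) (at z) (christoffel c z u v)) (frechet_derivative (F_rep e (2 * n + p + 1) f c) (at z) w) +
    lor (e 0) (frechet_derivative (F_rep e (2 * n + p + 1) f c) (at z) v) (frechet_derivative (F_rep e (2 * n + p + 1) f c) (at z) (christoffel c z u w))" for u v w
  proof -
    have "smooth_on (\<lambda>z. metric_rep c z v w) ?U" unfolding metric_rep_def by (rule metric_smooth[OF c])
    then have "frechet_derivative (\<lambda>z. lor (e 0) (frechet_derivative (F_rep e (2 * n + p + 1) f c) (at z) v) (frechet_derivative (F_rep e (2 * n + p + 1) f c) (at z) w)) (at z) u =
      frechet_derivative (\<lambda>z. metric_rep c z v w) (at z) u"
      by (rule frechet_derivative_cong[OF U z]) (rule metric_rep_F_rep[OF c])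
    then show ?thesis unfolding mr[symmetric] using ch by simp
  qed
  show "frechet_derivative (\<lambda>z. J_rep c z v) (at z) u + christoffel c z u (J_rep c z v) = J_rep c z (christoffel c z u v)" for u v
    using J_parallel[OF c z, of v u] by (simp add: J_rep_def Let_def)
qed

end

end

section \<open>Globalisation over the connected manifold\<close>

theorem theorem2:
  fixes M :: "'a topology" and A :: "('a, 'e::euclidean_space) chart set"
    and g :: "'a \<Rightarrow> ('a, 'e) tangent \<Rightarrow> ('a, 'e) tangent \<Rightarrow> real"
    and J :: "'a \<Rightarrow> ('a, 'e) tangent \<Rightarrow> ('a, 'e) tangent"
    and f :: "'a \<Rightarrow> nat \<Rightarrow> real"
    and n p m :: nat and x0 :: 'a and V :: "('a, 'e) tangent set"
  assumes "n \<ge> 2" and "p \<le> n - 1"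
    and "kaehler_manifold M A g J" and "DIM('e) = 2 * n"
    and "riemannian_manifold.isometric_immersion_hyperbolic M A g f (2 * n + p)"
    and "x0 \<in> topspace M"
    and "kaehler_manifold.complex_subspace_at A J x0 V" and "dim V = 2 * m" and "m \<ge> p"
    and "\<And>S. S \<in> V \<Longrightarrow> S \<noteq> 0 \<Longrightarrow>
           riemannian_manifold.sectional_curvature A g x0 S (J x0 S) > 0"
  shows "p = n - 1 \<and>
    (\<exists>c \<Phi>. c 1 < 0 \<and> (\<forall>j\<in>{2..n}. c j > 0) \<and> (\<Sum>j=1..n. 1 / c j) = -1 \<and>
       hyperbolic_isometry (3 * n - 1) \<Phi> \<and>
       openin (subtopology (Euclidean_space (3 * n)) (extrinsic_product n c))
         (\<Phi> ` f ` topspace M))"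
proof -
  interpret kaehler_manifold M A g J by (rule assms(3))
  have pn: "p < n" and n0: "0 < n" using assms(1,2) by auto
  \<comment> \<open>The ambient space needs \<open>2 * n + p + 1 \<le> 3 * n\<close> dimensions; the
    product of the model type with itself offers \<open>4 * n\<close>.\<close>
  obtain e where e0: "bij_betw e {0..<card (Basis :: ('e \<times> 'e) set)} (Basis :: ('e \<times> 'e) set)"
    using ex_bij_betw_nat_finite[OF finite_Basis] by blast
  have cB: "card (Basis :: ('e \<times> 'e) set) = 4 * n" using assms(4) by simp
  have lcN: "lorentz_coordinates e (2 * n + p + 1)"
  proof
    have sub: "{..<2 * n + p + 1} \<subseteq> {0..<card (Basis :: ('e \<times> 'e) set)}" unfolding cB using pn by auto
    show "inj_on e {..<2 * n + p + 1}" using e0 sub by (meson bij_betw_def inj_on_subset)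
    show "e ` {..<2 * n + p + 1} \<subseteq> Basis" using e0 sub by (metis bij_betw_def image_mono)
  qed simp
  define K where "K = 2 * n + p + 1"
  note kc = kaehler_chart_rep[OF assms(5,4) pn lcN, folded K_def]
  note mr = metric_rep_F_rep[OF assms(5,4) pn lcN, folded K_def]
  define c0 where "c0 = chart_at x0"
  define y0 where "y0 = snd c0 x0"
  have c0: "c0 \<in> charts_at x0" unfolding c0_def by (rule chart_at_in[OF assms(6)])
  have c0A: "c0 \<in> A" "x0 \<in> fst c0" using c0 by (auto simp: charts_at_def)
  have y0: "y0 \<in> snd c0 ` fst c0" "chart_inv c0 y0 = x0"
    using c0A by (auto simp: y0_def chart_inv_left)
  interpret k0: kaehler_chart "snd c0 ` fst c0" "F_rep e (K) f c0" "J_rep c0" "christoffel c0"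
    "e 0" "span (e ` {..<K})" n p by (rule kc[OF c0A(1)])
  define T where "T = tangent_of c0 x0"
  have T_in: "T u \<in> tangent_space x0" for u unfolding T_def by (rule tangent_of_in[OF c0])
  have T_add: "T (u + v) = T u + T v" and T_scale: "T (a *\<^sub>R u) = a *\<^sub>R T u" and T_c: "T u c0 = u" for u v a
    unfolding T_def by (rule tangent_of_add[OF c0] tangent_of_scale[OF c0] tangent_of_self[OF c0])+
  have T_J: "T (J_rep c0 y0 u) = J x0 (T u)" for u
    using tangent_of_J_rep[OF c0A(1) y0(1), of u] by (simp add: y0(2) T_def)
  have T_g: "g x0 (T u) (T v) = k0.g y0 u v" for u v
    using mr[OF c0A(1) y0(1), of u v] by (simp add: metric_rep_def y0(2) T_def k0.g_def k0.dF_def)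
  have V: "subspace V" "V \<subseteq> tangent_space x0" "J x0 ` V \<subseteq> V"
    using assms(7) by (auto simp: complex_subspace_at_def)
  define V' where "V' = {u. T u \<in> V}"
  have T0: "T 0 = 0" using T_scale[of 0 0] by simp
  have subV': "subspace V'"
    using V(1) by (auto simp: V'_def subspace_def T_add T_scale T0)
  have JV': "J_rep c0 y0 v \<in> V'" if "v \<in> V'" for v using that V(3) by (auto simp: V'_def T_J)
  \<comment> \<open>Tangent vectors are functions and do not form a Euclidean type, so the dimension
    is transferred by a basis and the evaluation at \<open>c0\<close>, which is linear and injective
    on tangent vectors.\<close>
  have dimV': "2 * p \<le> dim V'"
  proof -
    obtain B0 where B0: "B0 \<subseteq> V" "independent B0" "V \<subseteq> span B0" "card B0 = dim V"
      by (rule basis_exists)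
    let ?L = "\<lambda>v :: ('a, 'e) tangent. v c0"
    have L: "linear ?L" by (intro linearI) (simp_all add: scaleR_fun_def)
    have inj: "inj_on ?L (span B0)"
    proof (rule inj_onI)
      fix v w assume vw: "v \<in> span B0" "w \<in> span B0" "v c0 = w c0"
      have "span B0 \<subseteq> V" using B0(1) V(1) by (rule span_minimal)
      then have "v \<in> tangent_space x0" "w \<in> tangent_space x0" using vw V(2) by auto
      then show "v = w" using tangent_of_eq[OF _ c0] vw(3) by metis
    qed
    have "independent (?L ` B0)" by (rule linear_independent_injective_image[OF L B0(2) inj])
    moreover have "?L ` B0 \<subseteq> V'"
    proof (intro image_subsetI)
      fix v assume v: "v \<in> B0"
      then have "T (v c0) = v" unfolding T_def using B0(1) V(2) by (intro tangent_of_eq[OF _ c0]) auto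
      then show "v c0 \<in> V'" using v B0(1) by (auto simp: V'_def)
    qed
    ultimately have "card (?L ` B0) \<le> dim V'" by (intro independent_card_le_dim)
    moreover have "card (?L ` B0) = card B0" using inj span_superset by (intro card_image) (rule inj_on_subset)
    ultimately show ?thesis using B0(4) assms(8,9) by simp
  qed
  have pos: "k0.g y0 (k0.curv y0 S (J_rep c0 y0 S) (J_rep c0 y0 S)) S > 0" if S: "S \<in> V'" "S \<noteq> 0" for S
  proof -
    interpret h: hermitian "k0.g y0" "J_rep c0 y0" by (rule k0.hermitian[OF y0(1)])
    let ?S' = "J_rep c0 y0 S"
    have "T S \<noteq> 0" using T_c[of S] S(2) by auto
    then have "sectional_curvature x0 (T S) (T ?S') > 0" using assms(10)[of "T S"] S(1) by (simp add: V'_def T_J)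
    moreover have "curvature x0 (T S) (T ?S') (T ?S') = T (k0.curv y0 S ?S' ?S')"
      unfolding curvature_def Let_def c0_def[symmetric] y0_def[symmetric] T_c k0.curv_def curvature_rep_def T_def[symmetric] ..
    \<comment> \<open>\<open>S\<close> and \<open>J S\<close> are orthogonal of equal length, so the
      denominator of the sectional curvature is the square of \<open>g S S\<close>.\<close>
    ultimately have "k0.g y0 (k0.curv y0 S ?S' ?S') S / (k0.g y0 S S * k0.g y0 S S) > 0"
      by (simp add: sectional_curvature_def T_g h.g_J_self h.J_orthogonal)
    moreover have "k0.g y0 S S * k0.g y0 S S > 0" using h.g_pos[OF S(2)] by simp
    ultimately show ?thesis by (simp add: zero_less_divide_iff)
  qed
  obtain b c where np: "n = Suc p" and fr: "lorentz_frame (e 0) (span (e ` {..<K})) n b"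
    and bF: "lor (e 0) (b 0) (F_rep e (K) f c0 y0) < 0"
    and csgn: "\<And>j. j < n \<Longrightarrow> if j = 0 then c j < 0 else c j > (0::real)" and csum: "(\<Sum>j<n. 1 / c j) = -1"
    and c1: "\<And>j u. j < n \<Longrightarrow> lor (e 0) (block_proj (e 0) b j (F_rep e (K) f c0 y0)) (k0.dF y0 u) = 0"
    and c2: "\<And>j u v. j < n \<Longrightarrow> lor (e 0) (block_proj (e 0) b j (F_rep e (K) f c0 y0)) (k0.ddF y0 u v) =
        - lor (e 0) (block_proj (e 0) b j (k0.dF y0 u)) (k0.dF y0 v)"
    and c3: "\<And>j. j < n \<Longrightarrow> lor (e 0) (block_proj (e 0) b j (F_rep e (K) f c0 y0)) (F_rep e (K) f c0 y0) = 1 / c j"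
  proof (rule k0.frame_at[OF y0(1) subV' _ dimV'])
    show "J_rep c0 y0 v \<in> V'" if v: "v \<in> V'" for v by (rule JV'[OF v])
    show "k0.g y0 (k0.curv y0 S (J_rep c0 y0 S) (J_rep c0 y0 S)) S > 0" if S: "S \<in> V'" "S \<noteq> 0" for S
      by (rule pos[OF S])
  qed (rule that)
  have N3: "K = 3 * n" using np by (simp add: K_def)
  note lc3 = lcN[folded K_def, unfolded N3] and kc3 = kc[unfolded N3] and fr3 = fr[unfolded N3]
  interpret lc: lorentz_coordinates e "3 * n" by (rule lc3)
  interpret fr: lorentz_frame "e 0" "span (e ` {..<3 * n})" n b by (rule fr3)
  have F_emb: "F_rep e (3 * n) f d z = lc.emb (f (chart_inv d z))" for d z by (simp add: F_rep_def)
  have fH: "f x \<in> hyperbolic_space (-1) (3 * n - 1)" if "x \<in> topspace M" for x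
  proof -
    have "3 * n - 1 = 2 * n + p" using np by simp
    then show ?thesis using assms(5) that by (auto simp: isometric_immersion_hyperbolic_def)
  qed
  have fx: "\<And>i. 3 * n \<le> i \<Longrightarrow> f x i = 0" "lorentz (3 * n) (f x) (f x) = -1" "f x 0 > 0" if "x \<in> topspace M" for x
    using fH[OF that] n0 by (simp_all add: hyperbolic_space_def topspace_Euclidean_space)
  interpret lf: lorentz_frame_coordinates e n b
  proof
    have "lor (e 0) (lc.emb (f x0)) (b 0) < 0" using bF unfolding N3 F_emb y0(2) by (simp add: lor_sym)
    moreover have "lor (e 0) (lc.emb (f x0)) (lc.emb (f x0)) = -1" using fx(2)[OF assms(6)] by (simp add: lc.lor_emb)
    moreover have "lc.emb (f x0) \<bullet> e 0 > 0" using fx(3)[OF assms(6)] n0 by (simp add: lc.emb_inner)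
    moreover have "lor (e 0) (b 0) (b 0) = -1" using fr.orthonormal[of 0 0] n0 by simp
    ultimately show "b 0 \<bullet> e 0 > 0" using lc.time_orientation by blast
  qed
  have spl: "lorentz_splitting (e 0) (span (e ` {..<3 * n})) n (block_proj (e 0) b) c 0"
    by (rule fr.splitting[OF n0 csgn])
  define level where "level Q \<longleftrightarrow> (\<forall>x\<in>Q. \<forall>j<n. lor (e 0) (block_proj (e 0) b j (lc.emb (f x))) (lc.emb (f x)) = 1 / c j)" for Q
  have local: "\<exists>Q. openin M Q \<and> chart_inv d y \<in> Q \<and> level Q"
    if d: "d \<in> A" "y \<in> snd d ` fst d"
      and h1: "\<And>j u. j < n \<Longrightarrow> lor (e 0) (block_proj (e 0) b j (F_rep e (3 * n) f d y)) (kaehler_chart.dF (F_rep e (3 * n) f d) y u) = 0"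
      and h2: "\<And>j u v. j < n \<Longrightarrow> lor (e 0) (block_proj (e 0) b j (F_rep e (3 * n) f d y)) (kaehler_chart.ddF (F_rep e (3 * n) f d) y u v) =
        - lor (e 0) (block_proj (e 0) b j (kaehler_chart.dF (F_rep e (3 * n) f d) y u)) (kaehler_chart.dF (F_rep e (3 * n) f d) y v)"
      and h3: "\<And>j. j < n \<Longrightarrow> lor (e 0) (block_proj (e 0) b j (F_rep e (3 * n) f d y)) (F_rep e (3 * n) f d y) = 1 / c j"
    for d y
  proof -
    obtain r where r: "r > 0" "ball y r \<subseteq> snd d ` fst d"
      "\<And>z j. z \<in> ball y r \<Longrightarrow> j < n \<Longrightarrow> lor (e 0) (block_proj (e 0) b j (F_rep e (3 * n) f d z)) (F_rep e (3 * n) f d z) = 1 / c j"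
    proof (rule kaehler_chart.local_product[OF kc3[OF d(1)] spl np d(2)])
      show "lor (e 0) (block_proj (e 0) b j (F_rep e (3 * n) f d y)) (kaehler_chart.dF (F_rep e (3 * n) f d) y u) = 0"
        if j: "j < n" for j u by (rule h1[OF j])
      show "lor (e 0) (block_proj (e 0) b j (F_rep e (3 * n) f d y)) (kaehler_chart.ddF (F_rep e (3 * n) f d) y u v) =
        - lor (e 0) (block_proj (e 0) b j (kaehler_chart.dF (F_rep e (3 * n) f d) y u)) (kaehler_chart.dF (F_rep e (3 * n) f d) y v)"
        if j: "j < n" for j u v by (rule h2[OF j])
      show "lor (e 0) (block_proj (e 0) b j (F_rep e (3 * n) f d y)) (F_rep e (3 * n) f d y) = 1 / c j"
        if j: "j < n" for j by (rule h3[OF j])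
    qed (rule that)
    have "level (chart_inv d ` ball y r)" unfolding level_def using r(3) by (auto simp: F_emb)
    then show ?thesis
      using openin_chart_inv_image[OF d(1) open_ball r(2)] r(1) by (intro exI[of _ "chart_inv d ` ball y r"]) auto
  qed
  \<comment> \<open>The largest open set on which the product equations hold.\<close>
  define S where "S = \<Union>{Q. openin M Q \<and> level Q}"
  have S_open: "openin M S" unfolding S_def by blast
  have S_level: "level S" unfolding S_def level_def by blast
  have S_sub: "S \<subseteq> topspace M" using openin_subset[OF S_open] .
  have inS: "x \<in> S" if "openin M Q" "x \<in> Q" "level Q" for Q x using that unfolding S_def by blast
  have x0S: "x0 \<in> S"
  proof -
    have "\<exists>Q. openin M Q \<and> chart_inv c0 y0 \<in> Q \<and> level Q"
      by (rule local[OF c0A(1) y0(1)]) (rule c1[unfolded N3] c2[unfolded N3] c3[unfolded N3]; assumption)+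
    then show ?thesis using inS unfolding y0(2) by blast
  qed
  have "closedin M S"
    unfolding closedin_def
  proof (intro conjI S_sub)
    show "openin M (topspace M - S)"
    proof (subst openin_subopen, intro ballI)
      fix x assume x: "x \<in> topspace M - S"
      obtain d where d: "d \<in> A" "x \<in> fst d" using x cover by blast
      define y where "y = snd d x"
      have y: "y \<in> snd d ` fst d" "chart_inv d y = x" using d by (auto simp: y_def chart_inv_left)
      interpret kd: kaehler_chart "snd d ` fst d" "F_rep e (3 * n) f d" "J_rep d" "christoffel d"
        "e 0" "span (e ` {..<3 * n})" n p by (rule kc3[OF d(1)])
      define Z where "Z = {z \<in> snd d ` fst d. chart_inv d z \<in> S}"
      have Z: "open Z" "Z \<subseteq> snd d ` fst d" unfolding Z_def using open_preimage_chart_inv[OF d(1) S_open] by auto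
      have lev: "lor (e 0) (block_proj (e 0) b j (F_rep e (3 * n) f d z)) (F_rep e (3 * n) f d z) = 1 / c j" if "z \<in> Z" "j < n" for z j
        using S_level that unfolding level_def Z_def F_emb by blast
      \<comment> \<open>At a point of the closure the second-order conditions hold by continuity, so
        \<open>local\<close> would make \<open>x\<close> a point of \<open>S\<close>.\<close>
      have "y \<notin> closure Z"
      proof
        assume cl: "y \<in> closure Z"
        note lim = kd.conditions_at_limit[OF spl Z cl y(1)]
        have "\<exists>Q. openin M Q \<and> chart_inv d y \<in> Q \<and> level Q"
          by (rule local[OF d(1) y(1)]) (rule lim; (assumption | rule lev; assumption))+
        then show False using inS x unfolding y(2) by blast
      qed
      then have "y \<in> snd d ` fst d - closure Z" using y(1) by blast
      moreover have "open (snd d ` fst d - closure Z)" using chartD(2)[OF d(1)] by (intro open_Diff) auto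
      ultimately have "openin M (chart_inv d ` (snd d ` fst d - closure Z))" "x \<in> chart_inv d ` (snd d ` fst d - closure Z)"
        using openin_chart_inv_image[OF d(1)] y(2) by (blast, force)
      moreover have "chart_inv d ` (snd d ` fst d - closure Z) \<subseteq> topspace M - S"
        using openin_subset[OF calculation(1)] closure_subset[of Z] by (auto simp: Z_def)
      ultimately show "\<exists>T. openin M T \<and> x \<in> T \<and> T \<subseteq> topspace M - S" by blast
    qed
  qed
  then have S_all: "S = topspace M"
    using connected S_open x0S unfolding connected_space_clopen_in by blast
  have lev: "lor (e 0) (block_proj (e 0) b j (lc.emb (f x))) (lc.emb (f x)) = 1 / c j" if "x \<in> topspace M" "j < n" for x j
    using S_level that unfolding level_def S_all by blast
  \<comment> \<open>Shift from blocks \<open>0..n-1\<close> to the factors \<open>1..n\<close> of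
    the statement.\<close>
  define c' where "c' j = c (j - 1)" for j :: nat
  note ext = extrinsic_product_iff[OF n0, of _ c', unfolded c'_def diff_Suc_1]
  have img: "lf.\<Phi> (f x) \<in> extrinsic_product n c'" if x: "x \<in> topspace M" for x
  proof -
    have "lf.\<Phi> (f x) 0 > 0" using lf.\<Phi>_future[OF fx(2)[OF x]] fx(3)[OF x] by blast
    moreover have "(\<Sum>i\<in>{3*j..<3*j+3}. (if i = 0 then -1 else 1) * (lf.\<Phi> (f x) i)\<^sup>2) = 1 / c j" if "j < n" for j
      using lf.lor_block_comb[OF that, of "lf.\<Phi> (f x)"] lev[OF x that] by (simp add: lf.comb_\<Phi>)
    moreover have "lf.\<Phi> (f x) i = 0" if "3 * n \<le> i" for i using that by (simp add: lf.\<Phi>_def)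
    ultimately show ?thesis unfolding c'_def ext by blast
  qed
  have "openin (subtopology (Euclidean_space (3 * n)) (extrinsic_product n c')) (lf.\<Phi> ` f ` topspace M)"
  proof (subst openin_subopen, intro ballI)
    fix q assume "q \<in> lf.\<Phi> ` f ` topspace M"
    then obtain x where x: "x \<in> topspace M" "q = lf.\<Phi> (f x)" by blast
    obtain d where d: "d \<in> A" "x \<in> fst d" using x(1) cover by blast
    define y where "y = snd d x"
    have y: "y \<in> snd d ` fst d" "chart_inv d y = x" using d by (auto simp: y_def chart_inv_left)
    interpret kd: kaehler_chart "snd d ` fst d" "F_rep e (3 * n) f d" "J_rep d" "christoffel d"
      "e 0" "span (e ` {..<3 * n})" n p by (rule kc3[OF d(1)])
    have levU: "lor (e 0) (block_proj (e 0) b j (F_rep e (3 * n) f d z)) (F_rep e (3 * n) f d z) = 1 / c j"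
      if "z \<in> snd d ` fst d" "j < n" for z j
      using lev[OF chart_point(2)[OF d(1) that(1)] that(2)] by (simp add: F_emb)
    have d1: "lor (e 0) (block_proj (e 0) b j (F_rep e (3 * n) f d y)) (kd.dF y u) = 0" if "j < n" for j u
      by (rule kd.conditions_of_level(1)[OF spl kd.U subset_refl y(1) that]) (rule levU[OF _ that])
    have "\<exists>\<delta>>0. \<forall>w\<in>span (e ` {..<3 * n}). dist w (F_rep e (3 * n) f d y) < \<delta> \<and>
        (\<forall>j<n. lor (e 0) (block_proj (e 0) b j w) w = 1 / c j) \<longrightarrow> w \<in> F_rep e (3 * n) f d ` snd d ` fst d"
    proof (rule kd.image_locally_open[OF spl np y(1)])
      show "lor (e 0) (block_proj (e 0) b j (F_rep e (3 * n) f d y)) (kd.dF y u) = 0" if j: "j < n" for j u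
        by (rule d1[OF j])
      show "lor (e 0) (block_proj (e 0) b j (F_rep e (3 * n) f d z)) (F_rep e (3 * n) f d z) = 1 / c j"
        if z: "z \<in> snd d ` fst d" "j < n" for z j by (rule levU[OF z])
    qed
    then obtain \<delta> where \<delta>: "\<delta> > 0" "\<And>w. w \<in> span (e ` {..<3 * n}) \<Longrightarrow> dist w (F_rep e (3 * n) f d y) < \<delta> \<Longrightarrow>
        \<forall>j<n. lor (e 0) (block_proj (e 0) b j w) w = 1 / c j \<Longrightarrow> w \<in> F_rep e (3 * n) f d ` snd d ` fst d"
      by blast
    \<comment> \<open>Coordinates whose ambient vector is close to \<open>lc.emb (f x)\<close>; for
      these the level equations alone guarantee membership in the image, by the choice of
      \<open>\<delta>\<close>.\<close>
    define W where "W = {q \<in> topspace (Euclidean_space (3 * n)). lf.comb q \<in> ball (lc.emb (f x)) \<delta>}"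
    have "openin (Euclidean_space (3 * n)) W"
      unfolding W_def by (rule openin_continuous_map_preimage[OF lf.continuous_comb]) simp
    then have "openin (subtopology (Euclidean_space (3 * n)) (extrinsic_product n c')) (W \<inter> extrinsic_product n c')"
      by (rule openin_subtopology_Int)
    moreover have "q \<in> W \<inter> extrinsic_product n c'"
      using img[OF x(1)] \<delta>(1) unfolding x(2) W_def
      by (simp add: lf.comb_\<Phi> topspace_Euclidean_space) (simp add: lf.\<Phi>_def)
    moreover have "W \<inter> extrinsic_product n c' \<subseteq> lf.\<Phi> ` f ` topspace M"
    proof
      fix r assume r: "r \<in> W \<inter> extrinsic_product n c'"
      then have rE: "\<forall>i\<ge>3 * n. r i = 0"
        "\<forall>j<n. (\<Sum>i\<in>{3*j..<3*j+3}. (if i = 0 then -1 else 1) * (r i)\<^sup>2) = 1 / c j"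
        unfolding c'_def Int_iff ext by blast+
      have "lf.comb r \<in> F_rep e (3 * n) f d ` snd d ` fst d"
        using r rE(2) by (intro \<delta>(2) lf.comb_R) (auto simp: W_def F_emb y(2) dist_commute lf.lor_block_comb)
      then obtain z where z: "z \<in> snd d ` fst d" "lf.comb r = lc.emb (f (chart_inv d z))" by (auto simp: F_emb)
      have "lf.\<Phi> (f (chart_inv d z)) = r" using rE(1) z(2) by (intro lf.\<Phi>_inverse) auto
      then show "r \<in> lf.\<Phi> ` f ` topspace M" using chart_point(2)[OF d(1) z(1)] by blast
    qed
    ultimately show "\<exists>T. openin (subtopology (Euclidean_space (3 * n)) (extrinsic_product n c')) T \<and> q \<in> T \<and> T \<subseteq> lf.\<Phi> ` f ` topspace M"
      by blast
  qed
  moreover have "c' 1 < 0" using csgn[OF n0] by (simp add: c'_def)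
  moreover have "\<forall>j\<in>{2..n}. c' j > 0"
  proof
    fix j assume "j \<in> {2..n}"
    then show "c' j > 0" using csgn[of "j - 1"] by (auto simp: c'_def split: if_splits)
  qed
  moreover have "(\<Sum>j=1..n. 1 / c' j) = -1"
  proof -
    have "(\<Sum>j=1..n. 1 / c' j) = (\<Sum>j<n. 1 / c' (Suc j))"
      by (simp add: lessThan_atLeast0 sum.atLeast1_atMost_eq atLeastLessThan_eq_atLeastAtMost_diff)
    then show ?thesis using csum by (simp add: c'_def)
  qed
  moreover have "p = n - 1" using np by simp
  ultimately show ?thesis using lf.\<Phi>_isometry by blast
qed

end
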